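(* Let $f\in V$ and $r\in(0,1)$ satisfy $\limsup_{m\to\infty}\mathrm{var}_m(f)^{1/m}/r^m<\infty$. Let $p>0$ satisfy $r^{2p}e^{h_{\mathrm{top}}(\sigma_{\mathbf A})}<1$. Then: (i) $\sum_{n=1}^\infty|\lambda_n(f)|^p<\infty$. (ii) For every $q\in\mathbb N$ with $q\ge p$, $\sum_{n=1}^\infty\lambda_n(f)^q=\sum_{\omega\in\mathrm{Per}_q(\sigma_{\mathbf A})}e^{S_qf(\omega)}$. (iii) Let $k_0$ be the smallest $k\in\mathbb N\cup\{0\}$ such that $\sum_n|\lambda_n(f)|^{k+1}<\infty$ and the identity in (ii) holds for all $q\in\mathbb N$ with $q>k$. Set $E(z,k_0)=(1-z)\exp(\sum_{k=1}^{k_0}z^k/k)$. Then $\prod_{n=1}^\infty E(z\lambda_n(f),k_0)$ converges uniformly on compact subsets of $\mathbb C$, and $\zeta_f(z)^{-1}=\exp\Big(-\sum_{q=1}^{k_0}\frac{z^q}{q}\sum_{\omega\in\mathrm{Per}_q(\sigma_{\mathbf A})}e^{S_qf(\omega)}\Big)\prod_{n=1}^\infty E(z\lambda_n(f),k_0)$, i.e. the entire function on the right is the holomorphic extension to $\mathbb C$ of $\zeta_f(z)^{-1}$.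
   Context: Let $N\ge2$ and let $\mathbf A$ be an $N\times N$ zero-one aperiodic matrix (some power has all entries positive). $\Sigma_{\mathbf A}^+=\{\omega\in\{1,\dots,N\}^{\mathbb N\cup\{0\}}:\mathbf A(\omega_m\omega_{m+1})=1\ \forall m\}$ with product topology, $\sigma_{\mathbf A}$ the left shift, $h_{\mathrm{top}}(\sigma_{\mathbf A})$ its topological entropy. For $\phi:\Sigma_{\mathbf A}^+\to\mathbb C$, $\mathrm{var}_m(\phi)=\sup\{|\phi(\omega)-\phi(\omega')|:\omega_k=\omega'_k,\ 0\le k\le m-1\}$. $V$ is the set of $\phi$ with $\mathrm{var}_m(\phi)^{1/m}\to0$, topologized by the norms $\|\phi\|_\theta=\|\phi\|_\infty+[\phi]_\theta$, $\theta\in(0,1)$, where $[\phi]_\theta$ is the Lipschitz constant w.r.t. $d_\theta(\omega,\omega')=\theta^{\min\{m:\omega_m\ne\omega'_m\}}$. Transfer operator: $(\mathscr L_f\phi)(\omega)=\sum_{\sigma_{\mathbf A}\omega'=\omega}e^{f(\omega')}\phi(\omega')$ on $V$. $\lambda_1(f),\lambda_2(f),\dots$ are the nonzero eigenvalues of $\mathscr L_f:V\to V$, repeated according to multiplicity, ordered with $|\lambda_n(f)|\ge|\lambda_{n+1}(f)|$, and set to $0$ beyond the last one if there are finitely many. $\mathrm{Per}_q(\sigma_{\mathbf A})=\{\omega:\sigma_{\mathbf A}^q\omega=\omega\}$, $S_qf=\sum_{k=0}^{q-1}f\circ\sigma_{\mathbf A}^k$, and the Ruelle zeta function is $\zeta_f(z)=\exp\big(\sum_{q\ge1}\frac{z^q}{q}\sum_{\omega\in\mathrm{Per}_q(\sigma_{\mathbf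 A})}e^{S_qf(\omega)}\big)$, convergent for small $|z|$. *)

theory Defs
  imports "HOL-Analysis.Analysis"
begin

text \<open>Alphabet is {1..N}; the matrix A is a function nat => nat => nat,
only its entries on {1..N} x {1..N} matter. Sequences are nat => nat.\<close>

definition zero_one_matrix :: "nat \<Rightarrow> (nat \<Rightarrow> nat \<Rightarrow> nat) \<Rightarrow> bool" where
  "zero_one_matrix N A \<longleftrightarrow> (\<forall>i\<in>{1..N}. \<forall>j\<in>{1..N}. A i j = 0 \<or> A i j = 1)"

fun mpow :: "nat \<Rightarrow> (nat \<Rightarrow> nat \<Rightarrow> nat) \<Rightarrow> nat \<Rightarrow> nat \<Rightarrow> nat \<Rightarrow> nat" where
  "mpow N A 0 i j = (if i = j then 1 else 0)"
| "mpow N A (Suc k) i j = (\<Sum>l\<in>{1..N}. mpow N A k i l * A l j)"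

definition aperiodic :: "nat \<Rightarrow> (nat \<Rightarrow> nat \<Rightarrow> nat) \<Rightarrow> bool" where
  "aperiodic N A \<longleftrightarrow> (\<exists>k>0. \<forall>i\<in>{1..N}. \<forall>j\<in>{1..N}. mpow N A k i j > 0)"

definition Sigma_A :: "nat \<Rightarrow> (nat \<Rightarrow> nat \<Rightarrow> nat) \<Rightarrow> (nat \<Rightarrow> nat) set" where
  "Sigma_A N A = {\<omega>. (\<forall>m. \<omega> m \<in> {1..N}) \<and> (\<forall>m. A (\<omega> m) (\<omega> (Suc m)) = 1)}"

definition shift :: "(nat \<Rightarrow> nat) \<Rightarrow> (nat \<Rightarrow> nat)" where
  "shift \<omega> = (\<lambda>m. \<omega> (Suc m))"

definition scons :: "nat \<Rightarrow> (nat \<Rightarrow> nat) \<Rightarrow> (nat \<Rightarrow> nat)" where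
  "scons i \<omega> = (\<lambda>m. case m of 0 \<Rightarrow> i | Suc k \<Rightarrow> \<omega> k)"

text \<open>Topological entropy of the shift (Bowen's definition via (n,eps)-separated
  sets) w.r.t. the metric d_theta with theta = 1/2 (any compatible metric gives the same value).\<close>

definition dshift :: "(nat \<Rightarrow> nat) \<Rightarrow> (nat \<Rightarrow> nat) \<Rightarrow> real" where
  "dshift \<omega> \<omega>' = (if \<omega> = \<omega>' then 0 else (1/2) ^ (LEAST m. \<omega> m \<noteq> \<omega>' m))"

definition separated :: "nat \<Rightarrow> (nat \<Rightarrow> nat \<Rightarrow> nat) \<Rightarrow> nat \<Rightarrow> real \<Rightarrow> (nat \<Rightarrow> nat) set \<Rightarrow> bool" where
  "separated N A n \<epsilon> E \<longleftrightarrow> E \<subseteq> Sigma_A N A \<and>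
     (\<forall>x\<in>E. \<forall>y\<in>E. x \<noteq> y \<longrightarrow> (\<exists>k<n. dshift ((shift ^^ k) x) ((shift ^^ k) y) > \<epsilon>))"

definition sepnum :: "nat \<Rightarrow> (nat \<Rightarrow> nat \<Rightarrow> nat) \<Rightarrow> nat \<Rightarrow> real \<Rightarrow> nat" where
  "sepnum N A n \<epsilon> = Sup {card E | E. finite E \<and> separated N A n \<epsilon> E}"

definition htop :: "nat \<Rightarrow> (nat \<Rightarrow> nat \<Rightarrow> nat) \<Rightarrow> ereal" where
  "htop N A = (SUP \<epsilon>\<in>{0<..}. limsup (\<lambda>n. ereal (ln (real (sepnum N A n \<epsilon>)) / real n)))"

text \<open>Variations and the space V (functions are represented as vanishing off Sigma_A).\<close>

definition var :: "nat \<Rightarrow> (nat \<Rightarrow> nat \<Rightarrow> nat) \<Rightarrow> ((nat \<Rightarrow> nat) \<Rightarrow> complex) \<Rightarrow> nat \<Rightarrow> real" where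
  "var N A \<phi> m = Sup {cmod (\<phi> \<omega> - \<phi> \<omega>') | \<omega> \<omega>'.
      \<omega> \<in> Sigma_A N A \<and> \<omega>' \<in> Sigma_A N A \<and> (\<forall>k<m. \<omega> k = \<omega>' k)}"

definition Vsp :: "nat \<Rightarrow> (nat \<Rightarrow> nat \<Rightarrow> nat) \<Rightarrow> ((nat \<Rightarrow> nat) \<Rightarrow> complex) set" where
  "Vsp N A = {\<phi>. (\<forall>\<omega>. \<omega> \<notin> Sigma_A N A \<longrightarrow> \<phi> \<omega> = 0)
      \<and> (\<forall>m. bdd_above {cmod (\<phi> \<omega> - \<phi> \<omega>') | \<omega> \<omega>'.
            \<omega> \<in> Sigma_A N A \<and> \<omega>' \<in> Sigma_A N A \<and> (\<forall>k<m. \<omega> k = \<omega>' k)})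
      \<and> (\<lambda>m. var N A \<phi> m powr (1 / real m)) \<longlonglongrightarrow> 0}"

definition Lop :: "nat \<Rightarrow> (nat \<Rightarrow> nat \<Rightarrow> nat) \<Rightarrow> ((nat \<Rightarrow> nat) \<Rightarrow> complex)
    \<Rightarrow> ((nat \<Rightarrow> nat) \<Rightarrow> complex) \<Rightarrow> ((nat \<Rightarrow> nat) \<Rightarrow> complex)" where
  "Lop N A f \<phi> = (\<lambda>\<omega>. if \<omega> \<in> Sigma_A N A then
      (\<Sum>i\<in>{i\<in>{1..N}. A i (\<omega> 0) = 1}. exp (f (scons i \<omega>)) * \<phi> (scons i \<omega>)) else 0)"

definition gen_eigenspace :: "nat \<Rightarrow> (nat \<Rightarrow> nat \<Rightarrow> nat) \<Rightarrow> ((nat \<Rightarrow> nat) \<Rightarrow> complex)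
    \<Rightarrow> complex \<Rightarrow> ((nat \<Rightarrow> nat) \<Rightarrow> complex) set" where
  "gen_eigenspace N A f \<mu> = {\<phi> \<in> Vsp N A.
      \<exists>k. ((\<lambda>\<psi>. \<lambda>\<omega>. Lop N A f \<psi> \<omega> - \<mu> * \<psi> \<omega>) ^^ k) \<phi> = (\<lambda>\<omega>. 0)}"

definition lin_indep_fun :: "((nat \<Rightarrow> nat) \<Rightarrow> complex) set \<Rightarrow> bool" where
  "lin_indep_fun S \<longleftrightarrow> finite S \<and>
     (\<forall>c. (\<forall>\<omega>. (\<Sum>\<phi>\<in>S. c \<phi> * \<phi> \<omega>) = 0) \<longrightarrow> (\<forall>\<phi>\<in>S. c \<phi> = 0))"

definition alg_mult :: "nat \<Rightarrow> (nat \<Rightarrow> nat \<Rightarrow> nat) \<Rightarrow> ((nat \<Rightarrow> nat) \<Rightarrow> complex) \<Rightarrow> complex \<Rightarrow> enat" where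
  "alg_mult N A f \<mu> = (SUP S\<in>{S. S \<subseteq> gen_eigenspace N A f \<mu> \<and> lin_indep_fun S}. enat (card S))"

text \<open>lam is an enumeration lambda_1, lambda_2, ... (indexed from 0) of the nonzero
  eigenvalues of L_f : V -> V, repeated according to algebraic multiplicity, with
  non-increasing modulus, padded with zeros if there are finitely many.\<close>

definition eig_seq :: "nat \<Rightarrow> (nat \<Rightarrow> nat \<Rightarrow> nat) \<Rightarrow> ((nat \<Rightarrow> nat) \<Rightarrow> complex) \<Rightarrow> (nat \<Rightarrow> complex) \<Rightarrow> bool" where
  "eig_seq N A f lam \<longleftrightarrow> (\<forall>n. cmod (lam (Suc n)) \<le> cmod (lam n)) \<and>
     (\<forall>\<mu>. \<mu> \<noteq> 0 \<longrightarrow> finite {n. lam n = \<mu>} \<and> alg_mult N A f \<mu> = enat (card {n. lam n = \<mu>}))"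

definition Per :: "nat \<Rightarrow> (nat \<Rightarrow> nat \<Rightarrow> nat) \<Rightarrow> nat \<Rightarrow> (nat \<Rightarrow> nat) set" where
  "Per N A q = {\<omega> \<in> Sigma_A N A. (shift ^^ q) \<omega> = \<omega>}"

definition birk :: "((nat \<Rightarrow> nat) \<Rightarrow> complex) \<Rightarrow> nat \<Rightarrow> (nat \<Rightarrow> nat) \<Rightarrow> complex" where
  "birk f q \<omega> = (\<Sum>k<q. f ((shift ^^ k) \<omega>))"

definition Zper :: "nat \<Rightarrow> (nat \<Rightarrow> nat \<Rightarrow> nat) \<Rightarrow> ((nat \<Rightarrow> nat) \<Rightarrow> complex) \<Rightarrow> nat \<Rightarrow> complex" where
  "Zper N A f q = (\<Sum>\<omega>\<in>Per N A q. exp (birk f q \<omega>))"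

definition Efac :: "nat \<Rightarrow> complex \<Rightarrow> complex" where
  "Efac k w = (1 - w) * exp (\<Sum>j=1..k. w ^ j / of_nat j)"

end

theory Submission
  imports
    "HOL-Complex_Analysis.Weierstrass_Factorization"
    "HOL-Complex_Analysis.Great_Picard"
    "Jordan_Normal_Form.Schur_Decomposition"
    "Jordan_Normal_Form.Char_Poly"
    "HOL-Library.Function_Algebras"
    Defs
begin

text \<open>
Every function in \<open>V\<close> is a telescoping sum \<open>g = \<Sum>\<^sub>w sec g w * ind w\<close> over the finite admissible words, where
\<open>ind w\<close> is the indicator of a cylinder and \<open>sec g w\<close> a difference of two values of \<open>g\<close> at points agreeing in all
but the last letter of \<open>w\<close>. The hypothesis on \<open>f\<close> says \<open>var\<^sub>m f = O(D^m * r^(m^2))\<close>. Giving the words of length \<open>m\<close>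
the weight \<open>D^m * r^(m^2)\<close> turns the transfer operator into an infinite matrix on \<open>\<ell>\<^sup>1\<close> whose column at a word of
length \<open>m\<close> has norm \<open>O(r^(2 m))\<close>, because \<open>(m+1)^2 - m^2\<close> is about \<open>2 m\<close>. There are at most \<open>exp (m * (htop + \<epsilon>))\<close>
such words, so the column norms are \<open>p'\<close>-summable for some \<open>p' < p\<close>.

For a matrix with \<open>p'\<close>-summable column norms, the products of the largest eigenvalues of the finite truncations are
bounded by products of distinct column norms, as in Weyl's inequality, which gives \<open>n |\<lambda>\<^sub>n|^p' \<le> const\<close> uniformly in the
size of the truncation. A diagonal limit yields a sequence whose power sums are the traces of the powers of the
matrix. Wielandt deflation removes one eigenvector at a time and lowers all traces by \<open>\<mu>^q\<close>; as the power sums of large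
exponent determine the multiplicities, the sequence counts every nonzero eigenvalue as often as its generalised
eigenspace demands. A generalised eigenfunction in \<open>V\<close> automatically has variations \<open>O(D^m * r^(m^2))\<close>, so that
matrix and operator have the same generalised eigenspaces. The trace of the \<open>q\<close>-th power is evaluated along words
of length \<open>m \<longrightarrow> \<infinity>\<close>, where it becomes the sum over the periodic points. The zeta function formula then follows from
the logarithmic series of the elementary factors.
\<close>

section \<open>Eigenvalues of finite truncations\<close>

text \<open>The estimate behind the spectral bound is of weak type:
  \<open>n * |\<lambda>_n|^p' \<le> K\<close> yields summability of \<open>|\<lambda>_n|^x\<close>
  only for \<open>x > p'\<close>. The entropy condition is a strict inequality and survives a small
  decrease of \<open>p\<close>; this slack gives (i) at the exponent \<open>p\<close> itself and
  (ii) at \<open>q = p\<close>.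

  The main obstacle is algebraic multiplicity. Limits of eigenvalue lists of truncations say nothing
  by themselves about generalised eigenspaces: they are tied to the matrix only by their power sums
  and by one eigenvector for each nonzero entry. The induction on the number of occurrences of an
  eigenvalue is built to use nothing more.

  A second obstacle is that the functions \<open>ind w\<close> are linearly dependent, since a
  cylinder is the union of its one-letter extensions. The coordinates of a function are therefore
  not unique, and matrix and operator are not conjugate. They are compared through two injections
  between generalised eigenspaces, which is enough for nonzero eigenvalues.\<close>

fun fpow :: "nat \<Rightarrow> (nat \<Rightarrow> nat \<Rightarrow> 'a) \<Rightarrow> nat \<Rightarrow> nat \<Rightarrow> nat \<Rightarrow> 'a::comm_semiring_1" where
  "fpow d B 0 i j = (if i = j then 1 else 0)"
| "fpow d B (Suc q) i j = (\<Sum>k<d. B i k * fpow d B q k j)"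

lemma det_mat_eq_sum:
  fixes a :: "nat \<Rightarrow> nat \<Rightarrow> complex"
  shows "Determinant.det (mat n n (\<lambda>(i,j). a i j)) =
    (\<Sum>p | p permutes {0..<n}. signof p * (\<Prod>i<n. a i (p i)))"
proof -
  have "Determinant.det (mat n n (\<lambda>(i,j). a i j)) =
    (\<Sum>p | p permutes {0..<n}. signof p * (\<Prod>i = 0..<n. mat n n (\<lambda>(i,j). a i j) $$ (i, p i)))"
    by (rule det_def') simp
  also have "\<dots> = (\<Sum>p | p permutes {0..<n}. signof p * (\<Prod>i<n. a i (p i)))"
  proof (rule sum.cong[OF refl])
    fix p assume "p \<in> {p. p permutes {0..<n}}"
    then have "p i < n" if "i < n" for i using that permutes_in_image[of p "{0..<n}" i] by simp
    then have "(\<Prod>i = 0..<n. mat n n (\<lambda>(i,j). a i j) $$ (i, p i)) = (\<Prod>i = 0..<n. a i (p i))"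
      by (intro prod.cong refl) simp
    then show "signof p * (\<Prod>i = 0..<n. mat n n (\<lambda>(i,j). a i j) $$ (i, p i)) =
        signof p * (\<Prod>i<n. a i (p i))" by (simp add: atLeast0LessThan)
  qed
  finally show ?thesis .
qed

text \<open>Multilinearity in the rows. This is Cauchy-Binet before equal index sets are collected:
  the sum runs over all maps \<open>h\<close>, so that no ordering of the chosen rows has to be
  handled.\<close>

lemma det_mult_expand:
  fixes M V :: "nat \<Rightarrow> nat \<Rightarrow> complex"
  shows "Determinant.det (mat n n (\<lambda>(i,j). \<Sum>k<d. M i k * V k j)) =
    (\<Sum>h\<in>{..<n} \<rightarrow>\<^sub>E {..<d}. (\<Prod>i<n. M i (h i)) * Determinant.det (mat n n (\<lambda>(i,j). V (h i) j)))"
proof -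
  let ?S = "{p. p permutes {0..<n}}"
  let ?H = "{..<n} \<rightarrow>\<^sub>E {..<d}"
  have "Determinant.det (mat n n (\<lambda>(i,j). \<Sum>k<d. M i k * V k j))
      = (\<Sum>p\<in>?S. signof p * (\<Prod>i<n. \<Sum>k<d. M i k * V k (p i)))"
    by (rule det_mat_eq_sum)
  also have "\<dots> = (\<Sum>p\<in>?S. signof p * (\<Sum>h\<in>?H. \<Prod>i<n. M i (h i) * V (h i) (p i)))"
    by (simp add: prod_sum_PiE)
  also have "\<dots> = (\<Sum>h\<in>?H. \<Sum>p\<in>?S. signof p * (\<Prod>i<n. M i (h i) * V (h i) (p i)))"
    by (simp add: sum_distrib_left sum.swap[of _ ?H])
  also have "\<dots> = (\<Sum>h\<in>?H. (\<Prod>i<n. M i (h i)) * (\<Sum>p\<in>?S. signof p * (\<Prod>i<n. V (h i) (p i))))"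
    by (simp add: prod.distrib sum_distrib_left mult_ac)
  also have "\<dots> = (\<Sum>h\<in>?H. (\<Prod>i<n. M i (h i)) * Determinant.det (mat n n (\<lambda>(i,j). V (h i) j)))"
    by (simp only: det_mat_eq_sum)
  finally show ?thesis .
qed

text \<open>The \<open>n * n\<close> minors of the first \<open>n\<close> columns of \<open>P\<close> form an eigenvector of the \<open>n\<close>-th compound of \<open>B\<close> with
  eigenvalue \<open>\<Prod>k<n. T k k\<close>; the bound compares \<open>\<ell>\<^sup>1\<close> norms. Only injective \<open>h\<close> matter, as a repeated row makes the
  minor vanish.\<close>

lemma weyl_column_bound:
  fixes B P Q T :: "nat \<Rightarrow> nat \<Rightarrow> complex"
  assumes nd: "n \<le> d"
    and QP: "\<And>i j. i < d \<Longrightarrow> j < d \<Longrightarrow> (\<Sum>k<d. Q i k * P k j) = (if i = j then 1 else 0)"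
    and BP: "\<And>i j. i < d \<Longrightarrow> j < d \<Longrightarrow> (\<Sum>k<d. B i k * P k j) = (\<Sum>k<d. P i k * T k j)"
    and T: "\<And>i j. i < d \<Longrightarrow> j < i \<Longrightarrow> T i j = 0"
    and \<beta>: "\<And>j. j < d \<Longrightarrow> (\<Sum>i<d. cmod (B i j)) \<le> \<beta> j"
    and C: "\<And>h. h \<in> {..<n} \<rightarrow>\<^sub>E {..<d} \<Longrightarrow> inj_on h {..<n} \<Longrightarrow> (\<Prod>i<n. \<beta> (h i)) \<le> C"
  shows "(\<Prod>k<n. cmod (T k k)) \<le> C"
proof -
  let ?H = "{..<n} \<rightarrow>\<^sub>E {..<d}"
  define X where "X h = Determinant.det (mat n n (\<lambda>(i,j). P (h i) j))" for h
  have finH: "finite ?H" by (intro finite_PiE) auto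
  have Hlt: "h i < d" if "h \<in> ?H" "i < n" for h i using that by (auto simp: PiE_def Pi_def)
  have "1 = Determinant.det (mat n n (\<lambda>(i,j). \<Sum>k<d. Q i k * P k j))"
  proof -
    have "mat n n (\<lambda>(i,j). \<Sum>k<d. Q i k * P k j) = 1\<^sub>m n"
      using nd by (intro eq_matI) (auto simp: QP)
    then show ?thesis by simp
  qed
  also have "\<dots> = (\<Sum>h\<in>?H. (\<Prod>i<n. Q i (h i)) * X h)"
    unfolding X_def by (rule det_mult_expand)
  finally have one: "1 = (\<Sum>h\<in>?H. (\<Prod>i<n. Q i (h i)) * X h)" .
  have "\<exists>h\<in>?H. X h \<noteq> 0"
  proof (rule ccontr)
    assume "\<not> ?thesis"
    then have "(\<Sum>h\<in>?H. (\<Prod>i<n. Q i (h i)) * X h) = 0" by (intro sum.neutral) auto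
    with one show False by simp
  qed
  then obtain h0 where "h0 \<in> ?H" "X h0 \<noteq> 0" by blast
  then have pos: "0 < (\<Sum>h\<in>?H. cmod (X h))"
    by (intro sum_pos2[OF finH, of h0]) auto
  have XT: "X g * (\<Prod>k<n. T k k) = (\<Sum>h\<in>?H. (\<Prod>i<n. B (g i) (h i)) * X h)" if g: "g \<in> ?H" for g
  proof -
    have "upper_triangular (mat n n (\<lambda>(i,j). T i j))"
      using nd by (intro upper_triangularI) (auto simp: T)
    from det_upper_triangular[OF this, of n]
    have "(\<Prod>k<n. T k k) = Determinant.det (mat n n (\<lambda>(i,j). T i j))"
      by (simp add: prod_list_diag_prod atLeast0LessThan)
    then have "X g * (\<Prod>k<n. T k k) =
       Determinant.det (mat n n (\<lambda>(i,j). P (g i) j) * mat n n (\<lambda>(i,j). T i j))"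
      unfolding X_def by (simp add: Determinant.det_mult[of _ n])
    also have "mat n n (\<lambda>(i,j). P (g i) j) * mat n n (\<lambda>(i,j). T i j)
        = mat n n (\<lambda>(i,j). \<Sum>k<d. B (g i) k * P k j)"
    proof (intro eq_matI)
      fix i j assume "i < dim_row (mat n n (\<lambda>(i,j). \<Sum>k<d. B (g i) k * P k j))"
        "j < dim_col (mat n n (\<lambda>(i,j). \<Sum>k<d. B (g i) k * P k j))"
      then have ij: "i < n" "j < n" by auto
      have "(\<Sum>k<d. B (g i) k * P k j) = (\<Sum>k<d. P (g i) k * T k j)"
        using ij nd Hlt[OF g ij(1)] by (intro BP) simp_all
      \<comment> \<open>The first \<open>n\<close> columns of the upper triangular \<open>T\<close>
        vanish below row \<open>n\<close>, so the leading block of \<open>T\<close>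
        suffices.\<close>
      also have "\<dots> = (\<Sum>k<n. P (g i) k * T k j)"
        using ij nd by (intro sum.mono_neutral_right) (auto intro!: T)
      finally show "(mat n n (\<lambda>(i,j). P (g i) j) * mat n n (\<lambda>(i,j). T i j)) $$ (i,j)
          = mat n n (\<lambda>(i,j). \<Sum>k<d. B (g i) k * P k j) $$ (i,j)"
        using ij by (simp add: scalar_prod_def atLeast0LessThan)
    qed auto
    also have "Determinant.det \<dots> = (\<Sum>h\<in>?H. (\<Prod>i<n. B (g i) (h i)) * X h)"
      unfolding X_def by (rule det_mult_expand)
    finally show ?thesis .
  qed
  have X0: "X h = 0" if "h \<in> ?H" "\<not> inj_on h {..<n}" for h
  proof -
    from that obtain i j where "i < n" "j < n" "i \<noteq> j" "h i = h j" by (auto simp: inj_on_def)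
    then show ?thesis unfolding X_def
      by (intro det_identical_rows[of _ n i j]) (auto intro!: eq_vecI)
  qed
  have "(\<Sum>g\<in>?H. cmod (X g)) * (\<Prod>k<n. cmod (T k k)) = (\<Sum>g\<in>?H. cmod (X g * (\<Prod>k<n. T k k)))"
    by (simp add: norm_mult prod_norm sum_distrib_right)
  also have "\<dots> = (\<Sum>g\<in>?H. cmod (\<Sum>h\<in>?H. (\<Prod>i<n. B (g i) (h i)) * X h))"
    by (intro sum.cong refl) (simp add: XT)
  also have "\<dots> \<le> (\<Sum>g\<in>?H. \<Sum>h\<in>?H. (\<Prod>i<n. cmod (B (g i) (h i))) * cmod (X h))"
    by (intro sum_mono order_trans[OF norm_sum]) (simp add: norm_mult prod_norm)
  also have "\<dots> = (\<Sum>h\<in>?H. \<Sum>g\<in>?H. (\<Prod>i<n. cmod (B (g i) (h i))) * cmod (X h))"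
    by (rule sum.swap)
  \<comment> \<open>For fixed \<open>h\<close>, summing over all maps \<open>g\<close> turns the
    product of entries into a product of column sums.\<close>
  also have "\<dots> = (\<Sum>h\<in>?H. cmod (X h) * (\<Prod>i<n. \<Sum>a<d. cmod (B a (h i))))"
    by (simp add: prod_sum_PiE sum_distrib_left mult.commute)
  also have "\<dots> \<le> (\<Sum>h\<in>?H. cmod (X h) * C)"
  proof (intro sum_mono)
    fix h assume h: "h \<in> ?H"
    show "cmod (X h) * (\<Prod>i<n. \<Sum>a<d. cmod (B a (h i))) \<le> cmod (X h) * C"
    proof (cases "inj_on h {..<n}")
      case True
      have "(\<Prod>i<n. \<Sum>a<d. cmod (B a (h i))) \<le> (\<Prod>i<n. \<beta> (h i))"
        using Hlt[OF h] by (intro prod_mono) (auto intro!: sum_nonneg \<beta>)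
      also have "\<dots> \<le> C" using C h True by blast
      finally show ?thesis by (intro mult_left_mono) auto
    next
      case False
      then show ?thesis using X0[OF h] by simp
    qed
  qed
  also have "\<dots> = (\<Sum>h\<in>?H. cmod (X h)) * C" by (simp add: sum_distrib_right)
  finally show ?thesis using pos by simp
qed

lemma mat_mult_entry:
  "A \<in> carrier_mat d d \<Longrightarrow> B \<in> carrier_mat d d \<Longrightarrow> i < d \<Longrightarrow> j < d \<Longrightarrow>
    (A * B) $$ (i,j) = (\<Sum>k<d. A $$ (i,k) * B $$ (k,j))"
  by (auto simp: scalar_prod_def atLeast0LessThan)

lemma pow_mat_commute:
  fixes A :: "'a::semiring_1 mat"
  assumes A: "A \<in> carrier_mat d d"
  shows "A ^\<^sub>m k * A = A * A ^\<^sub>m k"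
proof (induction k)
  case 0 then show ?case using A by simp
next
  case (Suc k)
  have "A ^\<^sub>m Suc k * A = (A * A ^\<^sub>m k) * A" using Suc by simp
  also have "\<dots> = A * (A ^\<^sub>m k * A)" using A by (intro assoc_mult_mat[of _ d d _ d _ d]) auto
  finally show ?case by simp
qed

text \<open>Schur triangularisation \<open>A P = P U\<close> keeps the order in which the roots are
  supplied. With the roots sorted by decreasing modulus, the leading diagonal entries of
  \<open>U\<close> are the largest eigenvalues, and traces, eigenvectors and the product bound all
  refer to one list.\<close>

lemma finite_matrix_eigenvalues:
  fixes B :: "nat \<Rightarrow> nat \<Rightarrow> complex"
  obtains \<mu> :: "nat \<Rightarrow> complex" where
    "\<And>n. cmod (\<mu> (Suc n)) \<le> cmod (\<mu> n)" "\<And>n. n \<ge> d \<Longrightarrow> \<mu> n = 0"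
    "\<And>q. (\<Sum>i<d. fpow d B q i i) = (\<Sum>n<d. \<mu> n ^ q)"
    "\<And>n. n < d \<Longrightarrow> \<exists>v. (\<exists>i<d. v i \<noteq> 0) \<and> (\<forall>i<d. (\<Sum>j<d. B i j * v j) = \<mu> n * v i)"
    "\<And>n \<beta> C. n \<le> d \<Longrightarrow> (\<And>j. j < d \<Longrightarrow> (\<Sum>i<d. cmod (B i j)) \<le> \<beta> j) \<Longrightarrow>
       (\<And>h. h \<in> {..<n} \<rightarrow>\<^sub>E {..<d} \<Longrightarrow> inj_on h {..<n} \<Longrightarrow> (\<Prod>i<n. \<beta> (h i)) \<le> C) \<Longrightarrow>
       (\<Prod>k<n. cmod (\<mu> k)) \<le> C"
proof -
  define A where "A = mat d d (\<lambda>(i,j). B i j)"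
  have A: "A \<in> carrier_mat d d" by (simp add: A_def)
  obtain es0 where es0: "char_poly A = (\<Prod>a\<leftarrow>es0. [:-a, 1:])" "length es0 = d"
    using char_poly_factorized[OF A] by blast
  define es where "es = rev (sort_key cmod es0)"
  have mset: "mset es = mset es0" by (simp add: es_def)
  have len: "length es = d" using es0 by (simp add: es_def)
  have "(\<Prod>a\<leftarrow>es. [:-a, 1:]) = (\<Prod>a\<leftarrow>es0. [:-a, 1:])"
    using arg_cong[OF mset, of "\<lambda>M. prod_mset (image_mset (\<lambda>a. [:-a, 1:]) M)"]
    by (simp add: prod_mset_prod_list flip: mset_map)
  then have cp: "char_poly A = (\<Prod>a\<leftarrow>es. [:-a, 1:])" using es0 by simp
  have srt: "cmod (es ! Suc n) \<le> cmod (es ! n)" if "Suc n < d" for n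
  proof -
    have "sorted (map cmod (sort_key cmod es0))" by simp
    then have "sorted (rev (map cmod es))" by (simp add: es_def rev_map)
    then show ?thesis using that len by (simp add: sorted_rev_iff_nth_Suc)
  qed
  obtain U P Q where sd: "schur_decomposition A es = (U, P, Q)" by (cases "schur_decomposition A es")
  from schur_decomposition[OF A cp sd]
  have wit: "similar_mat_wit A U P Q" and ut: "upper_triangular U" and dg: "diag_mat U = es" by auto
  note w = similar_mat_witD2[OF A wit]
  define \<mu> where "\<mu> n = (if n < d then es ! n else 0)" for n
  have U\<mu>: "U $$ (k,k) = \<mu> k" if "k < d" for k
    using dg that w(5) unfolding \<mu>_def by (auto simp: diag_mat_def)
  have AP: "A * P = P * U"
  proof -
    have "A * P = P * U * Q * P" using w(3) by simp
    also have "\<dots> = P * U * (Q * P)" using w(5-7) by (intro assoc_mult_mat[of _ d d _ d _ d]) auto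
    finally show ?thesis using w(2,5,6) by simp
  qed
  have powentry: "(A ^\<^sub>m q) $$ (i,j) = fpow d B q i j" if "i < d" "j < d" for q i j
    using that
  proof (induction q arbitrary: i j)
    case 0 then show ?case by (simp add: A_def)
  next
    case (Suc q)
    have "A ^\<^sub>m Suc q = A * A ^\<^sub>m q" using A by (metis pow_mat_commute pow_mat.simps(2))
    moreover have "A ^\<^sub>m q \<in> carrier_mat d d" using A by simp
    ultimately have "(A ^\<^sub>m Suc q) $$ (i,j) = (\<Sum>k<d. A $$ (i,k) * (A ^\<^sub>m q) $$ (k,j))"
      using Suc.prems A by (simp add: mat_mult_entry del: index_mult_mat)
    also have "\<dots> = (\<Sum>k<d. B i k * fpow d B q k j)"
      using Suc by (intro sum.cong) (auto simp: A_def)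
    finally show ?case by simp
  qed
  have utp: "upper_triangular (U ^\<^sub>m q) \<and> (\<forall>k<d. (U ^\<^sub>m q) $$ (k,k) = \<mu> k ^ q)" for q
  proof (induction q)
    case 0 then show ?case using w(5) by auto
  next
    case (Suc q)
    have cU: "U ^\<^sub>m q \<in> carrier_mat d d" "U \<in> carrier_mat d d" using w(5) by auto
    have e: "(U ^\<^sub>m Suc q) $$ (i,j) = (\<Sum>k<d. (U ^\<^sub>m q) $$ (i,k) * U $$ (k,j))" if "i < d" "j < d" for i j
      using that cU by (simp add: mat_mult_entry[OF cU] del: index_mult_mat)
    have z: "(U ^\<^sub>m q) $$ (i,k) * U $$ (k,j) = 0" if "i < d" "k < d" "j \<le> i" "\<not> (k = i \<and> j = i)" for i j k
      using that Suc cU upper_triangularD[OF ut, of j k]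
      by (cases "k < i") (auto dest: upper_triangularD)
    show ?case
    proof (intro conjI allI impI)
      show "upper_triangular (U ^\<^sub>m Suc q)"
        using cU by (intro upper_triangularI) (subst e, auto intro!: sum.neutral z)
      fix k assume k: "k < d"
      have "(U ^\<^sub>m Suc q) $$ (k,k) = (\<Sum>l\<in>{k}. (U ^\<^sub>m q) $$ (k,l) * U $$ (l,k))"
        unfolding e[OF k k] using k by (intro sum.mono_neutral_right ballI z) auto
      then show "(U ^\<^sub>m Suc q) $$ (k,k) = \<mu> k ^ Suc q" using Suc k U\<mu> by simp
    qed
  qed
  have tr: "(\<Sum>i<d. fpow d B q i i) = (\<Sum>n<d. \<mu> n ^ q)" for q
  proof -
    have cU: "U ^\<^sub>m q \<in> carrier_mat d d" using w by auto
    have PU: "P * U ^\<^sub>m q \<in> carrier_mat d d" using w cU by auto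
    have Aq: "A ^\<^sub>m q = P * U ^\<^sub>m q * Q" by (rule similar_mat_wit_pow_id[OF wit])
    have QP1: "(\<Sum>i<d. Q $$ (l,i) * P $$ (i,k)) = (if l = k then 1 else 0)" if "l < d" "k < d" for l k
    proof -
      have "(Q * P) $$ (l,k) = (\<Sum>i<d. Q $$ (l,i) * P $$ (i,k))"
        using that by (intro mat_mult_entry w)
      then show ?thesis using that w(2) by simp
    qed
    have "(\<Sum>i<d. fpow d B q i i) = (\<Sum>i<d. (P * U ^\<^sub>m q * Q) $$ (i,i))"
      by (simp add: powentry flip: Aq)
    also have "\<dots> = (\<Sum>i<d. \<Sum>l<d. (P * U ^\<^sub>m q) $$ (i,l) * Q $$ (l,i))"
      using PU w(7) by (intro sum.cong refl mat_mult_entry) auto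
    also have "\<dots> = (\<Sum>i<d. \<Sum>l<d. \<Sum>k<d. (P $$ (i,k) * (U ^\<^sub>m q) $$ (k,l)) * Q $$ (l,i))"
      using cU w(6) by (intro sum.cong refl) (auto simp: mat_mult_entry[of P d] sum_distrib_right simp del: index_mult_mat)
    also have "\<dots> = (\<Sum>l<d. \<Sum>k<d. \<Sum>i<d. (P $$ (i,k) * (U ^\<^sub>m q) $$ (k,l)) * Q $$ (l,i))"
      by (subst sum.swap) (intro sum.cong refl sum.swap)
    also have "\<dots> = (\<Sum>l<d. \<Sum>k<d. (U ^\<^sub>m q) $$ (k,l) * (\<Sum>i<d. Q $$ (l,i) * P $$ (i,k)))"
      by (simp add: sum_distrib_left mult_ac)
    also have "\<dots> = (\<Sum>l<d. \<Sum>k<d. if l = k then (U ^\<^sub>m q) $$ (k,l) else 0)"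
      by (intro sum.cong refl) (auto simp: QP1)
    also have "\<dots> = (\<Sum>l<d. \<mu> l ^ q)" using utp by (simp add: sum.delta)
    finally show ?thesis .
  qed
  have ev: "\<exists>v. (\<exists>i<d. v i \<noteq> 0) \<and> (\<forall>i<d. (\<Sum>j<d. B i j * v j) = \<mu> n * v i)" if n: "n < d" for n
  proof -
    have "poly (char_poly A) (\<mu> n) = 0" unfolding cp using n len
      by (auto simp: \<mu>_def poly_prod_list prod_list_zero_iff intro!: bexI[of _ "es ! n"])
    then have "eigenvalue A (\<mu> n)" using eigenvalue_root_char_poly[OF A] by simp
    then obtain v where "eigenvector A v (\<mu> n)" unfolding eigenvalue_def by blast
    moreover have "dim_row A = d" using A by simp
    ultimately have v: "v \<in> carrier_vec d" "v \<noteq> 0\<^sub>v d" "A *\<^sub>v v = \<mu> n \<cdot>\<^sub>v v"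
      unfolding eigenvector_def by simp_all
    have "(\<Sum>j<d. B i j * vec_index v j) = \<mu> n * vec_index v i" if "i < d" for i
    proof -
      have "vec_index (A *\<^sub>v v) i = (\<Sum>j<d. B i j * vec_index v j)"
        using that v(1) by (simp add: A_def scalar_prod_def atLeast0LessThan)
      moreover have "vec_index (\<mu> n \<cdot>\<^sub>v v) i = \<mu> n * vec_index v i"
        using v(1) that by simp
      ultimately show ?thesis unfolding v(3) by (rule trans[OF sym])
    qed
    moreover have "\<exists>i<d. vec_index v i \<noteq> 0"
    proof (rule ccontr)
      assume "\<not> ?thesis"
      then have "v = 0\<^sub>v d" using v(1) by (intro eq_vecI) auto
      with v(2) show False by contradiction
    qed
    ultimately have "(\<exists>i<d. vec_index v i \<noteq> 0) \<and>
        (\<forall>i<d. (\<Sum>j<d. B i j * vec_index v j) = \<mu> n * vec_index v i)"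
      by (intro conjI allI impI)
    then show ?thesis by (rule exI[of _ "vec_index v"])
  qed
  have weyl: "(\<Prod>k<n. cmod (\<mu> k)) \<le> C" if "n \<le> d" "\<And>j. j < d \<Longrightarrow> (\<Sum>i<d. cmod (B i j)) \<le> \<beta> j"
     "\<And>h. h \<in> {..<n} \<rightarrow>\<^sub>E {..<d} \<Longrightarrow> inj_on h {..<n} \<Longrightarrow> (\<Prod>i<n. \<beta> (h i)) \<le> C" for n \<beta> C
  proof -
    have "(\<Prod>k<n. cmod (U $$ (k,k))) \<le> C"
    proof (rule weyl_column_bound[where T="\<lambda>i j. U $$ (i,j)" and P="\<lambda>i j. P $$ (i,j)" and Q="\<lambda>i j. Q $$ (i,j)" and d=d and \<beta>=\<beta> and B=B, OF that(1)])
      fix i j assume ij: "i < d" "j < d"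
      have "(Q * P) $$ (i,j) = (\<Sum>k<d. Q $$ (i,k) * P $$ (k,j))"
        using ij by (intro mat_mult_entry w)
      then show "(\<Sum>k<d. Q $$ (i,k) * P $$ (k,j)) = (if i = j then 1 else 0)" using w(2) ij by simp
      have "(A * P) $$ (i,j) = (\<Sum>k<d. B i k * P $$ (k,j))"
        using ij mat_mult_entry[OF A w(6) ij] by (simp add: A_def)
      moreover have "(P * U) $$ (i,j) = (\<Sum>k<d. P $$ (i,k) * U $$ (k,j))"
        using ij by (intro mat_mult_entry w)
      ultimately show "(\<Sum>k<d. B i k * P $$ (k,j)) = (\<Sum>k<d. P $$ (i,k) * U $$ (k,j))" using AP by simp
    next
      fix i j assume "i < d" "j < i"
      then show "U $$ (i,j) = 0" using ut w(5) by (auto dest: upper_triangularD)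
    qed (use that in auto)
    moreover have "(\<Prod>k<n. cmod (U $$ (k,k))) = (\<Prod>k<n. cmod (\<mu> k))"
      using that(1) by (intro prod.cong) (auto simp: U\<mu>)
    ultimately show ?thesis by simp
  qed
  show ?thesis
  proof (rule that[of \<mu>])
    show "cmod (\<mu> (Suc n)) \<le> cmod (\<mu> n)" for n using srt[of n] by (auto simp: \<mu>_def)
    show "\<mu> n = 0" if "n \<ge> d" for n using that by (simp add: \<mu>_def)
  qed (use tr ev weyl in blast)+
qed

section \<open>Infinite matrices acting on absolutely summable sequences\<close>

text \<open>Tannery's theorem, read off from dominated convergence for the counting measure.\<close>

lemma suminf_dominated_convergence:
  fixes a :: "nat \<Rightarrow> nat \<Rightarrow> 'b::{banach, second_countable_topology}"
  assumes lim: "\<And>i. (\<lambda>d. a d i) \<longlonglongrightarrow> L i"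
    and dom: "\<And>d i. norm (a d i) \<le> g i" and g: "summable g"
  shows "summable (\<lambda>i. norm (L i))" "(\<lambda>d. \<Sum>i. a d i) \<longlonglongrightarrow> (\<Sum>i. L i)"
proof -
  have Lg: "norm (L i) \<le> g i" for i
    using tendsto_norm[OF lim] by (rule LIMSEQ_le_const2) (use dom in auto)
  show sL: "summable (\<lambda>i. norm (L i))"
    by (rule summable_comparison_test'[where g=g and N=0]) (use g Lg in auto)
  have sa: "summable (\<lambda>i. norm (a d i))" for d
    by (rule summable_comparison_test'[where g=g and N=0]) (use g dom in auto)
  have g0: "0 \<le> g i" for i using dom[of 0 i] norm_ge_zero order_trans by blast
  have "(\<lambda>d. integral\<^sup>L (count_space UNIV) (a d)) \<longlonglongrightarrow> integral\<^sup>L (count_space UNIV) L"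
    using g g0 by (intro integral_dominated_convergence[where w=g])
      (auto simp: integrable_count_space_nat_iff AE_count_space lim dom)
  then show "(\<lambda>d. \<Sum>i. a d i) \<longlonglongrightarrow> (\<Sum>i. L i)"
    using sL sa by (simp add: integral_count_space_nat integrable_count_space_nat_iff)
qed

lemma prod_le_mean_power:
  fixes x :: "'a \<Rightarrow> real"
  assumes "finite S" "S \<noteq> {}" "\<And>i. i \<in> S \<Longrightarrow> 0 \<le> x i"
  shows "prod x S \<le> (sum x S / card S) ^ card S"
proof -
  have c: "card S > 0" using assms by (simp add: card_gt_0_iff)
  have p: "0 \<le> prod x S" using assms by (intro prod_nonneg) auto
  have "prod x S powr (1 / card S) \<le> sum x S / card S"
    using arith_geom_mean[of S x] assms by (simp add: sum_divide_distrib)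
  then have "(prod x S powr (1 / card S)) ^ card S \<le> (sum x S / card S) ^ card S"
    by (intro power_mono) auto
  moreover have "(prod x S powr (1 / card S)) ^ card S = prod x S"
    using c p by (cases "prod x S = 0") (auto simp: powr_realpow[symmetric] powr_powr)
  ultimately show ?thesis by simp
qed

definition l1 :: "(nat \<Rightarrow> complex) set" where
  "l1 = {x. summable (\<lambda>i. cmod (x i))}"

definition n1 :: "(nat \<Rightarrow> complex) \<Rightarrow> real" where
  "n1 x = (\<Sum>i. cmod (x i))"

definition app :: "(nat \<Rightarrow> nat \<Rightarrow> complex) \<Rightarrow> (nat \<Rightarrow> complex) \<Rightarrow> nat \<Rightarrow> complex" where
  "app B x i = (\<Sum>j. B i j * x j)"

definition unitv :: "nat \<Rightarrow> nat \<Rightarrow> complex" where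
  "unitv j i = (if i = j then 1 else 0)"

definition hd_vec :: "nat \<Rightarrow> (nat \<Rightarrow> complex) \<Rightarrow> nat \<Rightarrow> complex" where
  "hd_vec n x i = (if i < n then x i else 0)"

lemma l1_dominated:
  assumes "summable g" "\<And>i. cmod (x i) \<le> g i"
  shows "x \<in> l1" "n1 x \<le> suminf g"
  using assms by (auto simp: l1_def n1_def intro!: summable_comparison_test'[where g=g and N=0 and f="\<lambda>i. cmod (x i)"] suminf_le)

lemma l1_zero: "(\<lambda>i. 0) \<in> l1" by (simp add: l1_def)

lemma l1_scale: "x \<in> l1 \<Longrightarrow> (\<lambda>i. c * x i) \<in> l1"
  by (simp add: l1_def norm_mult summable_mult)

lemma n1_scale: "x \<in> l1 \<Longrightarrow> n1 (\<lambda>i. c * x i) = cmod c * n1 x"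
  by (simp add: l1_def n1_def norm_mult suminf_mult)

lemma l1_add:
  assumes "x \<in> l1" "y \<in> l1"
  shows "(\<lambda>i. x i + y i) \<in> l1" "n1 (\<lambda>i. x i + y i) \<le> n1 x + n1 y"
  using l1_dominated[of "\<lambda>i. cmod (x i) + cmod (y i)" "\<lambda>i. x i + y i"] assms
  by (auto simp: l1_def n1_def summable_add norm_triangle_ineq suminf_add)

lemma l1_diff:
  assumes "x \<in> l1" "y \<in> l1"
  shows "(\<lambda>i. x i - y i) \<in> l1" "n1 (\<lambda>i. x i - y i) \<le> n1 x + n1 y"
  using l1_dominated[of "\<lambda>i. cmod (x i) + cmod (y i)" "\<lambda>i. x i - y i"] assms
  by (auto simp: l1_def n1_def summable_add norm_triangle_ineq4 suminf_add)

lemma n1_nonneg: "x \<in> l1 \<Longrightarrow> 0 \<le> n1 x"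
  by (auto simp: n1_def l1_def intro!: suminf_nonneg)

lemma cmod_le_n1: "x \<in> l1 \<Longrightarrow> cmod (x i) \<le> n1 x"
  unfolding l1_def n1_def using sum_le_suminf[of "\<lambda>i. cmod (x i)" "{i}"] by auto

lemma n1_reverse_triangle:
  assumes "x \<in> l1" "y \<in> l1"
  shows "\<bar>n1 x - n1 y\<bar> \<le> n1 (\<lambda>i. x i - y i)"
proof -
  have "n1 (\<lambda>i. (x i - y i) + y i) \<le> n1 (\<lambda>i. x i - y i) + n1 y"
    by (rule l1_add(2)[OF l1_diff(1)[OF assms] assms(2)])
  moreover have "n1 (\<lambda>i. x i - (x i - y i)) \<le> n1 x + n1 (\<lambda>i. x i - y i)"
    by (rule l1_diff(2)[OF assms(1) l1_diff(1)[OF assms]])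
  ultimately show ?thesis by simp
qed

lemma unitv_l1: "unitv j \<in> l1" "n1 (unitv j) = 1"
proof -
  have *: "(\<lambda>i. cmod (unitv j i)) = (\<lambda>i. if i = j then 1 else 0)" by (auto simp: unitv_def)
  have "(\<lambda>i. cmod (unitv j i)) sums 1" unfolding * using sums_single[of j "\<lambda>_. 1::real"] by simp
  then show "unitv j \<in> l1" "n1 (unitv j) = 1" by (auto simp: l1_def n1_def sums_iff)
qed

lemma hd_vec_l1: "hd_vec n x \<in> l1"
  unfolding l1_def mem_Collect_eq
  by (rule summable_finite[of "{..<n}"]) (auto simp: hd_vec_def)

lemma n1_hd_vec_diff:
  assumes x: "x \<in> l1" shows "(\<lambda>n. n1 (\<lambda>i. x i - hd_vec n x i)) \<longlonglongrightarrow> 0"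
proof -
  have s: "summable (\<lambda>i. cmod (x i))" using x by (simp add: l1_def)
  have "n1 (\<lambda>i. x i - hd_vec n x i) = (\<Sum>i. cmod (x i)) - (\<Sum>i<n. cmod (x i))" for n
  proof -
    have "(\<lambda>i. cmod (x i - hd_vec n x i)) = (\<lambda>i. cmod (x i) - (if i < n then cmod (x i) else 0))"
      by (auto simp: hd_vec_def)
    moreover have "(\<lambda>i. if i < n then cmod (x i) else 0) sums (\<Sum>i<n. cmod (x i))"
      using sums_If_finite_set[of "{..<n}" "\<lambda>i. cmod (x i)"] by simp
    ultimately show ?thesis unfolding n1_def using sums_diff[OF summable_sums[OF s]] by (simp add: sums_iff)
  qed
  moreover have "(\<lambda>n. (\<Sum>i. cmod (x i)) - (\<Sum>i<n. cmod (x i))) \<longlonglongrightarrow> (\<Sum>i. cmod (x i)) - (\<Sum>i. cmod (x i))"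
    by (intro tendsto_diff tendsto_const summable_LIMSEQ s)
  ultimately show ?thesis by simp
qed

text \<open>Uniformly bounded columns in \<open>l1\<close> characterise the matrices of bounded
  operators on \<open>l1\<close>.\<close>

locale l1_matrix =
  fixes B :: "nat \<Rightarrow> nat \<Rightarrow> complex" and M :: real
  assumes col: "\<And>j. (\<lambda>i. B i j) \<in> l1" and bd: "\<And>j. n1 (\<lambda>i. B i j) \<le> M"
begin

lemma M_nonneg: "0 \<le> M" using bd[of 0] n1_nonneg[OF col] order_trans by blast

lemma entry_le: "cmod (B i j) \<le> n1 (\<lambda>i. B i j)" using cmod_le_n1[OF col] by blast

lemma row_summable:
  assumes "x \<in> l1" shows "summable (\<lambda>j. cmod (B i j * x j))" "summable (\<lambda>j. B i j * x j)"
proof -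
  show s: "summable (\<lambda>j. cmod (B i j * x j))"
    by (rule summable_comparison_test'[where g="\<lambda>j. M * cmod (x j)" and N=0])
       (use assms order_trans[OF entry_le bd] in \<open>auto simp: l1_def norm_mult intro!: summable_mult mult_right_mono\<close>)
  show "summable (\<lambda>j. B i j * x j)" by (rule summable_norm_cancel[OF s])
qed

text \<open>The bound keeps the individual column norms instead of \<open>M\<close>.
  \<open>limit_eigenvector\<close> depends on this, because there the columns tend to zero and make
  the tail of a vector negligible.\<close>

lemma app_l1_weighted:
  assumes x: "x \<in> l1"
  shows "app B x \<in> l1" "n1 (app B x) \<le> (\<Sum>j. n1 (\<lambda>i. B i j) * cmod (x j))"
    "summable (\<lambda>j. n1 (\<lambda>i. B i j) * cmod (x j))"
proof -
  show S: "summable (\<lambda>j. n1 (\<lambda>i. B i j) * cmod (x j))"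
    by (rule summable_comparison_test'[where g="\<lambda>j. M * cmod (x j)" and N=0])
       (use x bd n1_nonneg[OF col] in \<open>auto simp: l1_def abs_mult intro!: summable_mult mult_right_mono\<close>)
  have P: "(\<Sum>i<n. cmod (app B x i)) \<le> (\<Sum>j. n1 (\<lambda>i. B i j) * cmod (x j))" for n
  proof -
    have "(\<Sum>i<n. cmod (app B x i)) \<le> (\<Sum>i<n. \<Sum>j. cmod (B i j * x j))"
      unfolding app_def by (intro sum_mono summable_norm row_summable x)
    also have "\<dots> = (\<Sum>j. \<Sum>i<n. cmod (B i j * x j))"
      by (rule suminf_sum[symmetric]) (rule row_summable[OF x])
    also have "\<dots> \<le> (\<Sum>j. n1 (\<lambda>i. B i j) * cmod (x j))"
    proof (intro suminf_le)
      fix j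
      have "(\<Sum>i<n. cmod (B i j)) \<le> n1 (\<lambda>i. B i j)"
        unfolding n1_def using col[of j] by (intro sum_le_suminf) (auto simp: l1_def)
      then show "(\<Sum>i<n. cmod (B i j * x j)) \<le> n1 (\<lambda>i. B i j) * cmod (x j)"
        by (simp add: norm_mult sum_distrib_right[symmetric] mult_right_mono)
      show "summable (\<lambda>j. \<Sum>i<n. cmod (B i j * x j))"
        by (rule summable_sum) (rule row_summable[OF x])
    qed (rule S)
    finally show ?thesis .
  qed
  show "app B x \<in> l1" unfolding l1_def mem_Collect_eq
    by (rule summableI_nonneg_bounded[OF _ P]) auto
  then show "n1 (app B x) \<le> (\<Sum>j. n1 (\<lambda>i. B i j) * cmod (x j))"
    unfolding n1_def l1_def mem_Collect_eq by (intro suminf_le_const P[unfolded n1_def]) auto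
qed

lemma app_l1: "x \<in> l1 \<Longrightarrow> app B x \<in> l1" by (rule app_l1_weighted)

lemma n1_app_le:
  assumes x: "x \<in> l1" shows "n1 (app B x) \<le> M * n1 x"
proof -
  have "n1 (app B x) \<le> (\<Sum>j. n1 (\<lambda>i. B i j) * cmod (x j))" by (rule app_l1_weighted[OF x])
  also have "\<dots> \<le> (\<Sum>j. M * cmod (x j))"
    using x bd by (intro suminf_le app_l1_weighted mult_right_mono summable_mult) (auto simp: l1_def)
  also have "\<dots> = M * n1 x" using x by (simp add: n1_def l1_def suminf_mult)
  finally show ?thesis .
qed

lemma app_add: "x \<in> l1 \<Longrightarrow> y \<in> l1 \<Longrightarrow> app B (\<lambda>i. x i + y i) = (\<lambda>i. app B x i + app B y i)"
  unfolding app_def by (rule ext) (simp add: ring_distribs suminf_add row_summable)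

lemma app_diff: "x \<in> l1 \<Longrightarrow> y \<in> l1 \<Longrightarrow> app B (\<lambda>i. x i - y i) = (\<lambda>i. app B x i - app B y i)"
  unfolding app_def by (rule ext) (simp add: ring_distribs suminf_diff row_summable)

lemma app_scale: "x \<in> l1 \<Longrightarrow> app B (\<lambda>i. c * x i) = (\<lambda>i. c * app B x i)"
  unfolding app_def by (rule ext) (simp add: suminf_mult row_summable mult.left_commute)

lemma pow_l1: "x \<in> l1 \<Longrightarrow> (app B ^^ q) x \<in> l1"
  by (induction q) (auto intro: app_l1)

lemma pow_add: "x \<in> l1 \<Longrightarrow> y \<in> l1 \<Longrightarrow>
    (app B ^^ q) (\<lambda>i. x i + y i) = (\<lambda>i. (app B ^^ q) x i + (app B ^^ q) y i)"
  by (induction q) (simp_all add: app_add pow_l1)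

lemma pow_diff: "x \<in> l1 \<Longrightarrow> y \<in> l1 \<Longrightarrow>
    (app B ^^ q) (\<lambda>i. x i - y i) = (\<lambda>i. (app B ^^ q) x i - (app B ^^ q) y i)"
  by (induction q) (simp_all add: app_diff pow_l1)

lemma pow_scale: "x \<in> l1 \<Longrightarrow> (app B ^^ q) (\<lambda>i. c * x i) = (\<lambda>i. c * (app B ^^ q) x i)"
  by (induction q) (simp_all add: app_scale pow_l1)

lemma n1_pow_le: "x \<in> l1 \<Longrightarrow> n1 ((app B ^^ q) x) \<le> M ^ q * n1 x"
proof (induction q)
  case (Suc q)
  have "n1 ((app B ^^ Suc q) x) \<le> M * n1 ((app B ^^ q) x)" using n1_app_le pow_l1 Suc by simp
  also have "\<dots> \<le> M * (M ^ q * n1 x)" using Suc M_nonneg by (intro mult_left_mono) auto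
  finally show ?case by (simp add: mult_ac)
qed simp

text \<open>Linearity settles finitely supported vectors, and boundedness extends the formula to
  \<open>l1\<close>. It serves to sum the trace of the rank-one correction in
  \<open>wielandt_deflation\<close>.\<close>

lemma pow_sums:
  assumes x: "x \<in> l1"
  shows "(\<lambda>i. x i * (app B ^^ q) (unitv i) s) sums (app B ^^ q) x s"
proof -
  have fin: "(app B ^^ q) (hd_vec n x) s = (\<Sum>i<n. x i * (app B ^^ q) (unitv i) s)" for n
  proof (induction n)
    case 0
    have z: "hd_vec 0 x = (\<lambda>i. 0 * unitv 0 i)" by (rule ext) (simp add: hd_vec_def)
    show ?case unfolding z pow_scale[OF unitv_l1(1)] by simp
  next
    case (Suc n)
    have e: "hd_vec (Suc n) x = (\<lambda>i. hd_vec n x i + x n * unitv n i)"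
      by (rule ext) (auto simp: hd_vec_def unitv_def less_Suc_eq)
    have "(app B ^^ q) (hd_vec (Suc n) x) s = (app B ^^ q) (hd_vec n x) s + x n * (app B ^^ q) (unitv n) s"
      unfolding e pow_add[OF hd_vec_l1 l1_scale[OF unitv_l1(1)]] pow_scale[OF unitv_l1(1)] ..
    then show ?case using Suc by simp
  qed
  have "cmod ((app B ^^ q) x s - (app B ^^ q) (hd_vec n x) s) \<le> M ^ q * n1 (\<lambda>i. x i - hd_vec n x i)" for n
  proof -
    have "cmod ((app B ^^ q) x s - (app B ^^ q) (hd_vec n x) s)
        = cmod ((app B ^^ q) (\<lambda>i. x i - hd_vec n x i) s)"
      unfolding pow_diff[OF x hd_vec_l1] ..
    also have "\<dots> \<le> n1 ((app B ^^ q) (\<lambda>i. x i - hd_vec n x i))"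
      by (rule cmod_le_n1[OF pow_l1[OF l1_diff(1)[OF x hd_vec_l1]]])
    also have "\<dots> \<le> M ^ q * n1 (\<lambda>i. x i - hd_vec n x i)"
      by (rule n1_pow_le[OF l1_diff(1)[OF x hd_vec_l1]])
    finally show ?thesis .
  qed
  moreover have "(\<lambda>n. M ^ q * n1 (\<lambda>i. x i - hd_vec n x i)) \<longlonglongrightarrow> 0"
    using tendsto_mult_left[OF n1_hd_vec_diff[OF x], of "M ^ q"] by simp
  ultimately have "(\<lambda>n. (app B ^^ q) x s - (app B ^^ q) (hd_vec n x) s) \<longlonglongrightarrow> 0"
    by (rule Lim_null_comparison[OF always_eventually[OF allI]])
  then have "(\<lambda>n. (app B ^^ q) x s - ((app B ^^ q) x s - (app B ^^ q) (hd_vec n x) s)) \<longlonglongrightarrow> (app B ^^ q) x s - 0"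
    by (intro tendsto_diff tendsto_const)
  then show ?thesis unfolding sums_def by (simp add: fin)
qed

text \<open>\<open>fpow\<close> truncates only the inner summations and leaves the outer index
  \<open>i\<close> free. A column is therefore a full \<open>l1\<close> vector for every
  \<open>d\<close>, and convergence in norm can be carried through the induction on
  \<open>q\<close>.\<close>

lemma fpow_l1_tendsto:
  "(\<lambda>i. fpow d B q i j) \<in> l1"
  "(\<lambda>d. n1 (\<lambda>i. fpow d B q i j - (app B ^^ q) (unitv j) i)) \<longlonglongrightarrow> 0"
proof -
  have app_hd: "app B (hd_vec d x) i = (\<Sum>k<d. B i k * x k)" for x d i
  proof -
    have "(\<lambda>k. B i k * hd_vec d x k) = (\<lambda>k. if k \<in> {..<d} then B i k * x k else 0)"
      by (auto simp: hd_vec_def)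
    then show ?thesis unfolding app_def
      using sums_If_finite_set[of "{..<d}" "\<lambda>k. B i k * x k"] by (simp add: sums_iff)
  qed
  have F0: "(\<lambda>i. fpow d B 0 i j) = unitv j" for d by (auto simp: unitv_def)
  have FS: "(\<lambda>i. fpow d B (Suc q) i j) = app B (hd_vec d (\<lambda>i. fpow d B q i j))" for d q
    by (simp add: app_hd fun_eq_iff)
  show L: "(\<lambda>i. fpow d B q i j) \<in> l1" for d q
    by (cases q) (simp_all only: F0 FS unitv_l1 app_l1 hd_vec_l1)
  show "(\<lambda>d. n1 (\<lambda>i. fpow d B q i j - (app B ^^ q) (unitv j) i)) \<longlonglongrightarrow> 0"
  proof (induction q)
    case 0
    have "(\<lambda>i. fpow d B 0 i j - (app B ^^ 0) (unitv j) i) = (\<lambda>i. 0)" for d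
      using F0[of d] by (auto simp: fun_eq_iff)
    then show ?case by (simp add: n1_def)
  next
    case (Suc q)
    let ?y = "(app B ^^ q) (unitv j)" and ?x = "\<lambda>d i. fpow d B q i j"
    have y: "?y \<in> l1" by (intro pow_l1 unitv_l1)
    have ub: "n1 (\<lambda>i. fpow d B (Suc q) i j - (app B ^^ Suc q) (unitv j) i)
        \<le> M * (n1 (\<lambda>i. ?x d i - ?y i) + n1 (\<lambda>i. ?y i - hd_vec d ?y i))" for d
    proof -
      have "(\<lambda>i. fpow d B (Suc q) i j - (app B ^^ Suc q) (unitv j) i)
          = app B (\<lambda>i. hd_vec d (?x d) i - ?y i)"
        using FS[of d q] by (simp add: app_diff[OF hd_vec_l1 y] fun_eq_iff)
      then have "n1 (\<lambda>i. fpow d B (Suc q) i j - (app B ^^ Suc q) (unitv j) i)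
          \<le> M * n1 (\<lambda>i. hd_vec d (?x d) i - ?y i)"
        using n1_app_le[OF l1_diff(1)[OF hd_vec_l1[of d "?x d"] y]] by simp
      \<comment> \<open>The error splits into the truncated error of the previous power and the tail
        of the limit column.\<close>
      also have "(\<lambda>i. hd_vec d (?x d) i - ?y i) =
          (\<lambda>i. hd_vec d (\<lambda>i. ?x d i - ?y i) i - (?y i - hd_vec d ?y i))"
        by (auto simp: hd_vec_def)
      also have "n1 \<dots> \<le> n1 (hd_vec d (\<lambda>i. ?x d i - ?y i)) + n1 (\<lambda>i. ?y i - hd_vec d ?y i)"
        by (intro l1_diff hd_vec_l1 y)
      also have "n1 (hd_vec d (\<lambda>i. ?x d i - ?y i)) \<le> n1 (\<lambda>i. ?x d i - ?y i)"
        using l1_diff(1)[OF L y] hd_vec_l1 unfolding n1_def l1_def mem_Collect_eq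
        by (intro suminf_le) (auto simp: hd_vec_def)
      finally show ?thesis using M_nonneg by (simp add: mult_left_mono)
    qed
    have lim: "(\<lambda>d. M * (n1 (\<lambda>i. ?x d i - ?y i) + n1 (\<lambda>i. ?y i - hd_vec d ?y i))) \<longlonglongrightarrow> M * (0 + 0)"
      by (intro tendsto_intros Suc n1_hd_vec_diff y)
    have nn: "0 \<le> n1 (\<lambda>i. fpow d B (Suc q) i j - (app B ^^ Suc q) (unitv j) i)" for d
      by (rule n1_nonneg[OF l1_diff(1)[OF L pow_l1[OF unitv_l1(1)]]])
    show ?case
      by (rule tendsto_sandwich[OF always_eventually[OF allI[OF nn]] always_eventually[OF allI[OF ub]]
            tendsto_const lim[simplified]])
  qed
qed

lemma fpow_tendsto: "(\<lambda>d. fpow d B q i j) \<longlonglongrightarrow> (app B ^^ q) (unitv j) i"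
proof -
  have "cmod (fpow d B q i j - (app B ^^ q) (unitv j) i) \<le> n1 (\<lambda>i. fpow d B q i j - (app B ^^ q) (unitv j) i)" for d
    using cmod_le_n1[OF l1_diff(1)[OF fpow_l1_tendsto(1) pow_l1[OF unitv_l1(1)]]] by blast
  then have "(\<lambda>d. fpow d B q i j - (app B ^^ q) (unitv j) i) \<longlonglongrightarrow> 0"
    by (rule Lim_null_comparison[OF always_eventually[OF allI] fpow_l1_tendsto(2)])
  then show ?thesis by (simp add: LIM_zero_iff)
qed

end

section \<open>Spectral sequences of matrices with p-summable column norms\<close>

definition pmat :: "real \<Rightarrow> (nat \<Rightarrow> nat \<Rightarrow> complex) \<Rightarrow> bool" where
  "pmat p B \<longleftrightarrow> (\<forall>j. (\<lambda>i. B i j) \<in> l1) \<and> summable (\<lambda>j. n1 (\<lambda>i. B i j) powr p)"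

text \<open>The trace of the \<open>q\<close>-th power as a sum along the diagonal;
  \<open>trace_tendsto\<close> provides absolute convergence for \<open>q > p\<close>.\<close>

definition trp :: "(nat \<Rightarrow> nat \<Rightarrow> complex) \<Rightarrow> nat \<Rightarrow> complex" where
  "trp B q = (\<Sum>i. (app B ^^ q) (unitv i) i)"

lemma pmat_l1_matrix:
  assumes "pmat p B" "p > 0"
  obtains M where "l1_matrix B M"
proof -
  let ?S = "\<Sum>j. n1 (\<lambda>i. B i j) powr p"
  have "n1 (\<lambda>i. B i j) \<le> ?S powr (1 / p)" for j
  proof -
    have "n1 (\<lambda>i. B i j) powr p \<le> ?S"
      using sum_le_suminf[of "\<lambda>j. n1 (\<lambda>i. B i j) powr p" "{j}"] assms by (simp add: pmat_def)
    then have "(n1 (\<lambda>i. B i j) powr p) powr (1 / p) \<le> ?S powr (1 / p)"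
      using assms by (intro powr_mono2) auto
    moreover have "0 \<le> n1 (\<lambda>i. B i j)" using assms n1_nonneg by (simp add: pmat_def)
    ultimately show ?thesis using assms by (simp add: powr_powr)
  qed
  then have "l1_matrix B (?S powr (1 / p))" using assms by unfold_locales (auto simp: pmat_def)
  then show ?thesis by (rule that)
qed

lemma summable_inverse_powr:
  assumes "K \<ge> 0" "s > 1" shows "summable (\<lambda>n. (K / real (Suc n)) powr s)"
proof -
  have "summable (\<lambda>n. real n powr (-s))" using assms by (simp add: summable_real_powr_iff)
  then have "summable (\<lambda>n. real (Suc n) powr (-s))" by (subst summable_Suc_iff)
  then have "summable (\<lambda>n. K powr s * real (Suc n) powr (-s))" by (rule summable_mult)
  then show ?thesis using assms by (simp add: powr_divide powr_minus_divide)
qed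

text \<open>For \<open>m = Suc n\<close> the Weyl product bound gives
  \<open>|\<mu> n|^m \<le> \<Prod>k<m. |\<mu> k| \<le> C\<close>, where \<open>C\<close> dominates
  every product of \<open>m\<close> distinct column norms. By the inequality of arithmetic and
  geometric means, \<open>C = (K / m)^(m / p)\<close> is admissible. The constant \<open>K\<close>
  does not depend on the truncation size \<open>d\<close>.\<close>

lemma truncation_eigenvalues:
  fixes d :: nat
  assumes B: "pmat p B" and p: "p > 0"
  defines "K \<equiv> \<Sum>j. n1 (\<lambda>i. B i j) powr p"
  shows "\<exists>\<mu>. (\<forall>n. cmod (\<mu> (Suc n)) \<le> cmod (\<mu> n)) \<and> (\<forall>n\<ge>d. \<mu> n = 0) \<and>
    (\<forall>q. (\<Sum>i<d. fpow d B q i i) = (\<Sum>n<d. \<mu> n ^ q)) \<and>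
    (\<forall>n<d. \<exists>v. (\<exists>i<d. v i \<noteq> 0) \<and> (\<forall>i<d. (\<Sum>j<d. B i j * v j) = \<mu> n * v i)) \<and>
    (\<forall>n. cmod (\<mu> n) \<le> (K / real (Suc n)) powr (1 / p))"
proof -
  obtain \<mu> :: "nat \<Rightarrow> complex" where \<mu>:
    "\<And>n. cmod (\<mu> (Suc n)) \<le> cmod (\<mu> n)" "\<And>n. n \<ge> d \<Longrightarrow> \<mu> n = 0"
    "\<And>q. (\<Sum>i<d. fpow d B q i i) = (\<Sum>n<d. \<mu> n ^ q)"
    "\<And>n. n < d \<Longrightarrow> \<exists>v. (\<exists>i<d. v i \<noteq> 0) \<and> (\<forall>i<d. (\<Sum>j<d. B i j * v j) = \<mu> n * v i)"
    and weyl: "\<And>n \<beta> C. n \<le> d \<Longrightarrow> (\<And>j. j < d \<Longrightarrow> (\<Sum>i<d. cmod (B i j)) \<le> \<beta> j) \<Longrightarrow>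
       (\<And>h. h \<in> {..<n} \<rightarrow>\<^sub>E {..<d} \<Longrightarrow> inj_on h {..<n} \<Longrightarrow> (\<Prod>i<n. \<beta> (h i)) \<le> C) \<Longrightarrow>
       (\<Prod>k<n. cmod (\<mu> k)) \<le> C"
    using finite_matrix_eigenvalues[of d B] by blast
  define \<beta> where "\<beta> j = n1 (\<lambda>i. B i j)" for j
  have sm: "summable (\<lambda>j. \<beta> j powr p)" and K: "K = (\<Sum>j. \<beta> j powr p)"
    using B by (auto simp: pmat_def K_def \<beta>_def)
  have \<beta>0: "0 \<le> \<beta> j" for j using B n1_nonneg by (simp add: pmat_def \<beta>_def)
  have K0: "0 \<le> K" unfolding K by (rule suminf_nonneg[OF sm]) simp
  have col: "(\<Sum>i<d. cmod (B i j)) \<le> \<beta> j" for j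
    unfolding \<beta>_def n1_def using B by (intro sum_le_suminf) (auto simp: pmat_def l1_def)
  have dec: "cmod (\<mu> n) \<le> cmod (\<mu> k)" if "k \<le> n" for k n
    using lift_Suc_antimono_le[of "\<lambda>n. cmod (\<mu> n)"] \<mu>(1) that by blast
  have bnd: "cmod (\<mu> n) \<le> (K / real (Suc n)) powr (1 / p)" for n
  proof (cases "n < d")
    case False then show ?thesis using \<mu>(2) by simp
  next
    case True
    define m where "m = Suc n"
    define C where "C = ((K / m) ^ m) powr (1 / p)"
    have md: "m \<le> d" and m0: "m > 0" using True by (auto simp: m_def)
    have KC: "0 \<le> (K / m) ^ m" using K0 by simp
    have "(\<Prod>i<m. \<beta> (h i)) \<le> C" if h: "inj_on h {..<m}" for h
    proof -
      have "(\<Prod>i<m. \<beta> (h i)) powr p = (\<Prod>i<m. \<beta> (h i) powr p)"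
        using \<beta>0 by (simp add: prod_powr_distrib)
      also have "\<dots> \<le> ((\<Sum>i<m. \<beta> (h i) powr p) / card {..<m}) ^ card {..<m}"
        by (rule prod_le_mean_power) (use m0 in auto)
      \<comment> \<open>Injectivity of \<open>h\<close> enters here: distinct columns together
        contribute at most \<open>K\<close>.\<close>
      also have "(\<Sum>i<m. \<beta> (h i) powr p) = (\<Sum>j\<in>h ` {..<m}. \<beta> j powr p)"
        by (simp add: sum.reindex[OF h])
      also have "(\<dots> / card {..<m}) ^ card {..<m} \<le> (K / m) ^ m"
        unfolding K card_lessThan
        by (intro power_mono divide_right_mono sum_le_suminf sm) (auto intro!: divide_nonneg_nonneg sum_nonneg)
      finally have "((\<Prod>i<m. \<beta> (h i)) powr p) powr (1 / p) \<le> C"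
        unfolding C_def using p by (intro powr_mono2) auto
      then show ?thesis using p \<beta>0 by (simp add: powr_powr prod_nonneg)
    qed
    then have "(\<Prod>k<m. cmod (\<mu> k)) \<le> C" using weyl[OF md col] by blast
    moreover have "cmod (\<mu> n) ^ m \<le> (\<Prod>k<m. cmod (\<mu> k))"
      using prod_mono[of "{..<m}" "\<lambda>_. cmod (\<mu> n)" "\<lambda>k. cmod (\<mu> k)"] dec by (simp add: m_def)
    ultimately have "(cmod (\<mu> n) ^ m) powr p \<le> C powr p" using p by (intro powr_mono2) auto
    also have "C powr p = (K / m) ^ m" unfolding C_def using p KC by (simp add: powr_powr)
    also have "(cmod (\<mu> n) ^ m) powr p = (cmod (\<mu> n) powr p) ^ m"
    proof (cases "\<mu> n = 0")
      case False
      then have "(cmod (\<mu> n) ^ m) powr p = (cmod (\<mu> n) powr real m) powr p"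
        by (simp only: powr_realpow zero_less_norm_iff not_False_eq_True)
      also have "\<dots> = (cmod (\<mu> n) powr p) powr real m" by (simp add: powr_powr mult.commute)
      also have "\<dots> = (cmod (\<mu> n) powr p) ^ m" using False by (intro powr_realpow) simp
      finally show ?thesis .
    qed (simp add: m_def)
    finally have "cmod (\<mu> n) powr p \<le> K / m"
      unfolding m_def by (rule power_le_imp_le_base) (use K0 in auto)
    then have "(cmod (\<mu> n) powr p) powr (1 / p) \<le> (K / m) powr (1 / p)"
      using p by (intro powr_mono2) auto
    then show ?thesis using p by (simp add: powr_powr m_def)
  qed
  show ?thesis using \<mu> bnd by (intro exI[of _ \<mu>]) simp
qed

lemma fpow_norm:
  fixes B :: "nat \<Rightarrow> nat \<Rightarrow> complex"
  shows "cmod (fpow d B q i j) \<le> fpow d (\<lambda>i j. cmod (B i j)) q i j"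
proof (induction q arbitrary: i)
  case (Suc q)
  have "cmod (fpow d B (Suc q) i j) \<le> (\<Sum>k<d. cmod (B i k) * cmod (fpow d B q k j))"
    by (simp add: norm_mult sum_norm_le)
  also have "\<dots> \<le> (\<Sum>k<d. cmod (B i k) * fpow d (\<lambda>i j. cmod (B i j)) q k j)"
    by (intro sum_mono mult_left_mono Suc) simp
  finally show ?case by simp
qed simp

lemma fpow_mono:
  fixes B :: "nat \<Rightarrow> nat \<Rightarrow> real"
  assumes "\<And>i j. 0 \<le> B i j"
  shows "0 \<le> fpow d B q i j" "d \<le> d' \<Longrightarrow> fpow d B q i j \<le> fpow d' B q i j"
proof -
  show nn: "0 \<le> fpow d B q i j" for d q i
    by (induction q arbitrary: i) (auto intro!: sum_nonneg mult_nonneg_nonneg assms)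
  assume le: "d \<le> d'"
  show "fpow d B q i j \<le> fpow d' B q i j"
  proof (induction q arbitrary: i)
    case (Suc q)
    have "(\<Sum>k<d. B i k * fpow d B q k j) \<le> (\<Sum>k<d. B i k * fpow d' B q k j)"
      by (intro sum_mono mult_left_mono Suc assms)
    also have "\<dots> \<le> (\<Sum>k<d'. B i k * fpow d' B q k j)"
      using le by (intro sum_mono2) (auto intro!: mult_nonneg_nonneg assms nn)
    finally show ?case by simp
  qed simp
qed

lemma fpow_of_real:
  "fpow d (\<lambda>i j. complex_of_real (R i j)) q i j = complex_of_real (fpow d R q i j)"
  by (induction q arbitrary: i) auto

text \<open>The matrix of absolute values has the same column norms, hence the same eigenvalue
  bounds, and its truncated traces are at most \<open>T\<close> for all \<open>d\<close>. Its
  diagonal entries increase with \<open>d\<close>, so their limits \<open>g i\<close> form a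
  summable dominating sequence for the truncated traces of \<open>B\<close>. The condition
  \<open>q > p\<close> makes \<open>T\<close> finite.\<close>

lemma trace_tendsto:
  assumes B: "pmat p B" and p: "p > 0" and q: "real q > p"
  shows "summable (\<lambda>i. cmod ((app B ^^ q) (unitv i) i))"
    "(\<lambda>d. \<Sum>i<d. fpow d B q i i) \<longlonglongrightarrow> trp B q"
proof -
  define R where "R d i = fpow d (\<lambda>i j. cmod (B i j)) q i i" for d i
  define A where "A = (\<lambda>i j. complex_of_real (cmod (B i j)))"
  have colA: "n1 (\<lambda>i. A i j) = n1 (\<lambda>i. B i j)" for j by (simp add: n1_def A_def)
  have "(\<lambda>i. A i j) \<in> l1" for j using B by (simp add: pmat_def l1_def A_def)
  then have A: "pmat p A" using B by (simp add: pmat_def colA)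
  define K where "K = (\<Sum>j. n1 (\<lambda>i. A i j) powr p)"
  have K0: "0 \<le> K" unfolding K_def using A by (intro suminf_nonneg) (auto simp: pmat_def)
  define T where "T = (\<Sum>n. (K / real (Suc n)) powr (real q / p))"
  have sT: "summable (\<lambda>n. (K / real (Suc n)) powr (real q / p))"
    using K0 p q by (intro summable_inverse_powr) auto
  have RA: "fpow d A q i i = complex_of_real (R d i)" for d i
    unfolding A_def R_def by (rule fpow_of_real)
  have R0: "0 \<le> R d i" and Rmono: "d \<le> d' \<Longrightarrow> R d i \<le> R d' i" for d d' i
    unfolding R_def by (auto intro: fpow_mono)
  have bound: "(\<Sum>i<d. R d i) \<le> T" for d
  proof -
    obtain \<mu> where \<mu>: "(\<Sum>i<d. fpow d A q i i) = (\<Sum>n<d. \<mu> n ^ q)"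
      "\<And>n. cmod (\<mu> n) \<le> (K / real (Suc n)) powr (1 / p)"
      using truncation_eigenvalues[OF A p, of d] unfolding K_def by blast
    have "(\<Sum>i<d. R d i) = cmod (\<Sum>i<d. fpow d A q i i)"
      unfolding RA of_real_sum[symmetric] norm_of_real using R0 by (simp add: sum_nonneg)
    also have "\<dots> \<le> (\<Sum>n<d. cmod (\<mu> n) ^ q)"
      unfolding \<mu>(1) by (intro order_trans[OF norm_sum]) (simp add: norm_power)
    also have "\<dots> \<le> (\<Sum>n<d. (K / real (Suc n)) powr (real q / p))"
    proof (rule sum_mono)
      fix n
      have "cmod (\<mu> n) ^ q \<le> ((K / real (Suc n)) powr (1 / p)) ^ q"
        by (intro power_mono \<mu>) simp
      also have "\<dots> = (K / real (Suc n)) powr (real q / p)"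
        using q p by (subst powr_realpow'[symmetric]) (auto simp: powr_powr)
      finally show "cmod (\<mu> n) ^ q \<le> (K / real (Suc n)) powr (real q / p)" .
    qed
    also have "\<dots> \<le> T" unfolding T_def by (rule sum_le_suminf[OF sT]) auto
    finally show ?thesis .
  qed
  obtain M' where "l1_matrix A M'" using pmat_l1_matrix[OF A p] .
  then interpret A: l1_matrix A M' .
  obtain M where "l1_matrix B M" using pmat_l1_matrix[OF B p] .
  then interpret B: l1_matrix B M .
  define g where "g i = Re ((app A ^^ q) (unitv i) i)" for i
  have Rg: "(\<lambda>d. R d i) \<longlonglongrightarrow> g i" for i
    using tendsto_Re[OF A.fpow_tendsto[of q i i]] unfolding RA g_def by simp
  have R_le: "R d i \<le> g i" for d i
    by (rule incseq_le[OF _ Rg]) (auto simp: incseq_def Rmono)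
  have sg: "summable g"
  proof (rule summableI_nonneg_bounded)
    show "0 \<le> g i" for i using R0 R_le order_trans by blast
    show "(\<Sum>i<m. g i) \<le> T" for m
    proof (rule LIMSEQ_le_const2)
      show "(\<lambda>d. \<Sum>i<m. R d i) \<longlonglongrightarrow> (\<Sum>i<m. g i)" by (intro tendsto_sum Rg)
      have "(\<Sum>i<m. R d i) \<le> T" if "m \<le> d" for d
      proof -
        have "(\<Sum>i<m. R d i) \<le> (\<Sum>i<d. R d i)" using that R0 by (intro sum_mono2) auto
        then show ?thesis using bound order_trans by blast
      qed
      then show "\<exists>N. \<forall>d\<ge>N. (\<Sum>i<m. R d i) \<le> T" by blast
    qed
  qed
  define a where "a d i = (if i < d then fpow d B q i i else 0)" for d i
  have alim: "(\<lambda>d. a d i) \<longlonglongrightarrow> (app B ^^ q) (unitv i) i" for i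
  proof (rule Lim_transform_eventually[OF B.fpow_tendsto])
    show "\<forall>\<^sub>F d in sequentially. fpow d B q i i = a d i"
      using eventually_gt_at_top[of i] by eventually_elim (simp add: a_def)
  qed
  have adom: "cmod (a d i) \<le> g i" for d i
  proof (cases "i < d")
    case True
    then have "cmod (a d i) \<le> R d i" unfolding a_def R_def by (simp add: fpow_norm)
    then show ?thesis using R_le order_trans by blast
  next
    case False
    then show ?thesis using R0 R_le order_trans by (simp add: a_def) blast
  qed
  have suma: "(\<Sum>i. a d i) = (\<Sum>i<d. fpow d B q i i)" for d
    using sums_If_finite_set[of "{..<d}" "\<lambda>i. fpow d B q i i"] by (simp add: a_def sums_iff)
  show "summable (\<lambda>i. cmod ((app B ^^ q) (unitv i) i))"
    by (rule suminf_dominated_convergence(1)[OF alim adom sg])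
  show "(\<lambda>d. \<Sum>i<d. fpow d B q i i) \<longlonglongrightarrow> trp B q"
    using suminf_dominated_convergence(2)[OF alim adom sg] unfolding suma trp_def .
qed

text \<open>A coordinatewise limit of \<open>\<ell>\<^sup>1\<close>-normalised eigenvectors of the truncations could vanish. Since the columns of \<open>B\<close>
  tend to \<open>0\<close>, the images of these vectors under \<open>B\<close> converge in norm, so \<open>\<kappa> \<noteq> 0\<close> excludes this.\<close>

lemma limit_eigenvector:
  assumes B: "pmat p B" and p: "p > 0"
    and s: "strict_mono (s :: nat \<Rightarrow> nat)" and lam: "\<mu> \<longlonglongrightarrow> \<kappa>" "\<kappa> \<noteq> 0"
    and ev: "\<And>k. \<mu> k \<noteq> 0 \<Longrightarrow> \<exists>v. (\<exists>i<s k. v i \<noteq> 0) \<and> (\<forall>i<s k. (\<Sum>j<s k. B i j * v j) = \<mu> k * v i)"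
  shows "\<exists>v\<in>l1. v \<noteq> (\<lambda>_. 0) \<and> app B v = (\<lambda>i. \<kappa> * v i)"
proof -
  obtain M where "l1_matrix B M" using pmat_l1_matrix[OF B p] .
  then interpret l1_matrix B M .
  have "\<exists>v. v \<in> l1 \<and> n1 v = 1 \<and> hd_vec (s k) (app B v) = (\<lambda>i. \<mu> k * v i)" if k: "\<mu> k \<noteq> 0" for k
  proof -
    obtain u where u: "\<exists>i<s k. u i \<noteq> 0" "\<forall>i<s k. (\<Sum>j<s k. B i j * u j) = \<mu> k * u i"
      using ev[OF k] by blast
    let ?h = "hd_vec (s k) u"
    have h1: "?h \<in> l1" by (rule hd_vec_l1)
    obtain i where "i < s k" "u i \<noteq> 0" using u(1) by blast
    then have "0 < cmod (?h i)" by (simp add: hd_vec_def)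
    also have "\<dots> \<le> n1 ?h" by (rule cmod_le_n1[OF h1])
    finally have pos: "n1 ?h > 0" .
    have app_h: "app B ?h i = (\<Sum>j<s k. B i j * u j)" for i
    proof -
      have "(\<lambda>j. B i j * ?h j) = (\<lambda>j. if j \<in> {..<s k} then B i j * u j else 0)"
        by (auto simp: hd_vec_def)
      then show ?thesis unfolding app_def
        using sums_If_finite_set[of "{..<s k}" "\<lambda>j. B i j * u j"] by (simp add: sums_iff)
    qed
    define c where "c = complex_of_real (1 / n1 ?h)"
    have "n1 (\<lambda>i. c * ?h i) = 1" unfolding n1_scale[OF h1] using pos by (simp add: c_def norm_divide)
    moreover have "hd_vec (s k) (app B (\<lambda>i. c * ?h i)) = (\<lambda>i. \<mu> k * (c * ?h i))"
      unfolding app_scale[OF h1] using u(2) by (auto simp: hd_vec_def app_h fun_eq_iff)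
    ultimately show ?thesis using l1_scale[OF h1] by blast
  qed
  then obtain V where V: "\<And>k. \<mu> k \<noteq> 0 \<Longrightarrow> V k \<in> l1 \<and> n1 (V k) = 1 \<and> hd_vec (s k) (app B (V k)) = (\<lambda>i. \<mu> k * V k i)"
    by metis
  obtain k0 where k0: "\<And>k. k \<ge> k0 \<Longrightarrow> \<mu> k \<noteq> 0"
    using tendsto_imp_eventually_ne[OF lam] unfolding eventually_sequentially by blast
  define W where "W k = V (k + k0)" for k
  define \<nu> where "\<nu> k = \<mu> (k + k0)" for k
  define t where "t k = s (k + k0)" for k
  have W: "W k \<in> l1" "n1 (W k) = 1" "hd_vec (t k) (app B (W k)) = (\<lambda>i. \<nu> k * W k i)" for k
    using V[OF k0[of "k + k0"]] by (auto simp: W_def \<nu>_def t_def)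
  have \<nu>: "\<nu> \<longlonglongrightarrow> \<kappa>" unfolding \<nu>_def using LIMSEQ_ignore_initial_segment[OF lam(1)] .
  have W1: "cmod (W k i) \<le> 1" for k i using cmod_le_n1[OF W(1)] W(2) by metis
  obtain r where r: "strict_mono (r :: nat \<Rightarrow> nat)" and conv: "\<And>i. \<exists>l. (\<lambda>k. W (r k) i) \<longlonglongrightarrow> l"
    using function_convergent_subsequence[of "UNIV :: nat set" W 1] W1 by auto
  define v where "v i = lim (\<lambda>k. W (r k) i)" for i
  have v: "(\<lambda>k. W (r k) i) \<longlonglongrightarrow> v i" for i
    unfolding v_def using conv[of i] by (simp add: convergent_LIMSEQ_iff[symmetric] convergent_def)
  have Wsum: "(\<Sum>i<m. cmod (W k i)) \<le> 1" for m k
    using sum_le_suminf[of "\<lambda>i. cmod (W k i)" "{..<m}"] W(1,2)[of k] by (simp add: l1_def n1_def)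
  have vsum: "(\<Sum>i<m. cmod (v i)) \<le> 1" for m
    by (rule LIMSEQ_le_const2[of "\<lambda>k. \<Sum>i<m. cmod (W (r k) i)"])
       (auto intro!: tendsto_sum tendsto_norm v Wsum)
  have vl1: "v \<in> l1" unfolding l1_def mem_Collect_eq
    by (rule summableI_nonneg_bounded[OF _ vsum]) auto
  have nv: "n1 v \<le> 1" unfolding n1_def
    using vl1 by (intro suminf_le_const vsum) (auto simp: l1_def)
  define \<beta> where "\<beta> j = n1 (\<lambda>i. B i j)" for j
  have \<beta>0: "0 \<le> \<beta> j" for j unfolding \<beta>_def by (rule n1_nonneg[OF col])
  have \<beta>lim: "\<beta> \<longlonglongrightarrow> 0"
  proof -
    have "(\<lambda>j. \<beta> j powr p) \<longlonglongrightarrow> 0" using B unfolding pmat_def \<beta>_def by (intro summable_LIMSEQ_zero) auto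
    then have "(\<lambda>j. (\<beta> j powr p) powr (1 / p)) \<longlonglongrightarrow> 0 powr (1 / p)"
      using p by (intro tendsto_powr') (auto intro: tendsto_intros)
    then show ?thesis using p \<beta>0 by (simp add: powr_powr)
  qed
  let ?w = "app B v"
  have wl1: "?w \<in> l1" by (rule app_l1[OF vl1])
  have conv_n1: "(\<lambda>k. n1 (\<lambda>i. app B (W (r k)) i - ?w i)) \<longlonglongrightarrow> 0"
  proof (rule LIMSEQ_I)
    fix e :: real assume e: "e > 0"
    \<comment> \<open>The difference of \<open>W (r k)\<close> and \<open>v\<close> has norm at most
      \<open>2\<close>, so columns below \<open>e / 4\<close> leave at most \<open>e / 2\<close> for
      the tail; the finitely many first coordinates converge separately.\<close>
    obtain J where J: "\<And>j. j \<ge> J \<Longrightarrow> \<beta> j < e / 4"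
      using order_tendstoD(2)[OF \<beta>lim, of "e / 4"] e unfolding eventually_sequentially by auto
    have "(\<lambda>k. \<Sum>j<J. \<beta> j * cmod (W (r k) j - v j)) \<longlonglongrightarrow> (\<Sum>j<J. \<beta> j * cmod (v j - v j))"
      by (intro tendsto_sum tendsto_mult tendsto_const tendsto_norm tendsto_diff v)
    then have "(\<lambda>k. \<Sum>j<J. \<beta> j * cmod (W (r k) j - v j)) \<longlonglongrightarrow> 0" by simp
    then obtain k1 where k1: "\<And>k. k \<ge> k1 \<Longrightarrow> (\<Sum>j<J. \<beta> j * cmod (W (r k) j - v j)) < e / 2"
      using order_tendstoD(2)[of _ 0 sequentially "e / 2"] e unfolding eventually_sequentially by fastforce
    have "norm (n1 (\<lambda>i. app B (W (r k)) i - ?w i) - 0) < e" if k: "k \<ge> k1" for k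
    proof -
      define x where "x = (\<lambda>j. W (r k) j - v j)"
      have x: "x \<in> l1" unfolding x_def by (rule l1_diff(1)[OF W(1) vl1])
      have nx: "n1 x \<le> 2" using l1_diff(2)[OF W(1)[of "r k"] vl1] W(2)[of "r k"] nv by (simp add: x_def)
      have sx: "summable (\<lambda>j. cmod (x j))" using x by (simp add: l1_def)
      have "n1 (\<lambda>i. app B (W (r k)) i - ?w i) = n1 (app B x)"
        unfolding x_def app_diff[OF W(1) vl1] ..
      also have "\<dots> \<le> (\<Sum>j. \<beta> j * cmod (x j))" unfolding \<beta>_def by (rule app_l1_weighted(2)[OF x])
      also have "\<dots> \<le> (\<Sum>j. (if j < J then \<beta> j * cmod (x j) else 0) + e / 4 * cmod (x j))"
      proof (rule suminf_le)
        show "summable (\<lambda>j. \<beta> j * cmod (x j))" unfolding \<beta>_def by (rule app_l1_weighted(3)[OF x])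
        have "summable (\<lambda>j. if j \<in> {..<J} then \<beta> j * cmod (x j) else 0)" by (rule summable_If_finite_set) simp
        then show "summable (\<lambda>j. (if j < J then \<beta> j * cmod (x j) else 0) + e / 4 * cmod (x j))"
          using summable_add[OF _ summable_mult[OF sx, of "e / 4"]] by fastforce
        show "\<beta> j * cmod (x j) \<le> (if j < J then \<beta> j * cmod (x j) else 0) + e / 4 * cmod (x j)" for j
          using mult_right_mono[of "\<beta> j" "e / 4" "cmod (x j)"] J[of j] e by (cases "j < J") auto
      qed
      also have "\<dots> = (\<Sum>j<J. \<beta> j * cmod (x j)) + e / 4 * n1 x"
      proof -
        have "(\<lambda>j. if j \<in> {..<J} then \<beta> j * cmod (x j) else 0) sums (\<Sum>j<J. \<beta> j * cmod (x j))"
          by (rule sums_If_finite_set) simp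
        moreover have "(\<lambda>j. e / 4 * cmod (x j)) sums (e / 4 * n1 x)"
          unfolding n1_def by (intro sums_mult summable_sums sx)
        ultimately have "(\<lambda>j. (if j \<in> {..<J} then \<beta> j * cmod (x j) else 0) + e / 4 * cmod (x j)) sums
            ((\<Sum>j<J. \<beta> j * cmod (x j)) + e / 4 * n1 x)" by (rule sums_add)
        then show ?thesis by (simp add: sums_iff)
      qed
      also have "\<dots> < e / 2 + e / 4 * 2"
        using k1[OF k] nx e unfolding x_def[symmetric] by (intro add_less_le_mono) (auto simp: x_def)
      finally have "n1 (\<lambda>i. app B (W (r k)) i - ?w i) < e" by simp
      moreover have "0 \<le> n1 (\<lambda>i. app B (W (r k)) i - ?w i)"
        by (rule n1_nonneg[OF l1_diff(1)[OF app_l1[OF W(1)] wl1]])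
      ultimately show ?thesis by simp
    qed
    then show "\<exists>k1. \<forall>k\<ge>k1. norm (n1 (\<lambda>i. app B (W (r k)) i - ?w i) - 0) < e" by blast
  qed
  have t_inf: "filterlim (\<lambda>k. t (r k)) at_top sequentially"
  proof -
    have "strict_mono (\<lambda>k. t (r k))" using s r unfolding t_def strict_mono_def by simp
    then show ?thesis by (rule filterlim_subseq)
  qed
  have lim2: "(\<lambda>k. n1 (\<lambda>i. \<nu> (r k) * W (r k) i - ?w i)) \<longlonglongrightarrow> 0"
  proof -
    have "n1 (\<lambda>i. \<nu> (r k) * W (r k) i - ?w i) \<le> n1 (\<lambda>i. app B (W (r k)) i - ?w i) + n1 (\<lambda>i. ?w i - hd_vec (t (r k)) ?w i)" for k
    proof -
      have "(\<lambda>i. \<nu> (r k) * W (r k) i - ?w i) =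
          (\<lambda>i. hd_vec (t (r k)) (\<lambda>i. app B (W (r k)) i - ?w i) i - (?w i - hd_vec (t (r k)) ?w i))"
        unfolding fun_cong[OF W(3)[of "r k"], symmetric] by (auto simp: hd_vec_def fun_eq_iff)
      moreover have "n1 \<dots> \<le> n1 (hd_vec (t (r k)) (\<lambda>i. app B (W (r k)) i - ?w i)) + n1 (\<lambda>i. ?w i - hd_vec (t (r k)) ?w i)"
        by (rule l1_diff(2)[OF hd_vec_l1 l1_diff(1)[OF wl1 hd_vec_l1]])
      moreover have "n1 (hd_vec (t (r k)) (\<lambda>i. app B (W (r k)) i - ?w i)) \<le> n1 (\<lambda>i. app B (W (r k)) i - ?w i)"
        using l1_diff(1)[OF app_l1[OF W(1)] wl1] hd_vec_l1 unfolding n1_def l1_def mem_Collect_eq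
        by (intro suminf_le) (auto simp: hd_vec_def)
      ultimately show ?thesis by simp
    qed
    moreover have "(\<lambda>k. n1 (\<lambda>i. app B (W (r k)) i - ?w i) + n1 (\<lambda>i. ?w i - hd_vec (t (r k)) ?w i)) \<longlonglongrightarrow> 0 + 0"
      by (intro tendsto_add conv_n1 filterlim_compose[OF n1_hd_vec_diff[OF wl1] t_inf])
    moreover have "0 \<le> n1 (\<lambda>i. \<nu> (r k) * W (r k) i - ?w i)" for k
      by (rule n1_nonneg[OF l1_diff(1)[OF l1_scale[OF W(1)] wl1]])
    ultimately show ?thesis
      using tendsto_sandwich[OF always_eventually[OF allI] always_eventually[OF allI] tendsto_const]
      by (metis (no_types, lifting) add_0)
  qed
  have \<nu>r: "(\<lambda>k. \<nu> (r k)) \<longlonglongrightarrow> \<kappa>" using LIMSEQ_subseq_LIMSEQ[OF \<nu> r] by (simp add: o_def)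
  have eq: "?w i = \<kappa> * v i" for i
  proof -
    have "cmod (\<nu> (r k) * W (r k) i - ?w i) \<le> n1 (\<lambda>i. \<nu> (r k) * W (r k) i - ?w i)" for k
      using cmod_le_n1[OF l1_diff(1)[OF l1_scale[OF W(1)] wl1]] .
    then have "(\<lambda>k. \<nu> (r k) * W (r k) i - ?w i) \<longlonglongrightarrow> 0"
      by (rule Lim_null_comparison[OF always_eventually[OF allI] lim2])
    then have "(\<lambda>k. \<nu> (r k) * W (r k) i) \<longlonglongrightarrow> ?w i" by (rule LIM_zero_cancel)
    moreover have "(\<lambda>k. \<nu> (r k) * W (r k) i) \<longlonglongrightarrow> \<kappa> * v i" by (intro tendsto_mult \<nu>r v)
    ultimately show ?thesis by (rule LIMSEQ_unique)
  qed
  \<comment> \<open>The vectors \<open>W\<close> have norm \<open>1\<close>, so norm convergence of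
    \<open>\<nu> * W\<close> to \<open>?w\<close> identifies the norm of \<open>?w\<close>. It is
    nonzero, hence \<open>v\<close> is nonzero.\<close>
  have "n1 ?w = cmod \<kappa>"
  proof -
    have "\<bar>cmod (\<nu> (r k)) - n1 ?w\<bar> \<le> n1 (\<lambda>i. \<nu> (r k) * W (r k) i - ?w i)" for k
      using n1_reverse_triangle[OF l1_scale[OF W(1)[of "r k"], of "\<nu> (r k)"] wl1] by (simp add: n1_scale W)
    then have "norm (cmod (\<nu> (r k)) - n1 ?w) \<le> n1 (\<lambda>i. \<nu> (r k) * W (r k) i - ?w i)" for k by simp
    then have "(\<lambda>k. cmod (\<nu> (r k)) - n1 ?w) \<longlonglongrightarrow> 0"
      by (rule Lim_null_comparison[OF always_eventually[OF allI] lim2])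
    then have "(\<lambda>k. cmod (\<nu> (r k))) \<longlonglongrightarrow> n1 ?w" by (rule LIM_zero_cancel)
    then show ?thesis using LIMSEQ_unique tendsto_norm[OF \<nu>r] by blast
  qed
  then have "v \<noteq> (\<lambda>_. 0)" using lam(2) by (auto simp: app_def n1_def)
  then show ?thesis using vl1 eq by blast
qed

text \<open>The bound \<open>c n\<close> does not depend on \<open>d\<close>. It makes the
  eigenvalue lists relatively compact coordinatewise and dominates their \<open>q\<close>-th powers,
  so that the trace formula passes to the limit along a subsequence.\<close>

lemma spectral_sequence:
  assumes B: "pmat p B" and p: "p > 0"
  defines "K \<equiv> \<Sum>j. n1 (\<lambda>i. B i j) powr p"
  obtains \<mu> :: "nat \<Rightarrow> complex" where
    "\<And>n. cmod (\<mu> (Suc n)) \<le> cmod (\<mu> n)"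
    "\<And>n. cmod (\<mu> n) \<le> (K / real (Suc n)) powr (1 / p)"
    "\<And>q. real q > p \<Longrightarrow> (\<lambda>n. \<mu> n ^ q) sums trp B q"
    "\<And>n. \<mu> n \<noteq> 0 \<Longrightarrow> \<exists>v\<in>l1. v \<noteq> (\<lambda>_. 0) \<and> app B v = (\<lambda>i. \<mu> n * v i)"
proof -
  have K0: "0 \<le> K" unfolding K_def using B by (intro suminf_nonneg) (auto simp: pmat_def)
  define c where "c n = (K / real (Suc n)) powr (1 / p)" for n
  define P where "P d \<nu> \<longleftrightarrow> (\<forall>n. cmod (\<nu> (Suc n)) \<le> cmod (\<nu> n)) \<and> (\<forall>n\<ge>d. \<nu> n = 0) \<and>
    (\<forall>q. (\<Sum>i<d. fpow d B q i i) = (\<Sum>n<d. \<nu> n ^ q)) \<and>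
    (\<forall>n<d. \<exists>v. (\<exists>i<d. v i \<noteq> 0) \<and> (\<forall>i<d. (\<Sum>j<d. B i j * v j) = \<nu> n * v i)) \<and>
    (\<forall>n. cmod (\<nu> n) \<le> c n)" for d and \<nu> :: "nat \<Rightarrow> complex"
  have "\<exists>\<nu>. P d \<nu>" for d
    unfolding P_def c_def K_def by (rule truncation_eigenvalues[OF B p])
  then obtain m where "\<And>d. P d (m d)" by metis
  then have m: "\<And>d n. cmod (m d (Suc n)) \<le> cmod (m d n)" "\<And>d n. n \<ge> d \<Longrightarrow> m d n = 0"
    "\<And>d q. (\<Sum>i<d. fpow d B q i i) = (\<Sum>n<d. m d n ^ q)"
    "\<And>d n. n < d \<Longrightarrow> \<exists>v. (\<exists>i<d. v i \<noteq> 0) \<and> (\<forall>i<d. (\<Sum>j<d. B i j * v j) = m d n * v i)"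
    "\<And>d n. cmod (m d n) \<le> c n"
    unfolding P_def by blast+
  have c0: "c n \<le> c 0" for n
    unfolding c_def using K0 p by (intro powr_mono2) (auto intro!: divide_left_mono simp: field_simps)
  obtain r where r: "strict_mono (r :: nat \<Rightarrow> nat)" and conv: "\<And>n. \<exists>l. (\<lambda>k. m (r k) n) \<longlonglongrightarrow> l"
    using function_convergent_subsequence[of "UNIV :: nat set" m "c 0"] order_trans[OF m(5) c0] by auto
  define \<mu> where "\<mu> n = lim (\<lambda>k. m (r k) n)" for n
  have \<mu>: "(\<lambda>k. m (r k) n) \<longlonglongrightarrow> \<mu> n" for n
    unfolding \<mu>_def using conv[of n] by (simp add: convergent_LIMSEQ_iff[symmetric] convergent_def)
  show ?thesis
  proof (rule that[of \<mu>])
    show "cmod (\<mu> (Suc n)) \<le> cmod (\<mu> n)" for n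
      by (rule LIMSEQ_le[OF tendsto_norm[OF \<mu>] tendsto_norm[OF \<mu>]]) (use m(1) in blast)
    show "cmod (\<mu> n) \<le> (K / real (Suc n)) powr (1 / p)" for n
      by (rule LIMSEQ_le_const2[OF tendsto_norm[OF \<mu>]]) (use m(5) in \<open>auto simp: c_def\<close>)
    show "(\<lambda>n. \<mu> n ^ q) sums trp B q" if q: "real q > p" for q
    proof -
      have sc: "summable (\<lambda>n. c n ^ q)"
      proof -
        have "c n ^ q = (K / real (Suc n)) powr (real q / p)" for n
          unfolding c_def using q p by (subst powr_realpow'[symmetric]) (auto simp: powr_powr)
        then show ?thesis using summable_inverse_powr[OF K0, of "real q / p"] p q by simp
      qed
      have q0: "q > 0" using q p by (cases q) auto
      have lim: "(\<lambda>k. m (r k) n ^ q) \<longlonglongrightarrow> \<mu> n ^ q" for n by (intro tendsto_power \<mu>)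
      have dom: "cmod (m (r k) n ^ q) \<le> c n ^ q" for k n
        unfolding norm_power by (rule power_mono[OF m(5)]) simp
      have "(\<Sum>n. m d n ^ q) = (\<Sum>i<d. fpow d B q i i)" for d
        unfolding m(3) by (rule suminf_finite) (use m(2) q0 in auto)
      then have "(\<lambda>k. \<Sum>n. m (r k) n ^ q) \<longlonglongrightarrow> trp B q"
        using LIMSEQ_subseq_LIMSEQ[OF trace_tendsto(2)[OF B p q] r] by (simp add: o_def)
      then have "(\<Sum>n. \<mu> n ^ q) = trp B q"
        using suminf_dominated_convergence(2)[OF lim dom sc] LIMSEQ_unique by blast
      moreover have "summable (\<lambda>n. \<mu> n ^ q)"
        using suminf_dominated_convergence(1)[OF lim dom sc] by (rule summable_norm_cancel)
      ultimately show ?thesis by (simp add: sums_iff)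
    qed
    show "\<exists>v\<in>l1. v \<noteq> (\<lambda>_. 0) \<and> app B v = (\<lambda>i. \<mu> n * v i)" if nz: "\<mu> n \<noteq> 0" for n
    proof (rule limit_eigenvector[OF B p r \<mu> nz])
      fix k assume "m (r k) n \<noteq> 0"
      then have "n < r k" using m(2)[of "r k" n] by (metis not_le)
      then show "\<exists>v. (\<exists>i<r k. v i \<noteq> 0) \<and> (\<forall>i<r k. (\<Sum>j<r k. B i j * v j) = m (r k) n * v i)"
        by (rule m(4))
    qed
  qed
qed

section \<open>Recovering multiplicities from power sums\<close>

lemma finite_fiber:
  fixes a :: "nat \<Rightarrow> complex"
  assumes "summable (\<lambda>n. cmod (a n) ^ q)" "\<mu> \<noteq> 0"
  shows "finite {n. cmod (a n) \<ge> cmod \<mu>}" "finite {n. a n = \<mu>}"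
proof -
  have "(\<lambda>n. cmod (a n) ^ q) \<longlonglongrightarrow> 0" by (rule summable_LIMSEQ_zero[OF assms(1)])
  moreover have "0 < cmod \<mu> ^ q" using assms by simp
  ultimately obtain n0 where n0: "\<And>n. n \<ge> n0 \<Longrightarrow> cmod (a n) ^ q < cmod \<mu> ^ q"
    using order_tendstoD(2)[of "\<lambda>n. cmod (a n) ^ q" 0 sequentially "cmod \<mu> ^ q"]
    unfolding eventually_sequentially by blast
  have "{n. cmod (a n) \<ge> cmod \<mu>} \<subseteq> {..<n0}"
  proof
    fix n assume "n \<in> {n. cmod (a n) \<ge> cmod \<mu>}"
    then have "cmod \<mu> ^ q \<le> cmod (a n) ^ q" by (simp add: power_mono)
    then show "n \<in> {..<n0}" using n0[of n] by (meson lessThan_iff not_le)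
  qed
  then show f: "finite {n. cmod (a n) \<ge> cmod \<mu>}" using finite_subset by blast
  show "finite {n. a n = \<mu>}" by (rule finite_subset[OF _ f]) auto
qed

text \<open>A term with \<open>a n = \<mu>\<close> equals \<open>1\<close>, the other large values
  are roots of \<open>R\<close>, and all remaining ratios have modulus at most \<open>1 / 2\<close>
  and die out. Wherever \<open>poly R (a n)\<close> is nonzero the ratio has modulus at most
  \<open>1\<close>, so a multiple of \<open>cmod (a n) ^ q0\<close> dominates the series.\<close>

lemma power_sum_limit:
  fixes a :: "nat \<Rightarrow> complex" and R :: "complex poly"
  assumes a: "summable (\<lambda>n. cmod (a n) ^ q0)" and \<mu>: "\<mu> \<noteq> 0" "poly R \<mu> = 1"
    and R: "\<And>n. a n \<noteq> \<mu> \<Longrightarrow> cmod (a n) \<ge> cmod \<mu> / 2 \<Longrightarrow> poly R (a n) = 0"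
  shows "(\<lambda>Q. \<Sum>n. (a n / \<mu>) ^ (q0 + Q) * poly R (a n)) \<longlonglongrightarrow> of_nat (card {n. a n = \<mu>})"
proof -
  obtain C where C: "\<And>n. cmod (a n) \<le> C"
  proof -
    have "Bseq (\<lambda>n. cmod (a n) ^ q0)"
      by (rule convergent_imp_Bseq[OF convergentI[OF summable_LIMSEQ_zero[OF a]]])
    then obtain D where D: "\<And>n. cmod (a n) ^ q0 \<le> D" unfolding Bseq_def by (auto simp: norm_power)
    have "cmod (a n) \<le> max 1 D" for n
    proof (cases "cmod (a n) \<le> 1 \<or> q0 = 0")
      case True
      show ?thesis
      proof (cases "q0 = 0")
        case True
        then have "summable (\<lambda>n::nat. 1::real)" using a by simp
        then have False by (simp only: summable_const_iff)
        then show ?thesis ..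
      qed (use True in auto)
    next
      case False
      then have "cmod (a n) ^ 1 \<le> cmod (a n) ^ q0" by (intro power_increasing) auto
      then show ?thesis using D[of n] by simp
    qed
    then show ?thesis by (rule that)
  qed
  have "bounded (poly R ` cball 0 C)"
    by (intro compact_imp_bounded compact_continuous_image continuous_intros compact_cball)
  then obtain M where "\<forall>x\<in>poly R ` cball 0 C. norm x \<le> M" unfolding bounded_iff by blast
  then have M: "cmod (poly R (a n)) \<le> M" for n using C[of n] by auto
  have M0: "0 \<le> M" using M[of 0] norm_ge_zero order_trans by blast
  define L where "L n = (if a n = \<mu> then 1 else 0 :: complex)" for n
  define g where "g n = M * (1 / cmod \<mu> ^ q0) * cmod (a n) ^ q0" for n
  have sg: "summable g" unfolding g_def by (rule summable_mult[OF a])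
  have cases: "a n = \<mu> \<or> poly R (a n) = 0 \<or> cmod (a n / \<mu>) \<le> 1 / 2" for n
    using R[of n] \<mu>(1) by (auto simp: norm_divide field_simps)
  have lim: "(\<lambda>Q. (a n / \<mu>) ^ (q0 + Q) * poly R (a n)) \<longlonglongrightarrow> L n" for n
  proof -
    consider "a n = \<mu>" | "a n \<noteq> \<mu>" "poly R (a n) = 0" | "a n \<noteq> \<mu>" "cmod (a n / \<mu>) \<le> 1 / 2" using cases by blast
    then show ?thesis
    proof cases
      case 3
      have "(\<lambda>Q. (a n / \<mu>) ^ Q) \<longlonglongrightarrow> 0" using 3 by (intro LIMSEQ_power_zero) simp
      then have "(\<lambda>Q. (a n / \<mu>) ^ q0 * (a n / \<mu>) ^ Q * poly R (a n)) \<longlonglongrightarrow> (a n / \<mu>) ^ q0 * 0 * poly R (a n)"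
        by (intro tendsto_mult tendsto_const)
      then show ?thesis using 3 by (simp add: L_def power_add)
    qed (use \<mu> in \<open>simp_all add: L_def\<close>)
  qed
  have dom: "cmod ((a n / \<mu>) ^ (q0 + Q) * poly R (a n)) \<le> g n" for Q n
  proof -
    have "cmod ((a n / \<mu>) ^ Q) * cmod (poly R (a n)) \<le> 1 * M"
    proof (cases "poly R (a n) = 0")
      case False
      then have "cmod (a n / \<mu>) \<le> 1" using cases[of n] \<mu> by auto
      then show ?thesis using M unfolding norm_power by (intro mult_mono power_le_one) auto
    qed (use M0 in simp)
    then have "cmod ((a n / \<mu>) ^ q0) * (cmod ((a n / \<mu>) ^ Q) * cmod (poly R (a n))) \<le> cmod ((a n / \<mu>) ^ q0) * (1 * M)"
      by (rule mult_left_mono) simp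
    then show ?thesis by (simp add: g_def norm_mult power_add norm_power norm_divide power_divide mult_ac)
  qed
  have "(\<Sum>n. L n) = of_nat (card {n. a n = \<mu>})"
  proof -
    have "(\<Sum>n. L n) = (\<Sum>n\<in>{n. a n = \<mu>}. L n)"
      by (rule suminf_finite[OF finite_fiber(2)[OF a \<mu>(1)]]) (auto simp: L_def)
    also have "\<dots> = (\<Sum>n\<in>{n. a n = \<mu>}. 1)" by (rule sum.cong) (auto simp: L_def)
    finally show ?thesis by simp
  qed
  then show ?thesis using suminf_dominated_convergence(2)[OF lim dom sg] by simp
qed

text \<open>The polynomial \<open>R\<close> in the proof equals \<open>1\<close> at \<open>\<mu>\<close> and kills the finitely many other values of modulus at least
  \<open>\<bar>\<mu>\<bar> / 2\<close>, so that \<open>\<Sum>n. (a n / \<mu>)^q * poly R (a n)\<close> tends to the multiplicity of \<open>\<mu>\<close>.\<close>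

lemma power_sums_determine_multiplicity:
  fixes a b :: "nat \<Rightarrow> complex"
  assumes a: "summable (\<lambda>n. cmod (a n) ^ q0)" and b: "summable (\<lambda>n. cmod (b n) ^ q0)"
    and eq: "\<And>q. q \<ge> q0 \<Longrightarrow> (\<lambda>n. a n ^ q) sums T q \<and> (\<lambda>n. b n ^ q) sums T q"
    and \<mu>: "\<mu> \<noteq> 0"
  shows "card {n. a n = \<mu>} = card {n. b n = \<mu>}"
proof -
  define Z where "Z = (a ` {n. cmod (a n) \<ge> cmod (\<mu> / 2)} \<union> b ` {n. cmod (b n) \<ge> cmod (\<mu> / 2)}) - {\<mu>}"
  have fZ: "finite Z" unfolding Z_def
    using finite_fiber(1)[OF a, of "\<mu> / 2"] finite_fiber(1)[OF b, of "\<mu> / 2"] \<mu> by auto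
  define R where "R = Polynomial.smult (1 / (\<Prod>z\<in>Z. \<mu> - z)) (\<Prod>z\<in>Z. [:-z, 1:])"
  have "(\<Prod>z\<in>Z. \<mu> - z) \<noteq> 0" using fZ by (auto simp: Z_def)
  then have R1: "poly R \<mu> = 1" by (simp add: R_def poly_prod)
  have R0: "poly R z = 0" if "z \<in> Z" for z
    using that fZ by (auto simp: R_def poly_prod)
  have Ra: "poly R (a n) = 0" if "a n \<noteq> \<mu>" "cmod (a n) \<ge> cmod \<mu> / 2" for n
    using that by (intro R0) (auto simp: Z_def norm_divide)
  have Rb: "poly R (b n) = 0" if "b n \<noteq> \<mu>" "cmod (b n) \<ge> cmod \<mu> / 2" for n
    using that by (intro R0) (auto simp: Z_def norm_divide)
  \<comment> \<open>Expanding \<open>R\<close> writes the weighted series as a finite combination of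
    power sums with exponents at least \<open>q0\<close>; the result involves only \<open>T\<close>,
    so it is the same for \<open>a\<close> and \<open>b\<close>.\<close>
  have S: "(\<lambda>n. (x n / \<mu>) ^ (q0 + Q) * poly R (x n)) sums
      (\<Sum>k\<le>degree R. coeff R k / \<mu> ^ (q0 + Q) * T (q0 + Q + k))"
    if "\<And>q. q \<ge> q0 \<Longrightarrow> (\<lambda>n. x n ^ q) sums T q" for x :: "nat \<Rightarrow> complex" and Q
  proof -
    have "(\<lambda>n. \<Sum>k\<le>degree R. coeff R k / \<mu> ^ (q0 + Q) * x n ^ (q0 + Q + k)) sums
        (\<Sum>k\<le>degree R. coeff R k / \<mu> ^ (q0 + Q) * T (q0 + Q + k))"
      by (rule sums_sum) (intro sums_mult that, simp)
    moreover have "(\<Sum>k\<le>degree R. coeff R k / \<mu> ^ (q0 + Q) * x n ^ (q0 + Q + k))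
        = (x n / \<mu>) ^ (q0 + Q) * poly R (x n)" for n
      unfolding poly_altdef sum_distrib_left by (intro sum.cong refl) (simp add: power_add power_divide)
    ultimately show ?thesis by simp
  qed
  have "(\<Sum>n. (a n / \<mu>) ^ (q0 + Q) * poly R (a n)) = (\<Sum>n. (b n / \<mu>) ^ (q0 + Q) * poly R (b n))" for Q
    using S[of a Q] S[of b Q] eq by (simp add: sums_iff)
  then have "(of_nat (card {n. a n = \<mu>}) :: complex) = of_nat (card {n. b n = \<mu>})"
    using LIMSEQ_unique[OF power_sum_limit[OF a \<mu> R1 Ra]] power_sum_limit[OF b \<mu> R1 Rb] by auto
  then show ?thesis by simp
qed

text \<open>Pointwise complex scaling makes span, independence and the exchange bound available for
  sequences and for functions on the shift space alike.\<close>

interpretation fv: vector_space "\<lambda>(c::complex) (f::'i \<Rightarrow> complex) x. c * f x"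
  by unfold_locales (auto simp: fun_eq_iff algebra_simps)

section \<open>Generalised eigenspaces and Wielandt deflation\<close>

text \<open>The name stands for linear independence. The coordinate form is that of
  \<open>lin_indep_fun\<close>, over an arbitrary index type.\<close>

definition lindep :: "('i \<Rightarrow> complex) set \<Rightarrow> bool" where
  "lindep S \<longleftrightarrow> finite S \<and> (\<forall>c. (\<forall>w. (\<Sum>f\<in>S. c f * f w) = 0) \<longrightarrow> (\<forall>f\<in>S. c f = 0))"

definition has_basis :: "('i \<Rightarrow> complex) set \<Rightarrow> nat \<Rightarrow> bool" where
  "has_basis E c \<longleftrightarrow> (\<exists>S\<subseteq>E. finite S \<and> card S = c \<and> fv.independent S \<and> E \<subseteq> fv.span S)"

text \<open>Subspace and linearity in one predicate, relative to \<open>E\<close>: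
  \<open>app B\<close> is defined by \<open>suminf\<close> and its linearity is available on
  \<open>l1\<close>, where the series converge.\<close>

definition lin_on :: "('i \<Rightarrow> complex) set \<Rightarrow> (('i \<Rightarrow> complex) \<Rightarrow> ('j \<Rightarrow> complex)) \<Rightarrow> bool" where
  "lin_on E T \<longleftrightarrow> (\<lambda>_. 0) \<in> E \<and> (\<forall>x\<in>E. \<forall>y\<in>E. (\<lambda>i. x i + y i) \<in> E \<and> T (\<lambda>i. x i + y i) = (\<lambda>i. T x i + T y i)) \<and>
     (\<forall>x\<in>E. \<forall>c. (\<lambda>i. c * x i) \<in> E \<and> T (\<lambda>i. c * x i) = (\<lambda>i. c * T x i))"

definition eig_shift :: "(('i \<Rightarrow> complex) \<Rightarrow> ('i \<Rightarrow> complex)) \<Rightarrow> complex \<Rightarrow> ('i \<Rightarrow> complex) \<Rightarrow> 'i \<Rightarrow> complex" where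
  "eig_shift T \<mu> = (\<lambda>x i. T x i - \<mu> * x i)"

definition gen_ker :: "(('i \<Rightarrow> complex) \<Rightarrow> ('i \<Rightarrow> complex)) \<Rightarrow> ('i \<Rightarrow> complex) set \<Rightarrow> complex \<Rightarrow> ('i \<Rightarrow> complex) set" where
  "gen_ker T E \<mu> = {x \<in> E. \<exists>k. (eig_shift T \<mu> ^^ k) x = (\<lambda>_. 0)}"

lemma eig_shift_apply: "eig_shift T \<mu> x = (\<lambda>i. T x i - \<mu> * x i)"
  by (simp add: eig_shift_def)

lemma sum_fun_apply: "(\<Sum>f\<in>S. g f) w = (\<Sum>f\<in>S. g f w)"
  for g :: "'a \<Rightarrow> 'b \<Rightarrow> complex"
  by (induction S rule: infinite_finite_induct) auto

lemma lindep_iff: "lindep S \<longleftrightarrow> finite S \<and> fv.independent S"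
proof (cases "finite S")
  case True
  have "fv.dependent S \<longleftrightarrow> (\<exists>c. (\<exists>f\<in>S. c f \<noteq> 0) \<and> (\<forall>w. (\<Sum>f\<in>S. c f * f w) = 0))"
    unfolding fv.dependent_finite[OF True] by (simp add: fun_eq_iff sum_fun_apply)
  then show ?thesis using True unfolding lindep_def by blast
qed (simp add: lindep_def)

lemma lin_onD:
  assumes "lin_on E T"
  shows "(\<lambda>_. 0) \<in> E" "T (\<lambda>_. 0) = (\<lambda>_. 0)"
    "x \<in> E \<Longrightarrow> y \<in> E \<Longrightarrow> (\<lambda>i. x i + y i) \<in> E"
    "x \<in> E \<Longrightarrow> y \<in> E \<Longrightarrow> T (\<lambda>i. x i + y i) = (\<lambda>i. T x i + T y i)"
    "x \<in> E \<Longrightarrow> (\<lambda>i. c * x i) \<in> E" "x \<in> E \<Longrightarrow> T (\<lambda>i. c * x i) = (\<lambda>i. c * T x i)"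
    "x \<in> E \<Longrightarrow> y \<in> E \<Longrightarrow> (\<lambda>i. x i - y i) \<in> E"
    "x \<in> E \<Longrightarrow> y \<in> E \<Longrightarrow> T (\<lambda>i. x i - y i) = (\<lambda>i. T x i - T y i)"
proof -
  show z: "(\<lambda>_. 0) \<in> E" using assms by (simp add: lin_on_def)
  have sc: "(\<lambda>i. c * x i) \<in> E" "T (\<lambda>i. c * x i) = (\<lambda>i. c * T x i)" if "x \<in> E" for x c
    using assms that unfolding lin_on_def by blast+
  have ad: "(\<lambda>i. x i + y i) \<in> E" "T (\<lambda>i. x i + y i) = (\<lambda>i. T x i + T y i)" if "x \<in> E" "y \<in> E" for x y
    using assms that unfolding lin_on_def by blast+
  show "T (\<lambda>_. 0) = (\<lambda>_. 0)" using sc(2)[OF z, of 0] by simp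
  show "x \<in> E \<Longrightarrow> y \<in> E \<Longrightarrow> (\<lambda>i. x i + y i) \<in> E"
    "x \<in> E \<Longrightarrow> y \<in> E \<Longrightarrow> T (\<lambda>i. x i + y i) = (\<lambda>i. T x i + T y i)"
    "x \<in> E \<Longrightarrow> (\<lambda>i. c * x i) \<in> E" "x \<in> E \<Longrightarrow> T (\<lambda>i. c * x i) = (\<lambda>i. c * T x i)"
    by (fact ad sc)+
  assume xy: "x \<in> E" "y \<in> E"
  show "(\<lambda>i. x i - y i) \<in> E" using ad(1)[OF xy(1) sc(1)[OF xy(2), of "-1"]] by simp
  show "T (\<lambda>i. x i - y i) = (\<lambda>i. T x i - T y i)"
    using ad(2)[OF xy(1) sc(1)[OF xy(2), of "-1"]] sc(2)[OF xy(2), of "-1"] by simp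
qed

lemma lin_on_sum:
  assumes T: "lin_on E T" and S: "finite S" "S \<subseteq> E"
  shows "(\<lambda>w. \<Sum>f\<in>S. c f * f w) \<in> E \<and> T (\<lambda>w. \<Sum>f\<in>S. c f * f w) = (\<lambda>w. \<Sum>f\<in>S. c f * T f w)"
  using S
proof (induction S rule: finite_induct)
  case empty then show ?case using lin_onD(1,2)[OF T] by simp
next
  case (insert f S)
  let ?g = "\<lambda>w. \<Sum>f\<in>S. c f * f w"
  have f: "f \<in> E" and IH: "?g \<in> E" "T ?g = (\<lambda>w. \<Sum>f\<in>S. c f * T f w)" using insert by auto
  have e: "(\<lambda>w. \<Sum>f\<in>insert f S. c f * f w) = (\<lambda>w. c f * f w + ?g w)"
    using insert.hyps by (auto simp: fun_eq_iff)
  have "(\<lambda>w. c f * f w + ?g w) \<in> E" by (rule lin_onD(3)[OF T lin_onD(5)[OF T f] IH(1)])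
  moreover have "T (\<lambda>w. c f * f w + ?g w) = (\<lambda>w. \<Sum>f\<in>insert f S. c f * T f w)"
    unfolding lin_onD(4)[OF T lin_onD(5)[OF T f] IH(1)] lin_onD(6)[OF T f] IH(2)
    using insert.hyps by (auto simp: fun_eq_iff)
  ultimately show ?case unfolding e by blast
qed

lemma lindep_image:
  assumes T: "lin_on E T" and S: "S \<subseteq> E" "lindep S"
    and ker: "\<And>x. x \<in> E \<Longrightarrow> T x = (\<lambda>_. 0) \<Longrightarrow> x = (\<lambda>_. 0)"
  shows "inj_on T S" "lindep (T ` S)"
proof -
  have fS: "finite S" using S by (simp add: lindep_def)
  show inj: "inj_on T S"
  proof (rule inj_onI)
    fix x y assume xy: "x \<in> S" "y \<in> S" "T x = T y"
    then have E: "x \<in> E" "y \<in> E" using S by auto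
    have "(\<lambda>i. x i - y i) = (\<lambda>_. 0)"
      by (rule ker[OF lin_onD(7)[OF T E]]) (simp add: lin_onD(8)[OF T E] xy)
    then show "x = y" by (simp add: fun_eq_iff)
  qed
  show "lindep (T ` S)" unfolding lindep_def
  proof (intro conjI allI impI)
    show "finite (T ` S)" using fS by simp
    fix c assume "\<forall>w. (\<Sum>g\<in>T ` S. c g * g w) = 0"
    then have "T (\<lambda>w. \<Sum>f\<in>S. c (T f) * f w) = (\<lambda>_. 0)"
      using lin_on_sum[OF T fS S(1), of "\<lambda>f. c (T f)"] by (simp add: sum.reindex[OF inj])
    then have "(\<lambda>w. \<Sum>f\<in>S. c (T f) * f w) = (\<lambda>_. 0)"
      using lin_on_sum[OF T fS S(1), of "\<lambda>f. c (T f)"] ker by blast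
    then have "\<forall>f\<in>S. c (T f) = 0" using S(2) unfolding lindep_def by (metis (mono_tags))
    then show "\<forall>g\<in>T ` S. c g = 0" by blast
  qed
qed

text \<open>An injection \<open>T\<close> from \<open>E\<close> to \<open>F\<close> carries a basis
  to an independent set of the same size, and an injection \<open>U\<close> back bounds every
  independent set by the dimension of \<open>E\<close>. The two maps are not assumed inverse to each
  other, which suits \<open>synth\<close> and \<open>coef\<close> after \<open>L\<close>.\<close>

lemma has_basis_transfer:
  assumes E: "has_basis E c"
    and T: "lin_on E T" "T ` E \<subseteq> F" "\<And>x. x \<in> E \<Longrightarrow> T x = (\<lambda>_. 0) \<Longrightarrow> x = (\<lambda>_. 0)"
    and U: "lin_on F U" "U ` F \<subseteq> E" "\<And>x. x \<in> F \<Longrightarrow> U x = (\<lambda>_. 0) \<Longrightarrow> x = (\<lambda>_. 0)"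
  shows "(SUP S\<in>{S. S \<subseteq> F \<and> lindep S}. enat (card S)) = enat c"
proof (rule antisym)
  obtain B where B: "B \<subseteq> E" "finite B" "card B = c" "fv.independent B" "E \<subseteq> fv.span B"
    using E unfolding has_basis_def by blast
  show "(SUP S\<in>{S. S \<subseteq> F \<and> lindep S}. enat (card S)) \<le> enat c"
  proof (rule SUP_least)
    fix S assume "S \<in> {S. S \<subseteq> F \<and> lindep S}"
    then have S: "S \<subseteq> F" "lindep S" by auto
    note im = lindep_image[OF U(1) S U(3)]
    have "U ` S \<subseteq> fv.span B" using S U(2) B(5) by blast
    then have "card (U ` S) \<le> card B"
      using fv.independent_span_bound[OF B(2)] im(2) by (simp add: lindep_iff)
    then show "enat (card S) \<le> enat c" using B(3) card_image[OF im(1)] by simp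
  qed
  have LB: "lindep B" using B by (simp add: lindep_iff)
  note im = lindep_image[OF T(1) B(1) LB T(3)]
  have "T ` B \<in> {S. S \<subseteq> F \<and> lindep S}" using T(2) B(1) im(2) by blast
  then have "enat (card (T ` B)) \<le> (SUP S\<in>{S. S \<subseteq> F \<and> lindep S}. enat (card S))"
    by (rule SUP_upper)
  then show "enat c \<le> (SUP S\<in>{S. S \<subseteq> F \<and> lindep S}. enat (card S))"
    using card_image[OF im(1)] B(3) by simp
qed

lemma eig_shift_lin:
  assumes T: "lin_on E T" "T ` E \<subseteq> E"
  shows "lin_on E (eig_shift T \<mu>)" "eig_shift T \<mu> ` E \<subseteq> E"
proof -
  note D = lin_onD[OF T(1)]
  show "eig_shift T \<mu> ` E \<subseteq> E"
    unfolding eig_shift_def using T(2) D(7)[OF _ D(5)] by blast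
  show "lin_on E (eig_shift T \<mu>)"
    unfolding lin_on_def eig_shift_def using D(1,3,5)
    by (auto simp: D(4) D(6) algebra_simps)
qed

lemma eig_shift_pow_lin:
  assumes T: "lin_on E T" "T ` E \<subseteq> E"
  shows "lin_on E (eig_shift T \<mu> ^^ k) \<and> (eig_shift T \<mu> ^^ k) ` E \<subseteq> E"
proof (induction k)
  case 0
  show ?case using lin_onD(1,3,5)[OF T(1)] by (auto simp: lin_on_def)
next
  case (Suc k)
  note D = lin_onD[OF eig_shift_lin(1)[OF T, of \<mu>]] and IH = lin_onD[OF conjunct1[OF Suc]]
  have im: "(eig_shift T \<mu> ^^ k) x \<in> E" if "x \<in> E" for x using Suc that by blast
  show ?case
  proof
    show "lin_on E (eig_shift T \<mu> ^^ Suc k)"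
      unfolding lin_on_def using IH(1,3,5) by (simp add: IH(4) IH(6) D(4) D(6) im)
    show "(eig_shift T \<mu> ^^ Suc k) ` E \<subseteq> E" using im eig_shift_lin(2)[OF T, of \<mu>] by auto
  qed
qed

lemma gen_ker_lin:
  assumes T: "lin_on E T" "T ` E \<subseteq> E" and U: "lin_on E U"
  shows "lin_on (gen_ker T E \<mu>) U"
proof -
  let ?D = "eig_shift T \<mu>"
  note P = lin_onD[OF conjunct1[OF eig_shift_pow_lin[OF T, where \<mu>=\<mu>]]]
  have up: "(?D ^^ (m + k)) x = (\<lambda>_. 0)" if "(?D ^^ k) x = (\<lambda>_. 0)" for x k m
    by (simp add: funpow_add that P(2))
  have "(\<lambda>_. 0) \<in> gen_ker T E \<mu>" using P(1) by (auto simp: gen_ker_def intro!: exI[of _ 0])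
  moreover have "(\<lambda>i. x i + y i) \<in> gen_ker T E \<mu>" if xy: "x \<in> gen_ker T E \<mu>" "y \<in> gen_ker T E \<mu>" for x y
  proof -
    obtain k l where kl: "x \<in> E" "y \<in> E" "(?D ^^ k) x = (\<lambda>_. 0)" "(?D ^^ l) y = (\<lambda>_. 0)"
      using xy unfolding gen_ker_def by blast
    have "(?D ^^ (l + k)) (\<lambda>i. x i + y i) = (\<lambda>i. (?D ^^ (l + k)) x i + (?D ^^ (k + l)) y i)"
      using P(4)[OF kl(1,2), of "l + k"] by (simp add: add.commute)
    also have "\<dots> = (\<lambda>_. 0)" by (simp only: up[OF kl(3)] up[OF kl(4)] add_0)
    finally show ?thesis using P(3)[OF kl(1,2)] by (auto simp: gen_ker_def)
  qed
  moreover have "(\<lambda>i. c * x i) \<in> gen_ker T E \<mu>" if x: "x \<in> gen_ker T E \<mu>" for x c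
  proof -
    obtain k where k: "x \<in> E" "(?D ^^ k) x = (\<lambda>_. 0)" using x unfolding gen_ker_def by blast
    have "(?D ^^ k) (\<lambda>i. c * x i) = (\<lambda>_. 0)" unfolding P(6)[OF k(1)] k(2) by simp
    then show ?thesis using P(5)[OF k(1)] unfolding gen_ker_def by blast
  qed
  moreover have "gen_ker T E \<mu> \<subseteq> E" by (auto simp: gen_ker_def)
  ultimately show ?thesis using lin_onD(4,6)[OF U] unfolding lin_on_def by (auto simp: subset_iff)
qed

text \<open>A map that intertwines \<open>T\<close> and \<open>T'\<close> also intertwines all
  powers of their shifts by \<open>\<mu>\<close>.\<close>

lemma gen_ker_intertwine:
  assumes "\<And>x. x \<in> E \<Longrightarrow> U x \<in> F" "\<And>x. x \<in> E \<Longrightarrow> T x \<in> E"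
    and lin: "lin_on E U" "lin_on E T"
    and comm: "\<And>x. x \<in> E \<Longrightarrow> T' (U x) = U (T x)"
    and x: "x \<in> gen_ker T E \<mu>"
  shows "U x \<in> gen_ker T' F \<mu>"
proof -
  have TE: "T ` E \<subseteq> E" using assms(2) by blast
  have pw: "(eig_shift T' \<mu> ^^ k) (U x) = U ((eig_shift T \<mu> ^^ k) x)" if "x \<in> E" for k x
  proof (induction k)
    case (Suc k)
    let ?y = "(eig_shift T \<mu> ^^ k) x"
    have y: "?y \<in> E" using eig_shift_pow_lin[OF lin(2) TE, where \<mu>=\<mu> and k=k] that by blast
    have "(eig_shift T' \<mu> ^^ Suc k) (U x) = eig_shift T' \<mu> (U ?y)" using Suc by simp
    also have "\<dots> = (\<lambda>i. U (T ?y) i - \<mu> * U ?y i)" by (simp add: eig_shift_apply[of _ _ "U ?y"] comm[OF y])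
    also have "\<dots> = U (\<lambda>i. T ?y i - \<mu> * ?y i)"
      by (simp add: lin_onD(8)[OF lin(1) assms(2)[OF y] lin_onD(5)[OF lin(1) y]] lin_onD(6)[OF lin(1) y])
    finally show ?case by (simp add: eig_shift_apply[of _ _ ?y])
  qed simp
  obtain k where "x \<in> E" "(eig_shift T \<mu> ^^ k) x = (\<lambda>_. 0)" using x by (auto simp: gen_ker_def)
  then show ?thesis using pw[of x k] assms(1) lin_onD(2)[OF lin(1)] by (auto simp: gen_ker_def)
qed

text \<open>On the kernel of \<open>T\<close> the shifted map is multiplication by
  \<open>-\<mu>\<close>, which is injective. This is where a nonzero eigenvalue makes the redundancy
  of the coordinates harmless.\<close>

lemma gen_ker_null:
  assumes x: "x \<in> gen_ker T E \<mu>" and T: "T x = (\<lambda>_. 0)" "T (\<lambda>_. 0) = (\<lambda>_. 0)" and \<mu>: "\<mu> \<noteq> 0"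
    and sc: "\<And>c. T (\<lambda>i. c * x i) = (\<lambda>i. c * T x i)"
  shows "x = (\<lambda>_. 0)"
proof -
  have "(eig_shift T \<mu> ^^ k) x = (\<lambda>i. (-\<mu>) ^ k * x i)" for k
  proof (induction k)
    case (Suc k)
    have "(eig_shift T \<mu> ^^ Suc k) x = eig_shift T \<mu> (\<lambda>i. (-\<mu>) ^ k * x i)" using Suc by simp
    also have "\<dots> = (\<lambda>i. (-\<mu>) ^ Suc k * x i)" unfolding eig_shift_apply sc T(1) by (simp add: mult_ac)
    finally show ?case .
  qed simp
  moreover obtain k where "(eig_shift T \<mu> ^^ k) x = (\<lambda>_. 0)" using x by (auto simp: gen_ker_def)
  ultimately have "(-\<mu>) ^ k * x i = 0" for i by (metis (mono_tags))
  then show ?thesis using \<mu> by (auto simp: fun_eq_iff)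
qed

lemma gen_ker_eigenvector:
  assumes T: "lin_on E T" "T ` E \<subseteq> E" and x: "x \<in> gen_ker T E \<mu>" "x \<noteq> (\<lambda>_. 0)"
  obtains v where "v \<in> E" "v \<noteq> (\<lambda>_. 0)" "T v = (\<lambda>i. \<mu> * v i)"
proof -
  obtain k where k: "x \<in> E" "(eig_shift T \<mu> ^^ k) x = (\<lambda>_. 0)" using x by (auto simp: gen_ker_def)
  define m where "m = (LEAST k. (eig_shift T \<mu> ^^ k) x = (\<lambda>_. 0))"
  have m: "(eig_shift T \<mu> ^^ m) x = (\<lambda>_. 0)" unfolding m_def by (rule LeastI[of _ k]) (rule k(2))
  then obtain l where l: "m = Suc l" using x(2) by (cases m) auto
  let ?v = "(eig_shift T \<mu> ^^ l) x"
  have "?v \<noteq> (\<lambda>_. 0)" using not_less_Least[of l "\<lambda>k. (eig_shift T \<mu> ^^ k) x = (\<lambda>_. 0)"] l by (simp add: m_def)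
  moreover have "?v \<in> E" using eig_shift_pow_lin[OF T, where \<mu>=\<mu> and k=l] k(1) by blast
  moreover have "T ?v = (\<lambda>i. \<mu> * ?v i)"
    using m unfolding l by (simp add: eig_shift_def fun_eq_iff)
  ultimately show ?thesis using that by blast
qed

lemma (in l1_matrix) app_lin: "lin_on l1 (app B)" "app B ` l1 \<subseteq> l1"
  by (auto simp: lin_on_def l1_zero l1_add l1_scale app_add app_scale app_l1)

text \<open>With \<open>R x = x - x s * v\<close>, the projection along \<open>v\<close> onto the
  vectors with vanishing \<open>s\<close>-th coordinate, \<open>B'\<close> is \<open>R\<close> after
  \<open>B\<close>. As \<open>R\<close> kills the eigenvector, \<open>B' R = R B\<close>, hence
  \<open>B'^q = R B^q\<close> for \<open>q > 0\<close>. The lost trace is the sum of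
  \<open>v i\<close> times the \<open>(s, i)\<close> entry of \<open>B^q\<close>, that is
  \<open>(B^q v) s = \<mu>^q\<close>.\<close>

lemma wielandt_deflation:
  assumes B: "pmat p B" and p: "p > 0" and v: "v \<in> l1" "app B v = (\<lambda>i. \<mu> * v i)" "v s = 1"
    and \<mu>: "\<mu> \<noteq> 0"
  defines "B' \<equiv> \<lambda>i j. B i j - v i * B s j"
  shows "pmat p B'" "\<And>q. real q > p \<Longrightarrow> trp B' q = trp B q - \<mu> ^ q"
    "\<And>c. has_basis (gen_ker (app B') l1 \<mu>) c \<Longrightarrow> has_basis (gen_ker (app B) l1 \<mu>) (Suc c)"
proof -
  obtain M where "l1_matrix B M" using pmat_l1_matrix[OF B p] .
  then interpret B: l1_matrix B M .
  have colB': "(\<lambda>i. B' i j) \<in> l1" "n1 (\<lambda>i. B' i j) \<le> (1 + n1 v) * n1 (\<lambda>i. B i j)" for j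
  proof -
    have e: "(\<lambda>i. B' i j) = (\<lambda>i. B i j - B s j * v i)" by (simp add: B'_def mult.commute)
    show "(\<lambda>i. B' i j) \<in> l1" unfolding e by (intro l1_diff(1) B.col l1_scale v)
    have "n1 (\<lambda>i. B' i j) \<le> n1 (\<lambda>i. B i j) + n1 (\<lambda>i. B s j * v i)"
      unfolding e by (intro l1_diff(2) B.col l1_scale v)
    also have "n1 (\<lambda>i. B s j * v i) = cmod (B s j) * n1 v" by (rule n1_scale[OF v(1)])
    also have "\<dots> \<le> n1 (\<lambda>i. B i j) * n1 v" by (intro mult_right_mono B.entry_le n1_nonneg v)
    finally show "n1 (\<lambda>i. B' i j) \<le> (1 + n1 v) * n1 (\<lambda>i. B i j)" by (simp add: algebra_simps)
  qed
  show B': "pmat p B'"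
    unfolding pmat_def
  proof (intro conjI allI colB')
    have nv: "0 \<le> n1 v" by (rule n1_nonneg[OF v(1)])
    have le: "n1 (\<lambda>i. B' i j) powr p \<le> (1 + n1 v) powr p * n1 (\<lambda>i. B i j) powr p" for j
    proof -
      have "n1 (\<lambda>i. B' i j) powr p \<le> ((1 + n1 v) * n1 (\<lambda>i. B i j)) powr p"
        using p colB' n1_nonneg by (intro powr_mono2) auto
      also have "\<dots> = (1 + n1 v) powr p * n1 (\<lambda>i. B i j) powr p"
        using nv n1_nonneg[OF B.col] by (simp add: powr_mult)
      finally show ?thesis .
    qed
    show "summable (\<lambda>j. n1 (\<lambda>i. B' i j) powr p)"
    proof (rule summable_comparison_test'[where N=0])
      show "summable (\<lambda>j. (1 + n1 v) powr p * n1 (\<lambda>i. B i j) powr p)"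
        using B by (intro summable_mult) (simp add: pmat_def)
    qed (use le in simp)
  qed
  obtain M' where "l1_matrix B' M'" using pmat_l1_matrix[OF B' p] .
  then interpret B': l1_matrix B' M' .
  define R where "R x = (\<lambda>i. x i - x s * v i)" for x :: "nat \<Rightarrow> complex"
  have Rl1: "R x \<in> l1" if "x \<in> l1" for x unfolding R_def by (intro l1_diff(1) that l1_scale v)
  have appB': "app B' x = R (app B x)" if x: "x \<in> l1" for x
  proof (rule ext)
    fix i
    have "(\<lambda>j. B i j * x j - v i * (B s j * x j)) sums (app B x i - v i * app B x s)"
      unfolding app_def by (intro sums_diff sums_mult summable_sums B.row_summable x)
    then have "(\<lambda>j. B' i j * x j) sums (app B x i - v i * app B x s)"
      by (simp add: B'_def algebra_simps)
    then show "app B' x i = R (app B x) i" by (simp add: app_def R_def sums_iff mult.commute)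
  qed
  have appB'R: "app B' (R x) = R (app B x)" if x: "x \<in> l1" for x
  proof -
    have "app B (R x) = (\<lambda>i. app B x i - x s * (\<mu> * v i))"
      unfolding R_def B.app_diff[OF x l1_scale[OF v(1)]] B.app_scale[OF v(1)] v(2) ..
    then show ?thesis unfolding appB'[OF Rl1[OF x]] by (simp add: R_def v(3) algebra_simps)
  qed
  show "trp B' q = trp B q - \<mu> ^ q" if q: "real q > p" for q
  proof -
    have q0: "q \<noteq> 0" using q p by (cases q) auto
    have pw: "(app B' ^^ Suc k) x = R ((app B ^^ Suc k) x)" if "x \<in> l1" for k x
    proof (induction k)
      case 0 show ?case using appB'[OF that] by simp
    next
      case (Suc k)
      have "(app B' ^^ Suc (Suc k)) x = app B' (R ((app B ^^ Suc k) x))" using Suc by simp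
      also have "\<dots> = R (app B ((app B ^^ Suc k) x))" by (rule appB'R[OF B.pow_l1[OF that]])
      finally show ?case by simp
    qed
    then have e: "(app B' ^^ q) (unitv i) i = (app B ^^ q) (unitv i) i - v i * (app B ^^ q) (unitv i) s" for i
      using unitv_l1(1) q0 by (cases q) (simp_all only: R_def mult.commute not0_implies_Suc)
    have pv: "(app B ^^ k) v = (\<lambda>i. \<mu> ^ k * v i)" for k
    proof (induction k)
      case (Suc k)
      have "(app B ^^ Suc k) v = app B (\<lambda>i. \<mu> ^ k * v i)" using Suc by simp
      also have "\<dots> = (\<lambda>i. \<mu> ^ Suc k * v i)" unfolding B.app_scale[OF v(1)] v(2) by (simp add: mult_ac)
      finally show ?case .
    qed simp
    have "(\<lambda>i. (app B ^^ q) (unitv i) i) sums trp B q"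
      unfolding trp_def by (rule summable_sums[OF summable_norm_cancel[OF trace_tendsto(1)[OF B p q]]])
    moreover have "(\<lambda>i. v i * (app B ^^ q) (unitv i) s) sums \<mu> ^ q"
      using B.pow_sums[OF v(1), of q s] by (simp add: pv v(3))
    ultimately have "(\<lambda>i. (app B' ^^ q) (unitv i) i) sums (trp B q - \<mu> ^ q)"
      unfolding e by (rule sums_diff)
    then show ?thesis by (simp add: trp_def sums_iff)
  qed
  have Rlin: "lin_on l1 R"
    unfolding lin_on_def R_def using l1_zero l1_add l1_scale by (auto simp: algebra_simps)
  have R_gen: "R x \<in> gen_ker (app B') l1 \<mu>" if "x \<in> gen_ker (app B) l1 \<mu>" for x
    by (rule gen_ker_intertwine[OF Rl1 B.app_l1 Rlin B.app_lin(1) appB'R that])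
  \<comment> \<open>Row \<open>s\<close> of \<open>B'\<close> is zero, so each application of the
    shifted map multiplies the \<open>s\<close>-th coordinate by \<open>-\<mu>\<close>.\<close>
  have y0: "y s = 0" if y: "y \<in> gen_ker (app B') l1 \<mu>" for y
  proof -
    have "(eig_shift (app B') \<mu> ^^ k) y s = (-\<mu>) ^ k * y s" if "y \<in> l1" for k
    proof (induction k)
      case (Suc k)
      have l: "(eig_shift (app B') \<mu> ^^ k) y \<in> l1" using eig_shift_pow_lin[OF B'.app_lin, where \<mu>=\<mu> and k=k] that by blast
      then have "app B' ((eig_shift (app B') \<mu> ^^ k) y) s = 0" by (simp add: appB' R_def v(3))
      then show ?case using Suc by (simp add: eig_shift_apply[of _ _ "(eig_shift (app B') \<mu> ^^ k) y"])
    qed simp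
    moreover obtain k where "y \<in> l1" "(eig_shift (app B') \<mu> ^^ k) y = (\<lambda>_. 0)"
      using y unfolding gen_ker_def by blast
    ultimately have "(-\<mu>) ^ k * y s = 0" by metis
    then show ?thesis using \<mu> by simp
  qed
  have v_gen: "v \<in> gen_ker (app B) l1 \<mu>"
    using v by (auto simp: gen_ker_def eig_shift_def intro!: exI[of _ 1])
  have y_gen: "y \<in> gen_ker (app B) l1 \<mu>" if y: "y \<in> gen_ker (app B') l1 \<mu>" for y
  proof -
    obtain k where k: "y \<in> l1" "(eig_shift (app B') \<mu> ^^ k) y = (\<lambda>_. 0)" using y by (auto simp: gen_ker_def)
    have Ry: "R y = y" using y0[OF y] by (simp add: R_def)
    have comm: "(eig_shift (app B') \<mu> ^^ k) (R x) = R ((eig_shift (app B) \<mu> ^^ k) x)" if "x \<in> l1" for x k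
    proof (induction k)
      case (Suc k)
      let ?z = "(eig_shift (app B) \<mu> ^^ k) x"
      have z: "?z \<in> l1" using eig_shift_pow_lin[OF B.app_lin, where \<mu>=\<mu> and k=k] that by blast
      have "(eig_shift (app B') \<mu> ^^ Suc k) (R x) = (\<lambda>i. R (app B ?z) i - \<mu> * R ?z i)"
        using Suc by (simp add: eig_shift_apply[of _ _ "R ?z"] appB'R[OF z])
      also have "\<dots> = R (eig_shift (app B) \<mu> ?z)"
        by (simp add: R_def eig_shift_apply[of _ _ ?z] algebra_simps)
      finally show ?case by simp
    qed simp
    let ?z = "(eig_shift (app B) \<mu> ^^ k) y"
    \<comment> \<open>After \<open>k\<close> steps a multiple of \<open>v\<close> may remain; one
      more step with \<open>B\<close> removes it.\<close>
    have "R ?z = (\<lambda>_. 0)" using comm[OF k(1), of k] Ry k(2) by simp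
    then have z: "?z = (\<lambda>i. ?z s * v i)" unfolding R_def fun_eq_iff right_minus_eq .
    have "eig_shift (app B) \<mu> ?z = eig_shift (app B) \<mu> (\<lambda>i. ?z s * v i)" using z by (rule arg_cong)
    also have "\<dots> = (\<lambda>_. 0)" unfolding eig_shift_apply B.app_scale[OF v(1)] v(2) by (simp add: mult_ac)
    finally have "(eig_shift (app B) \<mu> ^^ Suc k) y = (\<lambda>_. 0)" by simp
    then show ?thesis using k(1) unfolding gen_ker_def by blast
  qed
  fix c assume "has_basis (gen_ker (app B') l1 \<mu>) c"
  then obtain S where S: "S \<subseteq> gen_ker (app B') l1 \<mu>" "finite S" "card S = c" "fv.independent S"
    "gen_ker (app B') l1 \<mu> \<subseteq> fv.span S" unfolding has_basis_def by blast
  have sp0: "y s = 0" if "y \<in> fv.span S" for y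
    using that by (induction rule: fv.span_induct_alt) (use S(1) y0 in auto)
  then have vS: "v \<notin> fv.span S" using v(3) by force
  then have "v \<notin> S" using fv.span_base by blast
  moreover have "fv.independent (insert v S)" using vS S(4) by (simp add: fv.independent_insert)
  moreover have "gen_ker (app B) l1 \<mu> \<subseteq> fv.span (insert v S)"
  proof
    fix x assume "x \<in> gen_ker (app B) l1 \<mu>"
    then have "R x \<in> fv.span (insert v S)" using R_gen S(5) fv.span_mono[of S "insert v S"] by blast
    moreover have "(\<lambda>i. x s * v i) \<in> fv.span (insert v S)" by (intro fv.span_scale fv.span_base) simp
    ultimately have "R x + (\<lambda>i. x s * v i) \<in> fv.span (insert v S)" by (rule fv.span_add)
    moreover have "R x + (\<lambda>i. x s * v i) = x" by (simp add: R_def fun_eq_iff)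
    ultimately show "x \<in> fv.span (insert v S)" by simp
  qed
  ultimately show "has_basis (gen_ker (app B) l1 \<mu>) (Suc c)"
    unfolding has_basis_def using S(1-3) v_gen y_gen by (intro exI[of _ "insert v S"]) auto
qed

lemma summable_power_of_decay:
  assumes "\<And>n. cmod (a n) \<le> (K / real (Suc n)) powr (1 / p)" "K \<ge> 0" "p > 0" "x > p"
  shows "summable (\<lambda>n. cmod (a n) powr x)"
proof (rule summable_comparison_test'[where N=0])
  show "summable (\<lambda>n. (K / real (Suc n)) powr (x / p))"
    using assms by (intro summable_inverse_powr) auto
  fix n
  have "cmod (a n) powr x \<le> ((K / real (Suc n)) powr (1 / p)) powr x"
    using assms by (intro powr_mono2) auto
  then show "norm (cmod (a n) powr x) \<le> (K / real (Suc n)) powr (x / p)" by (simp add: powr_powr)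
qed

lemma cmod_powr_nat: "q > 0 \<Longrightarrow> cmod z powr real q = cmod z ^ q"
  by (cases "z = 0") (auto simp: powr_realpow)

lemma summable_spectral_sequence:
  assumes B: "pmat p B" and p: "p > 0" and q: "real q > p"
    and a: "\<And>n. cmod (a n) \<le> ((\<Sum>j. n1 (\<lambda>i. B i j) powr p) / real (Suc n)) powr (1 / p)"
  shows "summable (\<lambda>n. cmod (a n) ^ q)"
proof -
  have "0 \<le> (\<Sum>j. n1 (\<lambda>i. B i j) powr p)" using B by (intro suminf_nonneg) (auto simp: pmat_def)
  from summable_power_of_decay[OF a this p q] show ?thesis
    using p q by (subst (asm) cmod_powr_nat) (cases q, auto)
qed

lemma spectral_sequence_ex:
  assumes "pmat p B" "p > 0"
  shows "\<exists>a. (\<forall>n. cmod (a n) \<le> ((\<Sum>j. n1 (\<lambda>i. B i j) powr p) / real (Suc n)) powr (1 / p)) \<and>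
    (\<forall>q. real q > p \<longrightarrow> (\<lambda>n. a n ^ q) sums trp B q) \<and>
    (\<forall>n. a n \<noteq> 0 \<longrightarrow> (\<exists>v\<in>l1. v \<noteq> (\<lambda>_. 0) \<and> app B v = (\<lambda>i. a n * v i)))"
proof (rule spectral_sequence[OF assms])
  fix a :: "nat \<Rightarrow> complex"
  assume "\<And>n. cmod (a n) \<le> ((\<Sum>j. n1 (\<lambda>i. B i j) powr p) / real (Suc n)) powr (1 / p)"
    "\<And>q. real q > p \<Longrightarrow> (\<lambda>n. a n ^ q) sums trp B q"
    "\<And>n. a n \<noteq> 0 \<Longrightarrow> \<exists>v\<in>l1. v \<noteq> (\<lambda>_. 0) \<and> app B v = (\<lambda>i. a n * v i)"
  then show ?thesis by (intro exI[of _ a] conjI allI impI)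
qed

text \<open>Putting \<open>\<mu>\<close> in front of a spectral sequence of the deflated matrix
  gives a sequence with the same power sums as \<open>a\<close>, hence with the same
  multiplicities.\<close>

lemma deflated_sequence:
  assumes B: "pmat p B" and p: "p > 0" and q0: "real q0 > p" and \<mu>: "\<mu> \<noteq> 0"
    and a: "summable (\<lambda>n. cmod (a n) ^ q0)" "\<And>q. q \<ge> q0 \<Longrightarrow> (\<lambda>n. a n ^ q) sums trp B q"
    and v: "v \<in> l1" "v \<noteq> (\<lambda>_. 0)" "app B v = (\<lambda>i. \<mu> * v i)"
  shows "\<exists>B' b. pmat p B' \<and> summable (\<lambda>n. cmod (b n) ^ q0) \<and>
    (\<forall>q\<ge>q0. (\<lambda>n. b n ^ q) sums trp B' q) \<and>
    card {n. a n = \<mu>} = Suc (card {n. b n = \<mu>}) \<and>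
    (\<forall>c. has_basis (gen_ker (app B') l1 \<mu>) c \<longrightarrow> has_basis (gen_ker (app B) l1 \<mu>) (Suc c))"
proof -
  obtain M where "l1_matrix B M" using pmat_l1_matrix[OF B p] .
  then interpret B: l1_matrix B M .
  obtain s where s: "v s \<noteq> 0" using v(2) by (auto simp: fun_eq_iff)
  define u where "u = (\<lambda>i. 1 / v s * v i)"
  have u: "u \<in> l1" "app B u = (\<lambda>i. \<mu> * u i)" "u s = 1"
    unfolding u_def B.app_scale[OF v(1)] v(3) using s l1_scale[OF v(1), of "1 / v s"]
    by (simp_all add: mult_ac)
  define B' where "B' = (\<lambda>i j. B i j - u i * B s j)"
  note defl = wielandt_deflation[OF B p u \<mu>, folded B'_def]
  obtain b where b: "\<And>n. cmod (b n) \<le> ((\<Sum>j. n1 (\<lambda>i. B' i j) powr p) / real (Suc n)) powr (1 / p)"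
    "\<And>q. real q > p \<Longrightarrow> (\<lambda>n. b n ^ q) sums trp B' q"
    using spectral_sequence_ex[OF defl(1) p] by metis
  have sb: "summable (\<lambda>n. cmod (b n) ^ q0)" by (rule summable_spectral_sequence[OF defl(1) p q0 b(1)])
  have bq: "(\<lambda>n. b n ^ q) sums trp B' q" if "q \<ge> q0" for q using that q0 by (intro b) simp
  define d where "d n = (case n of 0 \<Rightarrow> \<mu> | Suc m \<Rightarrow> b m)" for n
  have sd: "summable (\<lambda>n. cmod (d n) ^ q0)"
    using sb by (subst summable_Suc_iff[symmetric]) (simp add: d_def)
  have dq: "(\<lambda>n. d n ^ q) sums trp B q" if "q \<ge> q0" for q
  proof -
    have "(\<lambda>n. d (Suc n) ^ q) sums (trp B q - \<mu> ^ q)"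
      using bq[OF that] defl(2)[of q] that q0 by (simp add: d_def)
    then have "(\<lambda>n. d n ^ q) sums (trp B q - \<mu> ^ q + d 0 ^ q)" by (subst (asm) sums_Suc_iff) simp
    then show ?thesis by (simp add: d_def)
  qed
  have "card {n. a n = \<mu>} = card {n. d n = \<mu>}"
    using power_sums_determine_multiplicity[OF a(1) sd _ \<mu>, of "trp B"] a(2) dq by blast
  also have "{n. d n = \<mu>} = insert 0 (Suc ` {n. b n = \<mu>})"
  proof (rule Set.set_eqI)
    show "n \<in> {n. d n = \<mu>} \<longleftrightarrow> n \<in> insert 0 (Suc ` {n. b n = \<mu>})" for n
      by (cases n) (auto simp: d_def)
  qed
  also have "card \<dots> = Suc (card {n. b n = \<mu>})"
    using finite_fiber(2)[OF sb \<mu>] by (simp add: card_image)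
  finally show ?thesis using defl(1,3) sb bq by (intro exI[of _ B'] exI[of _ b]) blast
qed

text \<open>Induction on the count. If the count is zero, an eigenvector would allow a deflation and
  force a positive count. If it is positive, an eigenvector is needed, but \<open>a\<close> is known
  only through its power sums; it is replaced by a spectral sequence \<open>a'\<close> of
  \<open>B\<close>, whose nonzero entries come with eigenvectors and which has the same
  count.\<close>

lemma multiplicity_eq_count:
  assumes "pmat p B" and p: "p > 0" and q0: "real q0 > p" and \<mu>: "\<mu> \<noteq> 0"
    and "summable (\<lambda>n. cmod (a n) ^ q0)" "\<And>q. q \<ge> q0 \<Longrightarrow> (\<lambda>n. a n ^ q) sums trp B q"
  shows "has_basis (gen_ker (app B) l1 \<mu>) (card {n. a n = \<mu>})"
  using assms(1,5,6)
proof (induction "card {n. a n = \<mu>}" arbitrary: B a)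
  case H: 0
  note B = H(2) and a = H(3,4)
  obtain M where "l1_matrix B M" using pmat_l1_matrix[OF B p] .
  then interpret B: l1_matrix B M .
  have "x = (\<lambda>_. 0)" if x: "x \<in> gen_ker (app B) l1 \<mu>" for x
  proof (rule ccontr)
    assume "x \<noteq> (\<lambda>_. 0)"
    then obtain v where v: "v \<in> l1" "v \<noteq> (\<lambda>_. 0)" "app B v = (\<lambda>i. \<mu> * v i)"
      by (rule gen_ker_eigenvector[OF B.app_lin x])
    obtain b :: "nat \<Rightarrow> complex" where "card {n. a n = \<mu>} = Suc (card {n. b n = \<mu>})"
      using deflated_sequence[OF B p q0 \<mu> a v] by metis
    then show False using H(1) by simp
  qed
  then have "gen_ker (app B) l1 \<mu> \<subseteq> fv.span {}" by (auto simp: zero_fun_def)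
  then show ?case unfolding has_basis_def H(1)[symmetric] using fv.independent_empty by (intro exI[of _ "{}"]) auto
next
  case H: (Suc c)
  note B = H(3) and a = H(4,5)
  obtain a' where "(\<forall>n. cmod (a' n) \<le> ((\<Sum>j. n1 (\<lambda>i. B i j) powr p) / real (Suc n)) powr (1 / p)) \<and>
    (\<forall>q. real q > p \<longrightarrow> (\<lambda>n. a' n ^ q) sums trp B q) \<and>
    (\<forall>n. a' n \<noteq> 0 \<longrightarrow> (\<exists>v\<in>l1. v \<noteq> (\<lambda>_. 0) \<and> app B v = (\<lambda>i. a' n * v i)))"
    using spectral_sequence_ex[OF B p] by (rule exE)
  then have a': "\<And>n. cmod (a' n) \<le> ((\<Sum>j. n1 (\<lambda>i. B i j) powr p) / real (Suc n)) powr (1 / p)"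
    "\<And>q. real q > p \<Longrightarrow> (\<lambda>n. a' n ^ q) sums trp B q"
    and ev: "\<And>n. a' n \<noteq> 0 \<Longrightarrow> \<exists>v\<in>l1. v \<noteq> (\<lambda>_. 0) \<and> app B v = (\<lambda>i. a' n * v i)"
    by simp_all
  have sa': "summable (\<lambda>n. cmod (a' n) ^ q0)" by (rule summable_spectral_sequence[OF B p q0 a'(1)])
  have aq': "(\<lambda>n. a' n ^ q) sums trp B q" if "q \<ge> q0" for q using that q0 by (intro a') simp
  have "card {n. a' n = \<mu>} = card {n. a n = \<mu>}"
    using power_sums_determine_multiplicity[OF sa' a(1) _ \<mu>, of "trp B"] a(2) aq' by blast
  then have "card {n. a' n = \<mu>} \<noteq> 0" using H(2) by simp
  then obtain n where "a' n = \<mu>" by (metis (mono_tags) card.empty empty_Collect_eq)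
  then obtain v where v: "v \<in> l1" "v \<noteq> (\<lambda>_. 0)" "app B v = (\<lambda>i. \<mu> * v i)" using ev[of n] \<mu> by auto
  obtain B' b where B': "pmat p B'" "summable (\<lambda>n. cmod (b n) ^ q0)"
    "\<And>q. q \<ge> q0 \<Longrightarrow> (\<lambda>n. b n ^ q) sums trp B' q"
    and cb: "card {n. a n = \<mu>} = Suc (card {n. b n = \<mu>})"
    and bs: "\<And>c. has_basis (gen_ker (app B') l1 \<mu>) c \<Longrightarrow> has_basis (gen_ker (app B) l1 \<mu>) (Suc c)"
    using deflated_sequence[OF B p q0 \<mu> a v] by metis
  have "c = card {n. b n = \<mu>}" using H(2) cb by simp
  from H(1)[OF this B'] show ?case unfolding cb by (rule bs)
qed

section \<open>Words, cylinders and the transfer operator\<close>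

definition pref :: "nat \<Rightarrow> (nat \<Rightarrow> nat) \<Rightarrow> nat list" where
  "pref m x = map x [0..<m]"

lemma length_pref [simp]: "length (pref m x) = m" by (simp add: pref_def)

lemma pref_0 [simp]: "pref 0 x = []" by (simp add: pref_def)

lemma pref_eq_iff: "pref m x = pref m y \<longleftrightarrow> (\<forall>k<m. x k = y k)"
  by (auto simp: pref_def)

lemma pref_Suc: "pref (Suc m) x = pref m x @ [x m]" by (simp add: pref_def)

lemma butlast_pref: "butlast (pref m x) = pref (m - 1) x"
  by (cases m) (simp_all add: pref_Suc)

lemma nth_pref: "k < m \<Longrightarrow> pref m x ! k = x k" by (simp add: pref_def)

text \<open>For nonnegative sequences this is
  \<open>v m powr (1 / m) \<longlonglongrightarrow> 0\<close>, in a form that passes to sums,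
  multiples and index shifts without handling roots.\<close>

definition superexp :: "(nat \<Rightarrow> real) \<Rightarrow> bool" where
  "superexp v \<longleftrightarrow> (\<forall>e>0. \<exists>K. \<forall>m. v m \<le> K * e ^ m)"

lemma superexpD:
  assumes "superexp v" "e > 0"
  obtains K where "K > 0" "\<And>m. v m \<le> K * e ^ m"
proof -
  obtain K where K: "\<And>m. v m \<le> K * e ^ m" using assms unfolding superexp_def by blast
  have "v m \<le> max K 1 * e ^ m" for m
    by (rule order_trans[OF K mult_right_mono]) (use assms(2) in auto)
  then show ?thesis by (intro that[of "max K 1"]) auto
qed

lemma superexp_add: "superexp u \<Longrightarrow> superexp v \<Longrightarrow> superexp (\<lambda>m. u m + v m)"
  unfolding superexp_def
proof (intro allI impI)
  fix e :: real assume u: "\<forall>e>0. \<exists>K. \<forall>m. u m \<le> K * e ^ m" and v: "\<forall>e>0. \<exists>K. \<forall>m. v m \<le> K * e ^ m" and e: "0 < e"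
  then obtain K L where "\<And>m. u m \<le> K * e ^ m" "\<And>m. v m \<le> L * e ^ m" by blast
  then have "u m + v m \<le> (K + L) * e ^ m" for m by (simp add: distrib_right add_mono)
  then show "\<exists>K. \<forall>m. u m + v m \<le> K * e ^ m" by blast
qed

lemma superexp_scale:
  assumes "superexp v" "c \<ge> 0" shows "superexp (\<lambda>m. c * v m)"
  unfolding superexp_def
proof (intro allI impI)
  fix e :: real assume "0 < e"
  then obtain K where "\<And>m. v m \<le> K * e ^ m" using assms superexp_def by blast
  then have "c * v m \<le> (c * K) * e ^ m" for m using assms(2) by (simp add: mult_left_mono mult.assoc)
  then show "\<exists>K. \<forall>m. c * v m \<le> K * e ^ m" by blast
qed

lemma superexp_Suc:
  assumes "superexp v" shows "superexp (\<lambda>m. v (Suc m))"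
  unfolding superexp_def
proof (intro allI impI)
  fix e :: real assume "0 < e"
  then obtain K where "\<And>m. v m \<le> K * e ^ m" using assms superexp_def by blast
  then have "v (Suc m) \<le> (K * e) * e ^ m" for m by (metis mult.assoc power_Suc)
  then show "\<exists>K. \<forall>m. v (Suc m) \<le> K * e ^ m" by blast
qed

lemma superexp_0: "c \<ge> 0 \<Longrightarrow> superexp (\<lambda>m. if m = 0 then c else 0)"
  unfolding superexp_def by (intro allI impI exI[of _ c]) auto

lemma superexp_mono:
  assumes "superexp v" "\<And>m. u m \<le> v m" shows "superexp u"
  using assms unfolding superexp_def by (meson order_trans)

lemma superexp_eventually:
  assumes ev: "\<And>e. e > 0 \<Longrightarrow> \<exists>K m0. \<forall>m\<ge>m0. v m \<le> K * e ^ m"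
  shows "superexp v"
  unfolding superexp_def
proof (intro allI impI)
  fix e :: real assume e: "0 < e"
  obtain K m0 where K: "\<And>m. m \<ge> m0 \<Longrightarrow> v m \<le> K * e ^ m" using ev[OF e] by blast
  define L where "L = \<bar>K\<bar> + (\<Sum>m<m0. \<bar>v m / e ^ m\<bar>)"
  have "v m \<le> L * e ^ m" for m
  proof (cases "m < m0")
    case True
    have "v m / e ^ m \<le> \<bar>v m / e ^ m\<bar>" by (rule abs_ge_self)
    also have "\<dots> \<le> (\<Sum>m<m0. \<bar>v m / e ^ m\<bar>)" using True by (intro member_le_sum) auto
    also have "\<dots> \<le> L" by (simp add: L_def)
    finally show ?thesis using e by (simp add: field_simps)
  next
    case False
    then have "v m \<le> K * e ^ m" using K by simp
    also have "\<dots> \<le> L * e ^ m" unfolding L_def using e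
      by (intro mult_right_mono) (auto intro: order_trans[OF abs_ge_self] simp: sum_nonneg)
    finally show ?thesis .
  qed
  then show "\<exists>K. \<forall>m. v m \<le> K * e ^ m" by blast
qed

lemma superexp_iff_root_tendsto:
  assumes v: "\<And>m. 0 \<le> v m"
  shows "superexp v \<longleftrightarrow> (\<lambda>m. v m powr (1 / real m)) \<longlonglongrightarrow> 0"
proof
  assume lim: "(\<lambda>m. v m powr (1 / real m)) \<longlonglongrightarrow> 0"
  show "superexp v"
  proof (rule superexp_eventually)
    fix e :: real assume e: "e > 0"
    obtain m0 where m0: "\<And>m. m \<ge> m0 \<Longrightarrow> v m powr (1 / real m) < e"
      using order_tendstoD(2)[OF lim e] unfolding eventually_sequentially by blast
    have "v m \<le> 1 * e ^ m" if "m \<ge> max 1 m0" for m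
    proof -
      have "(v m powr (1 / real m)) ^ m \<le> e ^ m" using m0[of m] that by (intro power_mono) auto
      moreover have "(v m powr (1 / real m)) ^ m = v m"
        using that v[of m] by (cases "v m = 0") (auto simp: powr_realpow[symmetric] powr_powr)
      ultimately show ?thesis by simp
    qed
    then show "\<exists>K m0. \<forall>m\<ge>m0. v m \<le> K * e ^ m" by blast
  qed
next
  assume s: "superexp v"
  show "(\<lambda>m. v m powr (1 / real m)) \<longlonglongrightarrow> 0"
  proof (rule LIMSEQ_I)
    fix e :: real assume e: "e > 0"
    \<comment> \<open>Half of \<open>e\<close> leaves room for the factor
      \<open>K powr (1 / m)\<close>, which is eventually below \<open>2\<close>.\<close>
    obtain K where K: "K > 0" "\<And>m. v m \<le> K * (e / 2) ^ m" using superexpD[OF s, of "e / 2"] e by auto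
    have "(\<lambda>m. K powr (1 / real m)) \<longlonglongrightarrow> K powr 0"
      using K(1) by (intro tendsto_intros lim_1_over_n) auto
    then have "\<forall>\<^sub>F m in sequentially. K powr (1 / real m) < 2"
      using K(1) by (intro order_tendstoD(2)) auto
    then obtain m0 where m0: "\<And>m. m \<ge> m0 \<Longrightarrow> K powr (1 / real m) < 2" unfolding eventually_sequentially by blast
    have "norm (v m powr (1 / real m) - 0) < e" if m: "m \<ge> max 1 m0" for m
    proof -
      have "v m powr (1 / real m) \<le> (K * (e / 2) ^ m) powr (1 / real m)"
        using v K(2) by (intro powr_mono2) auto
      also have "\<dots> = K powr (1 / real m) * ((e / 2) ^ m) powr (1 / real m)"
        using K(1) e by (simp add: powr_mult)
      also have "((e / 2) ^ m) powr (1 / real m) = e / 2"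
        using m e by (simp add: powr_realpow[symmetric] powr_powr)
      also have "K powr (1 / real m) * (e / 2) < 2 * (e / 2)"
        using m0[of m] m e by (intro mult_strict_right_mono) auto
      finally show ?thesis by simp
    qed
    then show "\<exists>m0. \<forall>m\<ge>m0. norm (v m powr (1 / real m) - 0) < e" by blast
  qed
qed

lemma exp_lipschitz:
  assumes "cmod a \<le> F" "cmod b \<le> F"
  shows "cmod (exp a - exp b) \<le> exp F * cmod (a - b)"
proof (rule field_differentiable_bound[where S="cball 0 F"])
  show "(exp has_field_derivative exp z) (at z within cball 0 F)" for z :: complex
    by (rule DERIV_subset[OF DERIV_exp]) simp
  fix z :: complex assume "z \<in> cball 0 F"
  then have "Re z \<le> F" using complex_Re_le_cmod[of z] by simp
  then show "cmod (exp z) \<le> exp F" by simp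
qed (use assms in auto)

lemma shift_pow_apply: "(shift ^^ q) x k = x (k + q)"
  by (induction q arbitrary: k) (simp_all add: shift_def)

section \<open>Admissible words and sums over them\<close>

locale sft =
  fixes N :: nat and A :: "nat \<Rightarrow> nat \<Rightarrow> nat"
  assumes nonempty: "Sigma_A N A \<noteq> {}"
begin

abbreviation "S \<equiv> Sigma_A N A"

definition "words = {pref m x | m x. x \<in> S}"
definition "cyl w = {x \<in> S. pref (length w) x = w}"
definition ind :: "nat list \<Rightarrow> (nat \<Rightarrow> nat) \<Rightarrow> complex" where
  "ind w x = (if x \<in> cyl w then 1 else 0)"
definition rep :: "nat list \<Rightarrow> nat \<Rightarrow> nat" where "rep w = (SOME x. x \<in> cyl w)"
definition wlen :: "nat \<Rightarrow> nat list set" where "wlen m = {w \<in> words. length w = m}"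
\<comment> \<open>Coefficient of \<open>ind w\<close> in the telescoping expansion along prefixes, see \<open>sec_telescope\<close>.\<close>
definition sec :: "((nat \<Rightarrow> nat) \<Rightarrow> complex) \<Rightarrow> nat list \<Rightarrow> complex" where
  "sec g w = (if w = [] then g (rep []) else g (rep w) - g (rep (butlast w)))"
text \<open>Carries the word-indexed coordinates to the \<open>nat\<close>-indexed theory of
  \<open>l1\<close>. The series involved converge absolutely, so the order of the enumeration does
  not matter.\<close>

definition W :: "nat \<Rightarrow> nat list" where "W = from_nat_into words"

lemma S_letter: "x \<in> S \<Longrightarrow> 1 \<le> x m \<and> x m \<le> N" by (auto simp: Sigma_A_def)
lemma S_trans: "x \<in> S \<Longrightarrow> A (x m) (x (Suc m)) = 1" by (auto simp: Sigma_A_def)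

lemma shift_S: "x \<in> S \<Longrightarrow> shift x \<in> S" by (auto simp: Sigma_A_def shift_def)
lemma shift_pow_S: "x \<in> S \<Longrightarrow> (shift ^^ q) x \<in> S" by (induction q) (auto intro: shift_S)

lemma pref_words: "x \<in> S \<Longrightarrow> pref m x \<in> words" by (auto simp: words_def)
lemma pref_wlen: "x \<in> S \<Longrightarrow> pref m x \<in> wlen m" by (simp add: wlen_def pref_words)
lemma wlen_eq: "wlen m = pref m ` S" by (auto simp: wlen_def words_def)

lemma butlast_words: assumes "w \<in> words" shows "butlast w \<in> words"
proof -
  obtain m x where "w = pref m x" "x \<in> S" using assms by (auto simp: words_def)
  then show ?thesis using pref_words[of x "m - 1"] by (simp only: butlast_pref)
qed

lemma butlast_wlen: "w \<in> wlen (Suc m) \<Longrightarrow> butlast w \<in> wlen m"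
  by (auto simp: wlen_def butlast_words)

lemma rep_cyl: assumes "w \<in> words" shows "rep w \<in> cyl w"
proof -
  have "\<exists>x. x \<in> cyl w" using assms by (auto simp: words_def cyl_def)
  then show ?thesis unfolding rep_def by (rule someI_ex)
qed

lemma rep_S: "w \<in> words \<Longrightarrow> rep w \<in> S" and pref_rep: "w \<in> words \<Longrightarrow> pref (length w) (rep w) = w"
  using rep_cyl by (auto simp: cyl_def)

lemma rep_pref_agree: "x \<in> S \<Longrightarrow> k < m \<Longrightarrow> rep (pref m x) k = x k"
  using pref_rep[OF pref_words, of x m] by (simp add: pref_eq_iff)

lemma rep_butlast_agree:
  assumes "w \<in> wlen (Suc m)" "k < m" shows "rep w k = rep (butlast w) k"
proof -
  have w: "w \<in> words" "length w = Suc m" using assms by (auto simp: wlen_def)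
  have "pref m (rep (butlast w)) = butlast w" using pref_rep[OF butlast_words[OF w(1)]] w(2) by simp
  also have "\<dots> = butlast (pref (Suc m) (rep w))" using pref_rep[OF w(1)] w(2) by simp
  also have "\<dots> = pref m (rep w)" by (simp add: butlast_pref)
  finally show ?thesis using assms(2) by (simp add: pref_eq_iff)
qed

lemma ind_wlen: "x \<in> S \<Longrightarrow> w \<in> wlen k \<Longrightarrow> ind w x = (if w = pref k x then 1 else 0)"
  by (auto simp: ind_def cyl_def wlen_def)

lemma wlen_lists: "wlen m \<subseteq> {w. set w \<subseteq> {1..N} \<and> length w = m}"
proof
  fix w assume "w \<in> wlen m"
  then obtain x where "x \<in> S" "w = pref m x" by (auto simp: wlen_eq)
  then show "w \<in> {w. set w \<subseteq> {1..N} \<and> length w = m}" using S_letter by (auto simp: pref_def)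
qed

lemma finite_wlen: "finite (wlen m)" and card_wlen: "card (wlen m) \<le> N ^ m"
proof -
  have f: "finite {w. set w \<subseteq> {1..N} \<and> length w = m}" by (rule finite_lists_length_eq) simp
  show "finite (wlen m)" by (rule finite_subset[OF wlen_lists f])
  have "card (wlen m) \<le> card {w. set w \<subseteq> {1..N} \<and> length w = m}" by (rule card_mono[OF f wlen_lists])
  then show "card (wlen m) \<le> N ^ m" by (simp add: card_lists_length_eq)
qed

lemma wlen_nonempty: "wlen m \<noteq> {}" using nonempty by (simp add: wlen_eq)

lemma bij_W: "bij_betw W UNIV words"
proof -
  have "infinite words"
  proof
    assume "finite words"
    then have "finite (length ` words)" by (rule finite_imageI)
    moreover have "length ` words = UNIV" using wlen_nonempty by (auto simp: wlen_def image_iff) metis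
    ultimately show False by simp
  qed
  then show ?thesis unfolding W_def by (intro bij_betw_from_nat_into) auto
qed

lemma W_words: "W i \<in> words" using bij_W by (auto simp: bij_betw_def)
lemma inj_W: "inj W" using bij_W by (simp add: bij_betw_def)
lemma W_surj: assumes "w \<in> words" shows "\<exists>i. W i = w"
proof -
  have "words = range W" using bij_W by (simp add: bij_betw_def)
  then have "w \<in> range W" using assms by simp
  then obtain i where "w = W i" by (rule rangeE)
  then show ?thesis by blast
qed

text \<open>A word has at most \<open>N\<close> one-letter extensions.\<close>

lemma sum_butlast_le:
  assumes "\<And>w. w \<in> words \<Longrightarrow> 0 \<le> H w"
  shows "(\<Sum>w\<in>wlen (Suc m). H (butlast w)) \<le> real N * (\<Sum>w\<in>wlen m. H w)"
proof -
  have inj: "inj_on (\<lambda>w. (butlast w, last w)) (wlen (Suc m))"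
  proof (rule inj_onI)
    fix u v assume uv: "u \<in> wlen (Suc m)" "v \<in> wlen (Suc m)" "(butlast u, last u) = (butlast v, last v)"
    then have "u \<noteq> []" "v \<noteq> []" by (auto simp: wlen_def)
    then show "u = v" using uv(3) by (metis append_butlast_last_id prod.inject)
  qed
  have "(\<Sum>w\<in>wlen (Suc m). H (butlast w)) = (\<Sum>(v,a)\<in>(\<lambda>w. (butlast w, last w)) ` wlen (Suc m). H v)"
    by (simp add: sum.reindex[OF inj])
  also have "\<dots> \<le> (\<Sum>(v,a)\<in>wlen m \<times> {1..N}. H v)"
  proof (rule sum_mono2)
    show "finite (wlen m \<times> {1..N})" using finite_wlen by simp
    show "(\<lambda>w. (butlast w, last w)) ` wlen (Suc m) \<subseteq> wlen m \<times> {1..N}"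
    proof clarify
      fix w assume w: "w \<in> wlen (Suc m)"
      then have "w \<noteq> []" by (auto simp: wlen_def)
      then have "last w \<in> {1..N}" using wlen_lists[of "Suc m"] w last_in_set by blast
      then show "butlast w \<in> wlen m \<and> last w \<in> {1..N}" using butlast_wlen[OF w] by simp
    qed
  qed (use assms in \<open>auto simp: wlen_def\<close>)
  also have "\<dots> = real N * (\<Sum>w\<in>wlen m. H w)"
    by (simp add: sum.cartesian_product[symmetric] sum_distrib_left)
  finally show ?thesis .
qed

text \<open>Finitely many enumerated words lie in finitely many levels \<open>wlen k\<close>, so
  bounds on the levels control the series whatever order \<open>W\<close> has chosen.\<close>

lemma words_summable:
  fixes h :: "nat list \<Rightarrow> real"
  assumes nn: "\<And>w. w \<in> words \<Longrightarrow> 0 \<le> h w" and le: "\<And>k. (\<Sum>w\<in>wlen k. h w) \<le> b k" and b: "summable b"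
  shows "summable (\<lambda>i. h (W i))" "(\<Sum>i. h (W i)) \<le> suminf b"
proof -
  have b0: "0 \<le> b k" for k
    using le[of k] sum_nonneg[of "wlen k" h] nn by (force simp: wlen_def)
  have P: "(\<Sum>i<n. h (W i)) \<le> suminf b" for n
  proof -
    define K where "K = Max (insert 0 (length ` W ` {..<n}))"
    have sub: "W ` {..<n} \<subseteq> (\<Union>k\<le>K. wlen k)"
    proof
      fix w assume w: "w \<in> W ` {..<n}"
      then have "length w \<le> K" unfolding K_def by (intro Max_ge) auto
      then show "w \<in> (\<Union>k\<le>K. wlen k)" using w W_words by (auto simp: wlen_def)
    qed
    have "(\<Sum>i<n. h (W i)) = (\<Sum>w\<in>W ` {..<n}. h w)"
      by (simp add: sum.reindex[OF inj_on_subset[OF inj_W]])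
    also have "\<dots> \<le> (\<Sum>w\<in>(\<Union>k\<le>K. wlen k). h w)"
      by (rule sum_mono2[OF _ sub]) (use finite_wlen nn in \<open>auto simp: wlen_def\<close>)
    also have "\<dots> = (\<Sum>k\<le>K. \<Sum>w\<in>wlen k. h w)"
      by (rule sum.UNION_disjoint) (use finite_wlen in \<open>auto simp: wlen_def\<close>)
    also have "\<dots> \<le> (\<Sum>k\<le>K. b k)" by (intro sum_mono le)
    also have "\<dots> \<le> suminf b" by (rule sum_le_suminf[OF b]) (use b0 in auto)
    finally show ?thesis .
  qed
  show s: "summable (\<lambda>i. h (W i))"
    by (rule summableI_nonneg_bounded[OF _ P]) (use nn W_words in auto)
  show "(\<Sum>i. h (W i)) \<le> suminf b" by (rule suminf_le_const[OF s P])
qed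

text \<open>Absolute convergence permits summation by word length, the order in which the expansions
  along prefixes telescope.\<close>

lemma words_sum_limit:
  fixes h :: "nat list \<Rightarrow> complex"
  assumes s: "summable (\<lambda>i. cmod (h (W i)))"
  shows "(\<lambda>m. \<Sum>k\<le>m. \<Sum>w\<in>wlen k. h w) \<longlonglongrightarrow> (\<Sum>i. h (W i))"
proof -
  define a where "a m i = (if length (W i) \<le> m then h (W i) else 0)" for m i
  have lim: "(\<lambda>m. a m i) \<longlonglongrightarrow> h (W i)" for i
  proof (rule Lim_transform_eventually[OF tendsto_const])
    show "\<forall>\<^sub>F m in sequentially. h (W i) = a m i"
      using eventually_ge_at_top[of "length (W i)"] by eventually_elim (simp add: a_def)
  qed
  have dom: "norm (a m i) \<le> cmod (h (W i))" for m i by (simp add: a_def)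
  have "(\<Sum>i. a m i) = (\<Sum>k\<le>m. \<Sum>w\<in>wlen k. h w)" for m
  proof -
    let ?I = "{i. length (W i) \<le> m}"
    have im: "W ` ?I = (\<Union>k\<le>m. wlen k)"
    proof (rule Set.set_eqI)
      fix w show "w \<in> W ` ?I \<longleftrightarrow> w \<in> (\<Union>k\<le>m. wlen k)"
        using W_surj[of w] W_words by (auto simp: wlen_def)
    qed
    have fin: "finite ?I"
    proof (rule finite_imageD)
      show "finite (W ` ?I)" unfolding im using finite_wlen by simp
      show "inj_on W ?I" by (rule inj_on_subset[OF inj_W]) simp
    qed
    have "(\<Sum>i. a m i) = (\<Sum>i\<in>?I. h (W i))"
      using sums_If_finite_set[OF fin, of "\<lambda>i. h (W i)"] by (simp add: a_def sums_iff)
    also have "\<dots> = (\<Sum>w\<in>W ` ?I. h w)" by (simp add: sum.reindex[OF inj_on_subset[OF inj_W]])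
    also have "\<dots> = (\<Sum>k\<le>m. \<Sum>w\<in>wlen k. h w)" unfolding im
      by (rule sum.UNION_disjoint) (use finite_wlen in \<open>auto simp: wlen_def\<close>)
    finally show ?thesis .
  qed
  then show ?thesis using suminf_dominated_convergence(2)[OF lim dom s] by simp
qed

section \<open>Moduli of continuity and the space V\<close>

definition agree :: "nat \<Rightarrow> (nat \<Rightarrow> nat) \<Rightarrow> (nat \<Rightarrow> nat) \<Rightarrow> bool" where
  "agree m x y \<longleftrightarrow> x \<in> S \<and> y \<in> S \<and> (\<forall>k<m. x k = y k)"

text \<open>A majorant of the variations replaces the supremum in \<open>var\<close>, so that
  membership in \<open>Vsp\<close> can be shown by estimating single differences.\<close>

definition modulus :: "((nat \<Rightarrow> nat) \<Rightarrow> complex) \<Rightarrow> (nat \<Rightarrow> real) \<Rightarrow> bool" where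
  "modulus g v \<longleftrightarrow> (\<forall>m x y. agree m x y \<longrightarrow> cmod (g x - g y) \<le> v m)"

lemma var_eq: "var N A g m = Sup {cmod (g x - g y) | x y. agree m x y}"
  unfolding var_def agree_def by meson

lemma modulus_nonneg: "modulus g v \<Longrightarrow> 0 \<le> v m"
  using nonempty unfolding modulus_def agree_def by (metis (no_types, lifting) all_not_in_conv norm_ge_zero order_trans)

lemma Vsp_modulus:
  assumes g: "g \<in> Vsp N A"
  shows "modulus g (var N A g)" "superexp (var N A g)"
proof -
  have bdd: "bdd_above {cmod (g x - g y) | x y. agree m x y}" for m
    using g by (simp add: Vsp_def agree_def)
  show m: "modulus g (var N A g)"
    unfolding modulus_def var_eq using cSup_upper[OF _ bdd] by blast
  show "superexp (var N A g)"
    using g modulus_nonneg[OF m] by (subst superexp_iff_root_tendsto) (auto simp: Vsp_def)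
qed

lemma modulus_Vsp:
  assumes "modulus g v" "superexp v" "\<And>x. x \<notin> S \<Longrightarrow> g x = 0"
  shows "g \<in> Vsp N A"
proof -
  have bdd: "bdd_above {cmod (g x - g y) | x y. agree m x y}" for m
    using assms(1) unfolding modulus_def bdd_above_def by blast
  obtain x0 where x0: "x0 \<in> S" using nonempty by blast
  have var_le: "var N A g m \<le> v m" for m
    unfolding var_eq
  proof (rule cSup_least)
    have "agree m x0 x0" using x0 by (simp add: agree_def)
    then show "{cmod (g x - g y) | x y. agree m x y} \<noteq> {}" by blast
  qed (use assms(1) in \<open>auto simp: modulus_def\<close>)
  have mv: "modulus g (var N A g)" unfolding modulus_def var_eq using cSup_upper[OF _ bdd] by blast
  have "superexp (var N A g)" by (rule superexp_mono[OF assms(2) var_le])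
  then have "(\<lambda>m. var N A g m powr (1 / real m)) \<longlonglongrightarrow> 0"
    using superexp_iff_root_tendsto[of "var N A g"] modulus_nonneg[OF mv] by blast
  then show ?thesis using bdd assms(3) unfolding Vsp_def agree_def by blast
qed

lemma modulus_bounded:
  assumes "modulus g v" shows "\<exists>F\<ge>0. \<forall>x\<in>S. cmod (g x) \<le> F"
proof -
  obtain x0 where x0: "x0 \<in> S" using nonempty by blast
  have "cmod (g x) \<le> cmod (g x0) + v 0" if "x \<in> S" for x
  proof -
    have "cmod (g x - g x0) \<le> v 0" using assms that x0 by (auto simp: modulus_def agree_def)
    then show ?thesis using norm_triangle_sub[of "g x" "g x0"] by simp
  qed
  moreover have "0 \<le> cmod (g x0) + v 0" using modulus_nonneg[OF assms] by simp
  ultimately show ?thesis by (intro exI[of _ "cmod (g x0) + v 0"]) auto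
qed

lemma Vsp_lin:
  "(\<lambda>_. 0) \<in> Vsp N A"
  "g \<in> Vsp N A \<Longrightarrow> h \<in> Vsp N A \<Longrightarrow> (\<lambda>x. g x + h x) \<in> Vsp N A"
  "g \<in> Vsp N A \<Longrightarrow> (\<lambda>x. c * g x) \<in> Vsp N A"
proof -
  show "(\<lambda>_. 0) \<in> Vsp N A"
    by (rule modulus_Vsp[of _ "\<lambda>_. 0"]) (auto simp: modulus_def superexp_def intro!: exI[of _ 0])
  show "(\<lambda>x. c * g x) \<in> Vsp N A" if g: "g \<in> Vsp N A"
  proof (rule modulus_Vsp)
    show "superexp (\<lambda>m. cmod c * var N A g m)" by (rule superexp_scale[OF Vsp_modulus(2)[OF g]]) simp
    show "modulus (\<lambda>x. c * g x) (\<lambda>m. cmod c * var N A g m)"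
      using Vsp_modulus(1)[OF g] unfolding modulus_def
      by (simp add: norm_mult right_diff_distrib[symmetric] mult_left_mono)
  qed (use g in \<open>auto simp: Vsp_def\<close>)
  show "(\<lambda>x. g x + h x) \<in> Vsp N A" if g: "g \<in> Vsp N A" and h: "h \<in> Vsp N A"
  proof (rule modulus_Vsp)
    show "superexp (\<lambda>m. var N A g m + var N A h m)" by (intro superexp_add Vsp_modulus g h)
    show "modulus (\<lambda>x. g x + h x) (\<lambda>m. var N A g m + var N A h m)"
      unfolding modulus_def
    proof (intro allI impI)
      fix m x y assume "agree m x y"
      then have "cmod (g x - g y) \<le> var N A g m" "cmod (h x - h y) \<le> var N A h m"
        using Vsp_modulus(1)[OF g] Vsp_modulus(1)[OF h] by (auto simp: modulus_def)
      then show "cmod (g x + h x - (g y + h y)) \<le> var N A g m + var N A h m"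
        using norm_triangle_ineq[of "g x - g y" "h x - h y"] by (simp add: algebra_simps)
    qed
  qed (use g h in \<open>auto simp: Vsp_def\<close>)
qed

lemma rep_tendsto:
  assumes g: "g \<in> Vsp N A" and x: "x \<in> S"
    and y: "\<And>m. agree m (y m) x"
  shows "(\<lambda>m. g (y m)) \<longlonglongrightarrow> g x"
proof -
  obtain K where K: "\<And>m. var N A g m \<le> K * (1 / 2) ^ m"
    using superexpD[OF Vsp_modulus(2)[OF g], of "1/2"] by auto
  have "(\<lambda>m. K * (1 / 2) ^ m) \<longlonglongrightarrow> K * 0" by (intro tendsto_mult tendsto_const LIMSEQ_power_zero) simp
  then have lim: "(\<lambda>m. K * (1 / 2) ^ m) \<longlonglongrightarrow> 0" by simp
  have "norm (g (y m) - g x) \<le> K * (1 / 2) ^ m" for m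
    using Vsp_modulus(1)[OF g] y[of m] K[of m] unfolding modulus_def by (meson order_trans)
  then have "(\<lambda>m. g (y m) - g x) \<longlonglongrightarrow> 0"
    by (rule Lim_null_comparison[OF always_eventually[OF allI] lim])
  then show ?thesis by (rule LIM_zero_cancel)
qed

section \<open>Inverse branches and the transfer operator\<close>

lemma scons_S_iff: "x \<in> S \<Longrightarrow> scons i x \<in> S \<longleftrightarrow> i \<in> {1..N} \<and> A i (x 0) = 1"
  unfolding Sigma_A_def scons_def by (auto split: nat.splits)

lemma shift_scons [simp]: "shift (scons i x) = x" by (simp add: shift_def scons_def)
lemma scons_shift: "scons (x 0) (shift x) = x" by (auto simp: shift_def scons_def fun_eq_iff split: nat.splits)

lemma preimage_eq: "x \<in> S \<Longrightarrow> {y \<in> S. shift y = x} = (\<lambda>i. scons i x) ` {i \<in> {1..N}. A i (x 0) = 1}"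
proof (rule Set.set_eqI)
  fix y assume x: "x \<in> S"
  show "y \<in> {y \<in> S. shift y = x} \<longleftrightarrow> y \<in> (\<lambda>i. scons i x) ` {i \<in> {1..N}. A i (x 0) = 1}"
  proof
    assume "y \<in> {y \<in> S. shift y = x}"
    then have y: "y \<in> S" "scons (y 0) x = y" using scons_shift[of y] by auto
    then have "y 0 \<in> {i \<in> {1..N}. A i (x 0) = 1}" using scons_S_iff[OF x, of "y 0"] by simp
    then show "y \<in> (\<lambda>i. scons i x) ` {i \<in> {1..N}. A i (x 0) = 1}" using y(2) by (intro image_eqI[of _ _ "y 0"]) auto
  qed (use scons_S_iff[OF x] in auto)
qed

lemma scons_inj: "inj_on (\<lambda>i. scons i x) I"
  by (rule inj_onI) (drule fun_cong[where x=0], simp add: scons_def)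

lemma Lop_preimage:
  assumes "x \<in> S"
  shows "Lop N A f g x = (\<Sum>y\<in>{y \<in> S. shift y = x}. exp (f y) * g y)"
  unfolding preimage_eq[OF assms] using assms by (simp add: Lop_def sum.reindex[OF scons_inj])

lemma finite_preimage: "x \<in> S \<Longrightarrow> finite {y \<in> S. shift y = x}"
  by (simp add: preimage_eq)

lemma finite_preimage_pow: "x \<in> S \<Longrightarrow> finite {y \<in> S. (shift ^^ q) y = x}"
proof (induction q arbitrary: x)
  case 0
  then show ?case by simp
next
  case (Suc q)
  have "{y \<in> S. (shift ^^ Suc q) y = x} \<subseteq> (\<Union>z\<in>{z \<in> S. shift z = x}. {y \<in> S. (shift ^^ q) y = z})"
    using shift_pow_S by auto
  moreover have "finite (\<Union>z\<in>{z \<in> S. shift z = x}. {y \<in> S. (shift ^^ q) y = z})"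
    using finite_preimage[OF Suc.prems] Suc.IH by auto
  ultimately show ?case by (rule finite_subset)
qed

lemma Lop_pow:
  assumes "x \<in> S"
  shows "(Lop N A f ^^ q) g x = (\<Sum>y\<in>{y \<in> S. (shift ^^ q) y = x}. exp (birk f q y) * g y)"
  using assms
proof (induction q arbitrary: x)
  case 0
  have "{y \<in> S. y = x} = {x}" using 0 by auto
  then show ?case by (simp add: birk_def)
next
  case (Suc q)
  let ?P = "{z \<in> S. shift z = x}" and ?Q = "\<lambda>z. {y \<in> S. (shift ^^ q) y = z}"
  have U: "{y \<in> S. (shift ^^ Suc q) y = x} = (\<Union>z\<in>?P. ?Q z)" using shift_pow_S by auto
  have "(Lop N A f ^^ Suc q) g x = (\<Sum>z\<in>?P. exp (f z) * (Lop N A f ^^ q) g z)"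
    by (simp add: Lop_preimage[OF Suc.prems])
  also have "\<dots> = (\<Sum>z\<in>?P. \<Sum>y\<in>?Q z. exp (birk f (Suc q) y) * g y)"
  proof (rule sum.cong[OF refl])
    fix z assume "z \<in> ?P"
    then have z: "z \<in> S" by simp
    show "exp (f z) * (Lop N A f ^^ q) g z = (\<Sum>y\<in>?Q z. exp (birk f (Suc q) y) * g y)"
    proof -
      have "exp (f z) * (Lop N A f ^^ q) g z = exp (f z) * (\<Sum>y\<in>?Q z. exp (birk f q y) * g y)"
        by (rule arg_cong[OF Suc.IH[OF z]])
      also have "\<dots> = (\<Sum>y\<in>?Q z. exp (f z) * (exp (birk f q y) * g y))"
        by (rule sum_distrib_left)
      also have "\<dots> = (\<Sum>y\<in>?Q z. exp (birk f (Suc q) y) * g y)"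
        by (rule sum.cong[OF refl]) (auto simp: birk_def exp_add)
      finally show ?thesis .
    qed
  qed
  also have "\<dots> = (\<Sum>y\<in>(\<Union>z\<in>?P. ?Q z). exp (birk f (Suc q) y) * g y)"
    by (rule sum.UNION_disjoint[symmetric])
       (use finite_preimage[OF Suc.prems] finite_preimage_pow in auto)
  finally show ?case by (simp only: U)
qed

lemma Lop_lin: "Lop N A f (\<lambda>x. g x + h x) = (\<lambda>x. Lop N A f g x + Lop N A f h x)"
  "Lop N A f (\<lambda>x. c * g x) = (\<lambda>x. c * Lop N A f g x)" "Lop N A f (\<lambda>_. 0) = (\<lambda>_. 0)"
  by (auto simp: Lop_def fun_eq_iff ring_distribs sum.distrib sum_distrib_left mult_ac)

lemma Lop_pow_scale: "(Lop N A f ^^ q) (\<lambda>x. c * g x) = (\<lambda>x. c * (Lop N A f ^^ q) g x)"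
  by (induction q) (simp_all add: Lop_lin)

lemma Lop_bound:
  assumes f: "\<And>x. x \<in> S \<Longrightarrow> cmod (f x) \<le> F" and g: "\<And>x. x \<in> S \<Longrightarrow> cmod (g x) \<le> G" and G: "0 \<le> G"
  shows "cmod (Lop N A f g x) \<le> real N * exp F * G"
proof (cases "x \<in> S")
  case True
  let ?I = "{i \<in> {1..N}. A i (x 0) = 1}"
  have "card ?I \<le> card {1..N}" by (rule card_mono) auto
  then have card_I: "card ?I \<le> N" by simp
  have "cmod (Lop N A f g x) \<le> (\<Sum>i\<in>?I. exp F * G)"
  proof -
    have "cmod (exp (f (scons i x)) * g (scons i x)) \<le> exp F * G" if "i \<in> ?I" for i
    proof -
      have s: "scons i x \<in> S" using that scons_S_iff[OF True] by auto
      have "Re (f (scons i x)) \<le> F" using f[OF s] complex_Re_le_cmod[of "f (scons i x)"] by linarith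
      then show ?thesis unfolding norm_mult using g[OF s] by (intro mult_mono) auto
    qed
    then have "cmod (\<Sum>i\<in>?I. exp (f (scons i x)) * g (scons i x)) \<le> (\<Sum>i\<in>?I. exp F * G)"
      by (rule sum_norm_le)
    then show ?thesis unfolding Lop_def using True by (simp only: if_True)
  qed
  also have "\<dots> = real (card ?I) * (exp F * G)" by simp
  also have "\<dots> \<le> real N * (exp F * G)"
    using card_I G by (intro mult_right_mono) auto
  finally show ?thesis by (simp add: mult.assoc)
qed (use G in \<open>simp add: Lop_def\<close>)

text \<open>Prepending a common letter lengthens the agreement by one, so differences of
  \<open>f\<close> and \<open>g\<close> are taken one level further on. At least one common letter
  is required: only then do \<open>x\<close> and \<open>y\<close> admit the same letters in front,
  and the preimages can be paired.\<close>

lemma Lop_diff_bound: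
  assumes f: "\<And>x. x \<in> S \<Longrightarrow> cmod (f x) \<le> F" and g: "\<And>x. x \<in> S \<Longrightarrow> cmod (g x) \<le> G"
    and xy: "agree (Suc k) x y" and G: "0 \<le> G" and d: "0 \<le> df" "0 \<le> dg"
    and df: "\<And>u v. agree (Suc (Suc k)) u v \<Longrightarrow> cmod (f u - f v) \<le> df"
    and dg: "\<And>u v. agree (Suc (Suc k)) u v \<Longrightarrow> cmod (g u - g v) \<le> dg"
  shows "cmod (Lop N A f g x - Lop N A f g y) \<le> real N * exp F * (df * G + dg)"
proof -
  have S: "x \<in> S" "y \<in> S" and e: "x 0 = y 0" using xy by (auto simp: agree_def)
  let ?I = "{i \<in> {1..N}. A i (x 0) = 1}"
  have "card ?I \<le> card {1..N}" by (rule card_mono) auto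
  then have card_I: "card ?I \<le> N" by simp
  have t: "cmod (exp (f (scons i x)) * g (scons i x) - exp (f (scons i y)) * g (scons i y)) \<le> exp F * (df * G + dg)"
    if i: "i \<in> ?I" for i
  proof -
    let ?x = "scons i x" and ?y = "scons i y"
    have s: "?x \<in> S" "?y \<in> S" using i e scons_S_iff[OF S(1)] scons_S_iff[OF S(2)] by auto
    have ag: "agree (Suc (Suc k)) ?x ?y"
      using s xy by (auto simp: agree_def scons_def split: nat.splits)
    have "Re (f ?y) \<le> F" using f[OF s(2)] complex_Re_le_cmod[of "f ?y"] by linarith
    then have ey: "cmod (exp (f ?y)) \<le> exp F" by simp
    have eq: "exp (f ?x) * g ?x - exp (f ?y) * g ?y = (exp (f ?x) - exp (f ?y)) * g ?x + exp (f ?y) * (g ?x - g ?y)"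
      by (simp add: algebra_simps)
    have "cmod (exp (f ?x) * g ?x - exp (f ?y) * g ?y)
        \<le> cmod (exp (f ?x) - exp (f ?y)) * cmod (g ?x) + cmod (exp (f ?y)) * cmod (g ?x - g ?y)"
      unfolding eq by (rule order_trans[OF norm_triangle_ineq]) (simp only: norm_mult order_refl)
    also have "\<dots> \<le> (exp F * df) * G + exp F * dg"
    proof (intro add_mono mult_mono)
      have "cmod (exp (f ?x) - exp (f ?y)) \<le> exp F * cmod (f ?x - f ?y)"
        by (rule exp_lipschitz[OF f[OF s(1)] f[OF s(2)]])
      also have "\<dots> \<le> exp F * df" using df[OF ag] by simp
      finally show "cmod (exp (f ?x) - exp (f ?y)) \<le> exp F * df" .
    qed (use g[OF s(1)] dg[OF ag] ey d in auto)
    finally show ?thesis by (simp add: algebra_simps)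
  qed
  have eq: "Lop N A f g x - Lop N A f g y = (\<Sum>i\<in>?I. exp (f (scons i x)) * g (scons i x) - exp (f (scons i y)) * g (scons i y))"
    using S e by (simp add: Lop_def sum_subtractf)
  have "cmod (Lop N A f g x - Lop N A f g y) \<le> (\<Sum>i\<in>?I. exp F * (df * G + dg))"
    unfolding eq by (rule sum_norm_le[OF t])
  also have "\<dots> = real (card ?I) * (exp F * (df * G + dg))" by simp
  also have "\<dots> \<le> real N * (exp F * (df * G + dg))"
    using card_I G d by (intro mult_right_mono) auto
  finally show ?thesis by (simp add: mult.assoc)
qed

lemma Lop_Vsp:
  assumes f: "f \<in> Vsp N A" and g: "g \<in> Vsp N A"
  shows "Lop N A f g \<in> Vsp N A"
proof -
  obtain F where F: "F \<ge> 0" "\<And>x. x \<in> S \<Longrightarrow> cmod (f x) \<le> F" using modulus_bounded[OF Vsp_modulus(1)[OF f]] by blast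
  obtain G where G: "G \<ge> 0" "\<And>x. x \<in> S \<Longrightarrow> cmod (g x) \<le> G" using modulus_bounded[OF Vsp_modulus(1)[OF g]] by blast
  let ?c = "real N * exp F"
  have LB: "cmod (Lop N A f g x) \<le> ?c * G" for x by (rule Lop_bound) (use F G in auto)
  \<comment> \<open>At \<open>m = 0\<close> the first letters may differ and the preimages cannot be
    paired, so this entry uses twice the bound on \<open>L g\<close>.\<close>
  define v where "v m = (?c * G * var N A f (Suc m) + ?c * var N A g (Suc m)) + (if m = 0 then 2 * (?c * G) else 0)" for m
  note mf = Vsp_modulus[OF f] and mg = Vsp_modulus[OF g]
  show ?thesis
  proof (rule modulus_Vsp)
    show "superexp v" unfolding v_def
      using F G by (intro superexp_add superexp_scale superexp_Suc mf mg superexp_0) auto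
    show "modulus (Lop N A f g) v" unfolding modulus_def
    proof (intro allI impI)
      fix m x y assume a: "agree m x y"
      show "cmod (Lop N A f g x - Lop N A f g y) \<le> v m"
      proof (cases m)
        case 0
        have "cmod (Lop N A f g x - Lop N A f g y) \<le> 2 * (?c * G)"
          using LB[of x] LB[of y] norm_triangle_ineq4[of "Lop N A f g x" "Lop N A f g y"] by linarith
        moreover have "0 \<le> ?c * G * var N A f (Suc 0) + ?c * var N A g (Suc 0)"
          using G modulus_nonneg[OF mf(1)] modulus_nonneg[OF mg(1)] by simp
        ultimately show ?thesis using 0 by (simp add: v_def)
      next
        case (Suc k)
        have "cmod (Lop N A f g x - Lop N A f g y) \<le> ?c * (var N A f (Suc (Suc k)) * G + var N A g (Suc (Suc k)))"
          using F G a Suc modulus_nonneg[OF mf(1)] modulus_nonneg[OF mg(1)] mf(1) mg(1)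
          by (intro Lop_diff_bound) (auto simp: modulus_def)
        then show ?thesis using Suc by (simp add: v_def algebra_simps)
      qed
    qed
  qed (simp add: Lop_def)
qed

lemma Vsp_lin_on: "f \<in> Vsp N A \<Longrightarrow> lin_on (Vsp N A) (Lop N A f)"
  by (simp add: lin_on_def Vsp_lin Lop_lin)

end

section \<open>The transfer operator as an infinite matrix\<close>

definition gw :: "real \<Rightarrow> real \<Rightarrow> nat \<Rightarrow> real" where
  "gw r D k = D ^ k * r ^ (k * k)"

lemma gw_pos: "0 < r \<Longrightarrow> 0 < D \<Longrightarrow> 0 < gw r D k" by (simp add: gw_def)

lemma gw_0 [simp]: "gw r D 0 = 1" by (simp add: gw_def)

lemma gw_Suc: "gw r D (Suc k) = D * r ^ (2 * k + 1) * gw r D k"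
proof -
  have "Suc k * Suc k = (2 * k + 1) + k * k" by simp
  then have "r ^ (Suc k * Suc k) = r ^ (2 * k + 1) * r ^ (k * k)" by (simp only: power_add)
  then show ?thesis unfolding gw_def by simp
qed

lemma gw_add_le:
  assumes "0 < r" "r < 1" "0 \<le> D"
  shows "gw r D (k + i) \<le> gw r D k * gw r D i"
proof -
  have "r ^ ((k + i) * (k + i)) \<le> r ^ (k * k + i * i)"
    using assms by (intro power_decreasing) (auto simp: algebra_simps)
  then have "D ^ (k + i) * r ^ ((k + i) * (k + i)) \<le> D ^ (k + i) * r ^ (k * k + i * i)"
    using assms by (intro mult_left_mono) auto
  then show ?thesis by (simp add: gw_def power_add mult_ac)
qed

lemma gw_superexp:
  assumes "0 < r" "r < 1" "0 < D" shows "superexp (gw r D)"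
proof (rule superexp_eventually)
  fix e :: real assume e: "e > 0"
  have "(\<lambda>m. D * r ^ m) \<longlonglongrightarrow> D * 0" using assms by (intro tendsto_mult tendsto_const LIMSEQ_power_zero) auto
  then obtain m0 where m0: "\<And>m. m \<ge> m0 \<Longrightarrow> D * r ^ m < e"
    using order_tendstoD(2)[of "\<lambda>m. D * r ^ m" 0 sequentially e] e unfolding eventually_sequentially by auto
  have "gw r D m \<le> 1 * e ^ m" if "m \<ge> m0" for m
  proof -
    have "gw r D m = (D * r ^ m) ^ m" by (simp add: gw_def power_mult_distrib power_mult)
    also have "\<dots> \<le> e ^ m" using m0[OF that] assms by (intro power_mono) auto
    finally show ?thesis by simp
  qed
  then show "\<exists>K m0. \<forall>m\<ge>m0. gw r D m \<le> K * e ^ m" by blast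
qed

text \<open>Once \<open>a m < 1 / 2\<close>, the bound \<open>T\<close> reproduces itself because
  \<open>(1 + T) / 2 \<le> T\<close> for \<open>T \<ge> 1\<close>.\<close>

lemma contracting_recursion_bounded:
  fixes t a :: "nat \<Rightarrow> real"
  assumes t: "\<And>m. t (Suc m) = a m * (1 + t m)" "t 0 = 0" and a: "\<And>m. 0 \<le> a m" "a \<longlonglongrightarrow> 0"
  shows "\<exists>T\<ge>0. \<forall>m. 0 \<le> t m \<and> t m \<le> T"
proof -
  have t0: "0 \<le> t m" for m by (induction m) (auto simp: t a)
  obtain m0 where m0: "\<And>m. m \<ge> m0 \<Longrightarrow> a m < 1 / 2"
    using order_tendstoD(2)[OF a(2), of "1/2"] unfolding eventually_sequentially by auto
  define T where "T = max 1 (Max (t ` {..m0}))"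
  have T1: "1 \<le> T" by (simp add: T_def)
  have le: "t m \<le> T" if "m \<le> m0" for m
    unfolding T_def using that by (intro max.coboundedI2 Max_ge) auto
  have "t (m0 + k) \<le> T" for k
  proof (induction k)
    case (Suc k)
    have "t (m0 + Suc k) = a (m0 + k) * (1 + t (m0 + k))" using t(1) by simp
    also have "\<dots> \<le> 1 / 2 * (1 + T)"
      using m0[of "m0 + k"] Suc t0 a(1) by (intro mult_mono) (auto simp: add_nonneg_nonneg)
    also have "\<dots> \<le> T" using T1 by simp
    finally show ?case .
  qed (simp add: le)
  then have "t m \<le> T" for m using le[of m] by (metis le_add_diff_inverse nat_le_linear)
  then show ?thesis using t0 T1 by (intro exI[of _ T]) auto
qed

text \<open>The sums satisfy \<open>t (Suc m) = a m * (1 + t m)\<close> with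
  \<open>a m = D * r^(2 m + 1)\<close>. Boundedness of \<open>t\<close> and one further use of the
  recursion give the factor \<open>r^(2 m)\<close>: in order of magnitude only the term
  \<open>k = m - 1\<close> counts.\<close>

lemma gw_ratio_sum_bounded:
  assumes r: "0 < r" "r < 1" and D: "0 < D"
  shows "\<exists>K\<ge>0. \<forall>m. (\<Sum>k<m. gw r D m / gw r D k) \<le> K * r ^ (2 * m) \<and> gw r D m \<le> K * r ^ (2 * m)"
proof -
  define t where "t m = (\<Sum>k<m. gw r D m / gw r D k)" for m
  define a where "a m = D * r ^ (2 * m + 1)" for m
  have rec: "t (Suc m) = a m * (1 + t m)" for m
  proof -
    have "t (Suc m) = (\<Sum>k<m. a m * (gw r D m / gw r D k)) + a m * (gw r D m / gw r D m)"
      unfolding t_def gw_Suc a_def by simp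
    also have "(\<Sum>k<m. a m * (gw r D m / gw r D k)) = a m * t m"
      unfolding t_def by (rule sum_distrib_left[symmetric])
    also have "a m * t m + a m * (gw r D m / gw r D m) = a m * (1 + t m)"
      using gw_pos[OF r(1) D, of m] by (simp add: distrib_left)
    finally show ?thesis .
  qed
  have "(\<lambda>m. D * (r * (r ^ 2) ^ m)) \<longlonglongrightarrow> D * (r * 0)"
    using r by (intro tendsto_mult tendsto_const LIMSEQ_power_zero) (simp add: power_less_one_iff abs_square_less_1)
  then have "a \<longlonglongrightarrow> 0" unfolding a_def by (simp add: power_mult)
  moreover have "0 \<le> a m" for m using r D by (simp add: a_def)
  ultimately obtain T where T: "T \<ge> 0" "\<And>m. 0 \<le> t m \<and> t m \<le> T"
    using contracting_recursion_bounded[of t a] rec by (auto simp: t_def)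
  \<comment> \<open>For \<open>m = Suc n\<close> one has
    \<open>D * r^(2 n + 1) = (D / r) * r^(2 m)\<close>; the \<open>1\<close> covers
    \<open>gw r D 0\<close>.\<close>
  define K where "K = max 1 (D * (1 + T) / r)"
  have tK: "t m \<le> K * r ^ (2 * m)" for m
  proof (cases m)
    case 0
    then show ?thesis by (simp add: t_def K_def)
  next
    case (Suc n)
    have "t m \<le> a n * (1 + T)" unfolding Suc rec using T r D by (intro mult_left_mono) (auto simp: a_def)
    also have "\<dots> = (D * (1 + T) / r) * r ^ (2 * m)" using r by (simp add: a_def Suc field_simps)
    also have "\<dots> \<le> K * r ^ (2 * m)" using r by (intro mult_right_mono) (auto simp: K_def)
    finally show ?thesis .
  qed
  have gK: "gw r D m \<le> K * r ^ (2 * m)" for m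
  proof (cases m)
    case 0
    then show ?thesis by (simp add: K_def)
  next
    case (Suc n)
    have "gw r D m / gw r D 0 \<le> t m"
      unfolding t_def using Suc gw_pos[OF r(1) D] by (intro member_le_sum) (auto intro!: divide_nonneg_nonneg less_imp_le)
    then show ?thesis using tK[of m] by simp
  qed
  show ?thesis using tK gK by (intro exI[of _ K]) (auto simp: t_def K_def)
qed

text \<open>Iterating the recursion \<open>j\<close> times leaves \<open>c^j * v (k + j)\<close>,
  which vanishes as \<open>j\<close> grows even for large \<open>c\<close>, because \<open>v\<close>
  decays faster than any geometric sequence. The accumulated inhomogeneous terms are bounded through
  \<open>gw (k + i) \<le> gw k * gw i\<close>.\<close>

lemma superexp_bootstrap:
  assumes v: "superexp v" "\<And>k. 0 \<le> v k" and r: "0 < r" "r < 1" and D: "0 < D" and c: "0 \<le> c" and K: "0 \<le> K"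
    and rec: "\<And>k. k \<ge> 1 \<Longrightarrow> v k \<le> c * v (Suc k) + K * gw r D k"
  shows "\<exists>Q\<ge>0. \<forall>k\<ge>1. v k \<le> Q * gw r D k"
proof -
  \<comment> \<open>Chosen so that \<open>c * e \<le> 1 / 2\<close>.\<close>
  define e where "e = 1 / (2 * (c + 1))"
  have e: "e > 0" "c * e \<le> 1 / 2" "0 \<le> c * e" using c by (auto simp: e_def field_simps)
  obtain G where G: "G > 0" "\<And>m. gw r D m \<le> G * e ^ m" using superexpD[OF gw_superexp[OF r D] e(1)] by blast
  obtain H where H: "H > 0" "\<And>m. v m \<le> H * e ^ m" using superexpD[OF v(1) e(1)] by blast
  have geo: "summable (\<lambda>i. G * (1 / 2) ^ i)" by (intro summable_mult summable_geometric) simp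
  have trm: "c ^ i * gw r D i \<le> G * (1 / 2) ^ i" for i
  proof -
    have "c ^ i * gw r D i \<le> c ^ i * (G * e ^ i)" using c G by (intro mult_left_mono) auto
    also have "\<dots> = G * (c * e) ^ i" by (simp add: power_mult_distrib)
    also have "\<dots> \<le> G * (1 / 2) ^ i" using G e by (intro mult_left_mono power_mono) auto
    finally show ?thesis .
  qed
  have t0: "0 \<le> c ^ i * gw r D i" for i using c gw_pos[OF r(1) D, of i] by simp
  have sz: "summable (\<lambda>i. c ^ i * gw r D i)"
    by (rule summable_comparison_test'[OF geo, where N=0]) (use trm t0 in auto)
  define Z where "Z = (\<Sum>i. c ^ i * gw r D i)"
  have Z0: "0 \<le> Z" unfolding Z_def by (rule suminf_nonneg[OF sz t0])
  have it: "v k \<le> c ^ j * v (k + j) + K * (\<Sum>i<j. c ^ i * gw r D (k + i))" if k: "k \<ge> 1" for k j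
  proof (induction j)
    case (Suc j)
    have "c ^ j * v (k + j) \<le> c ^ j * (c * v (Suc (k + j)) + K * gw r D (k + j))"
      using c k by (intro mult_left_mono rec) auto
    then show ?case using Suc by (simp add: algebra_simps)
  qed simp
  have "v k \<le> K * Z * gw r D k" if k: "k \<ge> 1" for k
  proof (rule LIMSEQ_le_const)
    have "(\<lambda>j. (1/2) ^ j :: real) \<longlonglongrightarrow> 0" by (rule LIMSEQ_power_zero) simp
    then have "(\<lambda>j. H * e ^ k * (1/2) ^ j + K * Z * gw r D k) \<longlonglongrightarrow> H * e ^ k * 0 + K * Z * gw r D k"
      by (intro tendsto_add tendsto_mult tendsto_const)
    then show "(\<lambda>j. H * e ^ k * (1/2) ^ j + K * Z * gw r D k) \<longlonglongrightarrow> K * Z * gw r D k" by simp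
    have "v k \<le> H * e ^ k * (1/2) ^ j + K * Z * gw r D k" for j
    proof -
      have "c ^ j * v (k + j) \<le> c ^ j * (H * e ^ (k + j))" using c H by (intro mult_left_mono) auto
      also have "\<dots> = H * e ^ k * (c * e) ^ j" by (simp add: power_add power_mult_distrib)
      also have "\<dots> \<le> H * e ^ k * (1/2) ^ j" using H e by (intro mult_left_mono power_mono) auto
      finally have 1: "c ^ j * v (k + j) \<le> H * e ^ k * (1/2) ^ j" .
      have "(\<Sum>i<j. c ^ i * gw r D (k + i)) \<le> (\<Sum>i<j. gw r D k * (c ^ i * gw r D i))"
      proof (rule sum_mono)
        fix i
        have "c ^ i * gw r D (k + i) \<le> c ^ i * (gw r D k * gw r D i)"
          using c r D by (intro mult_left_mono gw_add_le) auto
        then show "c ^ i * gw r D (k + i) \<le> gw r D k * (c ^ i * gw r D i)" by (simp add: mult_ac)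
      qed
      also have "\<dots> = gw r D k * (\<Sum>i<j. c ^ i * gw r D i)" by (simp add: sum_distrib_left)
      also have "\<dots> \<le> gw r D k * Z"
        unfolding Z_def using gw_pos[OF r(1) D, of k] t0 by (intro mult_left_mono sum_le_suminf sz) auto
      finally have "K * (\<Sum>i<j. c ^ i * gw r D (k + i)) \<le> K * (gw r D k * Z)" using K by (rule mult_left_mono)
      then show ?thesis using it[OF k, of j] 1 by (simp add: mult_ac)
    qed
    then show "\<exists>j0. \<forall>j\<ge>j0. v k \<le> H * e ^ k * (1/2) ^ j + K * Z * gw r D k" by blast
  qed
  then show ?thesis using K Z0 by (intro exI[of _ "K * Z"]) auto
qed

locale gauss_sft = sft +
  fixes f :: "(nat \<Rightarrow> nat) \<Rightarrow> complex" and r D0 K0 :: real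
  assumes fV: "f \<in> Vsp N A" and r: "0 < r" "r < 1" and D0: "0 < D0" and K0: "0 \<le> K0"
    and f_var: "\<And>k. var N A f k \<le> K0 * gw r D0 k"
begin

abbreviation "L \<equiv> Lop N A f"

\<comment> \<open>The factor \<open>2 * N\<close> compensates the number of words, see \<open>ratio_geometric\<close>.\<close>
definition "D = 2 * real N * D0"
definition \<rho> :: "nat list \<Rightarrow> real" where "\<rho> w = gw r D (length w)"
definition basis_fun :: "nat \<Rightarrow> (nat \<Rightarrow> nat) \<Rightarrow> complex" where
  "basis_fun j = (\<lambda>x. of_real (\<rho> (W j)) * ind (W j) x)"
text \<open>\<open>synth\<close> has a kernel, because the indicator of a word is the sum of the
  indicators of its one-letter extensions; \<open>coef\<close> is only a right inverse where its
  values lie in \<open>l1\<close>. Since \<open>app Bm\<close> is \<open>coef\<close> after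
  \<open>L\<close> after \<open>synth\<close> (\<open>app_Bm\<close>), it annihilates this
  kernel.\<close>

definition synth :: "(nat \<Rightarrow> complex) \<Rightarrow> (nat \<Rightarrow> nat) \<Rightarrow> complex" where
  "synth a x = (\<Sum>i. a i * basis_fun i x)"
definition coef :: "((nat \<Rightarrow> nat) \<Rightarrow> complex) \<Rightarrow> nat \<Rightarrow> complex" where
  "coef g i = sec g (W i) / of_real (\<rho> (W i))"
definition Bm :: "nat \<Rightarrow> nat \<Rightarrow> complex" where "Bm i j = coef (L (basis_fun j)) i"

lemma N_pos: "1 \<le> N"
proof -
  obtain x where "x \<in> S" using nonempty by blast
  then show ?thesis using S_letter[of x 0] by linarith
qed

lemma D_pos: "0 < D" using N_pos D0 by (simp add: D_def)
lemma \<rho>_pos: "0 < \<rho> w" unfolding \<rho>_def by (rule gw_pos[OF r(1) D_pos])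

lemma ratio_geometric: "real N ^ k * gw r D0 k / gw r D k = (1 / 2) ^ k"
  using N_pos D0 r by (simp add: gw_def D_def power_mult_distrib power_divide field_simps)

lemma \<rho>_bounded: obtains R where "R > 0" "\<And>w. \<rho> w \<le> R"
proof -
  obtain R where "R > 0" "\<And>m. gw r D m \<le> R * 1 ^ m"
    using superexpD[OF gw_superexp[OF r D_pos], of 1] by auto
  then show ?thesis by (intro that[of R]) (auto simp: \<rho>_def)
qed

lemma synth_summable:
  assumes "a \<in> l1" shows "summable (\<lambda>i. cmod (a i * basis_fun i x))"
proof -
  obtain R where R: "R > 0" "\<And>w. \<rho> w \<le> R" using \<rho>_bounded by blast
  have "cmod (a i * basis_fun i x) \<le> cmod (a i) * R" for i
    unfolding norm_mult basis_fun_def using R(2)[of "W i"] \<rho>_pos[of "W i"] R(1)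
    by (intro mult_left_mono) (auto simp: ind_def)
  moreover have "summable (\<lambda>i. cmod (a i) * R)" using assms by (intro summable_mult2) (simp add: l1_def)
  ultimately show ?thesis by (intro summable_comparison_test'[where N=0 and g="\<lambda>i. cmod (a i) * R" and f="\<lambda>i. cmod (a i * basis_fun i x)"]) auto
qed

lemma synth_sums: "a \<in> l1 \<Longrightarrow> (\<lambda>i. a i * basis_fun i x) sums synth a x"
  unfolding synth_def by (rule summable_sums[OF summable_norm_cancel[OF synth_summable]])

lemma ind_agree: "agree m x y \<Longrightarrow> length w \<le> m \<Longrightarrow> ind w x = ind w y"
  unfolding ind_def cyl_def agree_def by (auto simp: pref_eq_iff) (metis order_less_le_trans pref_eq_iff)+

lemma synth_Vsp:
  assumes a: "a \<in> l1" shows "synth a \<in> Vsp N A"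
proof -
  \<comment> \<open>Words of length at most \<open>m\<close> do not distinguish points agreeing in
    \<open>m\<close> letters, so the weights of longer words matter. A tail supremum is taken
    because \<open>gw r D\<close> may increase at first.\<close>
  define u where "u m = (SUP k\<in>{m..}. gw r D k)" for m
  obtain R where R: "R > 0" "\<And>m. gw r D m \<le> R * 1 ^ m" using superexpD[OF gw_superexp[OF r D_pos], of 1] by auto
  have bdd: "bdd_above (gw r D ` {m..})" for m using R by (auto simp: bdd_above_def)
  have le_u: "gw r D k \<le> u m" if "m \<le> k" for m k unfolding u_def using that by (intro cSUP_upper bdd) auto
  have u0: "0 \<le> u m" for m using le_u[of m m] gw_pos[OF r(1) D_pos, of m] by linarith
  have su: "superexp u" unfolding superexp_def
  proof (intro allI impI)
    fix e :: real assume e: "0 < e"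
    \<comment> \<open>A base at most \<open>1\<close> makes the powers decrease, which bounds the
      tail supremum by its first term.\<close>
    define e' where "e' = min e 1"
    have e': "0 < e'" "e' \<le> 1" "e' \<le> e" using e by (auto simp: e'_def)
    obtain K where K: "K > 0" "\<And>m. gw r D m \<le> K * e' ^ m" using superexpD[OF gw_superexp[OF r D_pos] e'(1)] by blast
    have "u m \<le> K * e ^ m" for m
      unfolding u_def
    proof (rule cSUP_least)
      fix k assume "k \<in> {m..}"
      then have "e' ^ k \<le> e' ^ m" using e' by (intro power_decreasing) auto
      also have "\<dots> \<le> e ^ m" using e' by (intro power_mono) auto
      finally have "K * e' ^ k \<le> K * e ^ m" using K(1) by simp
      then show "gw r D k \<le> K * e ^ m" using K(2)[of k] by linarith
    qed simp
    then show "\<exists>K. \<forall>m. u m \<le> K * e ^ m" by blast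
  qed
  show ?thesis
  proof (rule modulus_Vsp)
    show "superexp (\<lambda>m. n1 a * u m)" by (rule superexp_scale[OF su n1_nonneg[OF a]])
    show "synth a x = 0" if "x \<notin> S" for x
      using that by (simp add: synth_def basis_fun_def ind_def cyl_def)
    show "modulus (synth a) (\<lambda>m. n1 a * u m)" unfolding modulus_def
    proof (intro allI impI)
      fix m x y assume ag: "agree m x y"
      have dif: "(\<lambda>i. a i * basis_fun i x - a i * basis_fun i y) sums (synth a x - synth a y)"
        by (intro sums_diff synth_sums a)
      have le: "cmod (a i * basis_fun i x - a i * basis_fun i y) \<le> cmod (a i) * u m" for i
      proof -
        have "cmod (basis_fun i x - basis_fun i y) \<le> u m"
        proof (cases "length (W i) \<le> m")
          case True
          then show ?thesis using ind_agree[OF ag True] u0 by (simp add: basis_fun_def)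
        next
          case False
          have "cmod (basis_fun i x - basis_fun i y) \<le> \<rho> (W i)"
            using \<rho>_pos[of "W i"] by (auto simp: basis_fun_def ind_def)
          also have "\<dots> \<le> u m" unfolding \<rho>_def using False by (intro le_u) simp
          finally show ?thesis .
        qed
        then show ?thesis by (simp add: right_diff_distrib[symmetric] norm_mult mult_left_mono)
      qed
      have s: "summable (\<lambda>i. cmod (a i) * u m)" using a by (intro summable_mult2) (simp add: l1_def)
      have s2: "summable (\<lambda>i. cmod (a i * basis_fun i x - a i * basis_fun i y))"
        by (rule summable_comparison_test'[OF s, where N=0]) (use le in auto)
      have "cmod (synth a x - synth a y) \<le> (\<Sum>i. cmod (a i * basis_fun i x - a i * basis_fun i y))"
        using summable_norm[OF s2] sums_unique[OF dif] by simp
      also have "\<dots> \<le> (\<Sum>i. cmod (a i) * u m)" by (rule suminf_le[OF le s2 s])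
      also have "\<dots> = n1 a * u m" unfolding n1_def using a by (simp add: l1_def suminf_mult2)
      finally show "cmod (synth a x - synth a y) \<le> n1 a * u m" .
    qed
  qed
qed

lemma sec_lin: "sec (\<lambda>x. g x + h x) w = sec g w + sec h w" "sec (\<lambda>x. c * g x) w = c * sec g w" "sec (\<lambda>_. 0) w = 0"
  by (auto simp: sec_def algebra_simps)

lemma sec_telescope:
  assumes "x \<in> S" shows "(\<Sum>k\<le>m. sec g (pref k x)) = g (rep (pref m x))"
proof (induction m)
  case 0 then show ?case by (simp add: sec_def)
next
  case (Suc m)
  have "pref (Suc m) x \<noteq> []" by (metis length_pref list.size(3) nat.distinct(1))
  then show ?case using Suc by (simp add: sec_def butlast_pref)
qed

text \<open>Summed by word length, the expansion at \<open>x\<close> telescopes to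
  \<open>g (rep (pref m x))\<close>, and these values tend to \<open>g x\<close> by
  continuity.\<close>

lemma synth_coef:
  assumes g: "g \<in> Vsp N A" and l: "coef g \<in> l1"
  shows "synth (coef g) = g"
proof (rule ext)
  fix x
  show "synth (coef g) x = g x"
  proof (cases "x \<in> S")
    case False
    then have "g x = 0" using g by (simp add: Vsp_def)
    then show ?thesis using False by (simp add: synth_def basis_fun_def ind_def cyl_def)
  next
    case True
    define h where "h w = sec g w * ind w x" for w
    have e: "coef g i * basis_fun i x = h (W i)" for i
      using \<rho>_pos[of "W i"] by (simp add: coef_def basis_fun_def h_def)
    have "summable (\<lambda>i. cmod (h (W i)))" using synth_summable[OF l, of x] by (simp add: e)
    from words_sum_limit[OF this]
    have "(\<lambda>m. \<Sum>k\<le>m. \<Sum>w\<in>wlen k. h w) \<longlonglongrightarrow> synth (coef g) x" by (simp add: synth_def e)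
    moreover have "(\<Sum>w\<in>wlen k. h w) = sec g (pref k x)" for k
    proof -
      have "(\<Sum>w\<in>wlen k. h w) = (\<Sum>w\<in>wlen k. if w = pref k x then sec g (pref k x) else 0)"
        by (rule sum.cong[OF refl]) (simp add: h_def ind_wlen[OF True])
      then show ?thesis using pref_wlen[OF True, of k] finite_wlen by simp
    qed
    ultimately have "(\<lambda>m. g (rep (pref m x))) \<longlonglongrightarrow> synth (coef g) x" by (simp add: sec_telescope[OF True])
    moreover have "(\<lambda>m. g (rep (pref m x))) \<longlonglongrightarrow> g x"
    proof (rule rep_tendsto[OF g True])
      show "agree m (rep (pref m x)) x" for m
        unfolding agree_def using True rep_S[OF pref_words[OF True]] rep_pref_agree[OF True] by simp
    qed
    ultimately show ?thesis by (rule LIMSEQ_unique)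
  qed
qed

lemma Lop_synth_sums:
  assumes a: "a \<in> l1" shows "(\<lambda>j. a j * L (basis_fun j) y) sums L (synth a) y"
proof (cases "y \<in> S")
  case False
  then show ?thesis by (simp add: Lop_def)
next
  case True
  let ?P = "{z \<in> S. shift z = y}"
  have "(\<lambda>j. \<Sum>z\<in>?P. exp (f z) * (a j * basis_fun j z)) sums (\<Sum>z\<in>?P. exp (f z) * synth a z)"
    by (intro sums_sum sums_mult synth_sums a)
  then show ?thesis by (simp add: Lop_preimage[OF True] sum_distrib_left mult_ac)
qed

lemma app_Bm:
  assumes a: "a \<in> l1" shows "app Bm a = coef (L (synth a))"
proof (rule ext)
  fix i
  have "(\<lambda>j. a j * sec (L (basis_fun j)) w) sums sec (L (synth a)) w" for w
  proof (cases "w = []")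
    case True
    then show ?thesis using Lop_synth_sums[OF a] by (simp add: sec_def)
  next
    case False
    then show ?thesis
      using sums_diff[OF Lop_synth_sums[OF a, of "rep w"] Lop_synth_sums[OF a, of "rep (butlast w)"]]
      by (simp add: sec_def right_diff_distrib)
  qed
  then have "(\<lambda>j. a j * sec (L (basis_fun j)) (W i) / of_real (\<rho> (W i))) sums (sec (L (synth a)) (W i) / of_real (\<rho> (W i)))"
    by (rule sums_divide)
  then have "(\<lambda>j. Bm i j * a j) sums coef (L (synth a)) i"
    by (simp add: Bm_def coef_def mult.commute)
  then show "app Bm a i = coef (L (synth a)) i" by (simp add: app_def sums_iff)
qed

lemma coef_lin: "coef (\<lambda>x. g x + h x) = (\<lambda>i. coef g i + coef h i)" "coef (\<lambda>x. c * g x) = (\<lambda>i. c * coef g i)"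
  "coef (\<lambda>_. 0) = (\<lambda>_. 0)"
  by (auto simp: coef_def sec_lin add_divide_distrib)

end

context gauss_sft
begin

section \<open>Column norms of the matrix\<close>

lemma f_bounded: "\<exists>F\<ge>0. \<forall>x\<in>S. cmod (f x) \<le> F"
  by (rule modulus_bounded[OF Vsp_modulus(1)[OF fV]])

lemma var_f_nonneg: "0 \<le> var N A f k" by (rule modulus_nonneg[OF Vsp_modulus(1)[OF fV]])

lemma sec_bound:
  assumes "\<And>x. cmod (g x) \<le> G" shows "cmod (sec g u) \<le> 2 * G"
proof -
  have "0 \<le> G" using assms[of "\<lambda>_. 0"] norm_ge_zero order_trans by blast
  then show ?thesis
    using assms[of "rep u"] assms[of "rep (butlast u)"] assms[of "rep []"] norm_triangle_ineq4[of "g (rep u)" "g (rep (butlast u))"]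
    unfolding sec_def by (cases "u = []") auto
qed

text \<open>For a word of length \<open>k\<close>, \<open>sec\<close> compares two points agreeing
  in \<open>k - 1\<close> letters, and the inverse branches restore the missing letter; so
  variations at level \<open>k\<close> appear. The condition \<open>k \<ge> 2\<close> ensures a
  common first letter.\<close>

lemma sec_Lop_bound:
  assumes F: "\<And>x. x \<in> S \<Longrightarrow> cmod (f x) \<le> F" and g: "\<And>x. x \<in> S \<Longrightarrow> cmod (g x) \<le> G" and G: "0 \<le> G"
    and u: "u \<in> wlen k" "k \<ge> 2" and dg: "0 \<le> dg" "\<And>x y. agree k x y \<Longrightarrow> cmod (g x - g y) \<le> dg"
  shows "cmod (sec (L g) u) \<le> real N * exp F * (var N A f k * G + dg)"
proof -
  obtain k' where k: "k = Suc (Suc k')" using u(2) by (metis Suc_le_D numeral_2_eq_2 Suc_le_mono)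
  have w: "u \<in> words" "u \<noteq> []" using u(1) k by (auto simp: wlen_def)
  have ag: "agree (Suc k') (rep u) (rep (butlast u))"
    unfolding agree_def
  proof (intro conjI allI impI)
    show "rep u \<in> S" "rep (butlast u) \<in> S" using rep_S butlast_words w by auto
    fix i assume "i < Suc k'"
    then show "rep u i = rep (butlast u) i" using rep_butlast_agree[of u "Suc k'" i] u(1) k by simp
  qed
  have "cmod (L g (rep u) - L g (rep (butlast u))) \<le> real N * exp F * (var N A f k * G + dg)"
  proof (rule Lop_diff_bound[OF F g ag G var_f_nonneg dg(1)])
    fix x y assume "agree (Suc (Suc k')) x y"
    then show "cmod (f x - f y) \<le> var N A f k" "cmod (g x - g y) \<le> dg"
      using Vsp_modulus(1)[OF fV] dg(2) k by (auto simp: modulus_def)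
  qed
  then show ?thesis using w(2) by (simp add: sec_def)
qed

lemma sum_wlen_le:
  assumes "\<And>u. u \<in> wlen k \<Longrightarrow> h u \<le> c" "0 \<le> c"
  shows "(\<Sum>u\<in>wlen k. h u) \<le> real N ^ k * c"
proof -
  have "(\<Sum>u\<in>wlen k. h u) \<le> (\<Sum>u\<in>wlen k. c)" by (rule sum_mono[OF assms(1)])
  also have "\<dots> = real (card (wlen k)) * c" by simp
  also have "\<dots> \<le> real (N ^ k) * c" using card_wlen[of k] assms(2) by (intro mult_right_mono) auto
  finally show ?thesis by simp
qed

text \<open>There are at most \<open>N^k\<close> words of length \<open>k\<close>, and
  \<open>N^k * gw r D0 k / gw r D k = (1 / 2)^k\<close>. The lengths \<open>0\<close> and
  \<open>1\<close> are covered by the uniform bound on \<open>g\<close>.\<close>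

lemma coef_l1:
  assumes G: "\<And>x. cmod (g x) \<le> G" and Q: "0 \<le> Q" "\<And>k u. k \<ge> 2 \<Longrightarrow> u \<in> wlen k \<Longrightarrow> cmod (sec g u) \<le> Q * gw r D0 k"
  shows "coef g \<in> l1"
proof -
  have G0: "0 \<le> G" using G[of "\<lambda>_. 0"] norm_ge_zero order_trans by blast
  define h where "h u = cmod (sec g u) / \<rho> u" for u
  define b where "b k = (if k \<in> {..1} then real N ^ k * (2 * G / gw r D k) else 0) + Q * (1 / 2) ^ k" for k
  have D0k: "0 < gw r D k" "0 < gw r D0 k" for k using gw_pos[OF r(1)] D_pos D0 by auto
  have "summable (\<lambda>i. h (W i))"
  proof (rule words_summable(1)[where b=b])
    show "0 \<le> h w" for w using \<rho>_pos[of w] by (simp add: h_def)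
    show "summable b" unfolding b_def
      by (intro summable_add summable_If_finite_set summable_mult summable_geometric) auto
    fix k
    have b2: "0 \<le> Q * (1 / 2) ^ k" using Q by simp
    show "(\<Sum>w\<in>wlen k. h w) \<le> b k"
    proof (cases "k \<le> 1")
      case True
      have "(\<Sum>w\<in>wlen k. h w) \<le> real N ^ k * (2 * G / gw r D k)"
      proof (rule sum_wlen_le)
        fix u assume "u \<in> wlen k"
        then have "length u = k" by (simp add: wlen_def)
        moreover have "cmod (sec g u) \<le> 2 * G" by (rule sec_bound[OF G])
        ultimately show "h u \<le> 2 * G / gw r D k"
          unfolding h_def \<rho>_def using D0k[of k] by (simp add: divide_right_mono)
      qed (use G0 D0k[of k] in auto)
      then show ?thesis using True b2 by (simp add: b_def)
    next
      case False
      have "(\<Sum>w\<in>wlen k. h w) \<le> real N ^ k * (Q * gw r D0 k / gw r D k)"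
      proof (rule sum_wlen_le)
        fix u assume u: "u \<in> wlen k"
        then have "length u = k" by (simp add: wlen_def)
        then show "h u \<le> Q * gw r D0 k / gw r D k"
          unfolding h_def \<rho>_def using Q(2)[of k u] u False D0k[of k] by (simp add: divide_right_mono)
      qed (use Q D0k[of k] in auto)
      also have "\<dots> = Q * (1 / 2) ^ k" unfolding ratio_geometric[of k, symmetric] by simp
      finally show ?thesis using False by (simp add: b_def)
    qed
  qed
  moreover have "cmod (coef g i) = h (W i)" for i
    using \<rho>_pos[of "W i"] by (simp add: coef_def h_def norm_divide)
  ultimately show ?thesis by (simp add: l1_def)
qed

text \<open>A nonzero value requires a preimage of \<open>x\<close> in the cylinder of
  \<open>w\<close>, so \<open>x\<close> must begin with \<open>tl w\<close>.\<close>

lemma Lop_ind_support: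
  assumes "L (ind w) x \<noteq> 0" "k < length w" "x \<in> S"
  shows "pref k x = take k (tl w)"
proof -
  have "\<exists>y\<in>{y \<in> S. shift y = x}. exp (f y) * ind w y \<noteq> 0"
  proof (rule ccontr)
    assume "\<not> ?thesis"
    then have "(\<Sum>y\<in>{y \<in> S. shift y = x}. exp (f y) * ind w y) = 0" by (intro sum.neutral) auto
    then show False using assms(1) by (simp add: Lop_preimage[OF assms(3)])
  qed
  then obtain y where y: "shift y = x" "y \<in> cyl w" by (auto simp: ind_def split: if_splits)
  then have w: "pref (length w) y = w" by (simp add: cyl_def)
  show ?thesis
  proof (rule nth_equalityI)
    show "length (pref k x) = length (take k (tl w))" using assms(2) by simp
    fix i assume "i < length (pref k x)"
    then have i: "i < k" by simp
    have "x i = y (Suc i)" using y(1) by (auto simp: shift_def)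
    also have "\<dots> = pref (length w) y ! Suc i" using i assms(2) by (simp add: nth_pref)
    also have "\<dots> = w ! Suc i" using w by simp
    finally show "pref k x ! i = take k (tl w) ! i" using i assms(2) by (simp add: nth_pref nth_tl)
  qed
qed

text \<open>Let \<open>w\<close> have length \<open>m\<close>. Rows of length \<open>k < m\<close>
  see \<open>L (ind w)\<close> only near one prefix, so their total is bounded independently of
  \<open>N^k\<close> and enters with the factor \<open>gw m / gw k\<close>. For
  \<open>k \<ge> max m 2\<close> the indicator is constant at level \<open>k\<close>, only the
  variation of \<open>f\<close> contributes, and its Gaussian bound beats the number of words. The
  rows just below \<open>m\<close> dictate the rate \<open>r^(2 m)\<close>.\<close>

lemma Bm_columns:
  "\<exists>K\<ge>0. \<forall>j. (\<lambda>i. Bm i j) \<in> l1 \<and> n1 (\<lambda>i. Bm i j) \<le> K * r ^ (2 * length (W j))"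
proof -
  obtain F where F: "F \<ge> 0" "\<And>x. x \<in> S \<Longrightarrow> cmod (f x) \<le> F" using f_bounded by blast
  define C where "C = real N * exp F"
  have C0: "0 \<le> C" by (simp add: C_def)
  have D0k: "0 < gw r D k" "0 < gw r D0 k" for k using gw_pos[OF r(1)] D_pos D0 by auto
  \<comment> \<open>The first two summands bound values at words and at their parents, the last one
    is the uniform bound for lengths at most \<open>1\<close>.\<close>
  define C1 where "C1 = C + real N * C + real N * (2 * C)"
  have C1: "0 \<le> C1" using C0 by (simp add: C1_def)
  have ind1: "cmod (ind w x) \<le> 1" for w x by (simp add: ind_def)
  have LC: "cmod (L (ind w) x) \<le> C" for w x
  proof -
    have "cmod (L (ind w) x) \<le> real N * exp F * 1" by (rule Lop_bound) (use F ind1 in auto)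
    then show ?thesis by (simp add: C_def)
  qed
  \<comment> \<open>At each length \<open>k < length w\<close> a single word can contribute, namely
    \<open>take k (tl w)\<close>.\<close>
  have A1: "(\<Sum>u\<in>wlen k. cmod (L (ind w) (rep u))) \<le> C" if k: "k < length w" for k w
  proof -
    have "(\<Sum>u\<in>wlen k. cmod (L (ind w) (rep u))) \<le> (\<Sum>u\<in>wlen k. if u = take k (tl w) then C else 0)"
    proof (rule sum_mono)
      fix u assume "u \<in> wlen k"
      then have u: "u \<in> words" "length u = k" by (auto simp: wlen_def)
      show "cmod (L (ind w) (rep u)) \<le> (if u = take k (tl w) then C else 0)"
        using Lop_ind_support[of w "rep u" k] k rep_S[OF u(1)] pref_rep[OF u(1)] u(2) LC[of w "rep u"]
        by (cases "L (ind w) (rep u) = 0") (auto simp: C0)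
    qed
    also have "\<dots> \<le> C" using C0 finite_wlen by simp
    finally show ?thesis .
  qed
  have A: "(\<Sum>u\<in>wlen k. cmod (sec (L (ind w)) u)) \<le> C1" if k: "k < length w \<or> k \<le> 1" for k w
  proof (cases "k < length w")
    case True
    show ?thesis
    proof (cases k)
      case 0
      have "(\<Sum>u\<in>wlen k. cmod (sec (L (ind w)) u)) = (\<Sum>u\<in>wlen k. cmod (L (ind w) (rep u)))"
        by (rule sum.cong) (auto simp: 0 wlen_def sec_def)
      also have "\<dots> \<le> C" by (rule A1[OF True])
      also have "\<dots> \<le> C1" using C0 by (simp add: C1_def)
      finally show ?thesis .
    next
      case (Suc k')
      have "(\<Sum>u\<in>wlen k. cmod (sec (L (ind w)) u))
          \<le> (\<Sum>u\<in>wlen k. cmod (L (ind w) (rep u)) + cmod (L (ind w) (rep (butlast u))))"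
      proof (rule sum_mono)
        fix u assume "u \<in> wlen k"
        then have "u \<noteq> []" using Suc by (auto simp: wlen_def)
        then show "cmod (sec (L (ind w)) u) \<le> cmod (L (ind w) (rep u)) + cmod (L (ind w) (rep (butlast u)))"
          by (simp add: sec_def norm_triangle_ineq4)
      qed
      also have "\<dots> = (\<Sum>u\<in>wlen k. cmod (L (ind w) (rep u))) + (\<Sum>u\<in>wlen k. cmod (L (ind w) (rep (butlast u))))"
        by (rule sum.distrib)
      also have "\<dots> \<le> C + real N * (\<Sum>u\<in>wlen k'. cmod (L (ind w) (rep u)))"
        using A1[OF True] sum_butlast_le[of "\<lambda>u. cmod (L (ind w) (rep u))" k'] unfolding Suc by (intro add_mono) auto
      also have "\<dots> \<le> C + real N * C" using A1[of k' w] True Suc by (intro add_left_mono mult_left_mono) auto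
      also have "\<dots> \<le> C1" using C0 by (simp add: C1_def)
      finally show ?thesis .
    qed
  next
    case False
    then have k1: "k \<le> 1" using k by simp
    have "(\<Sum>u\<in>wlen k. cmod (sec (L (ind w)) u)) \<le> real N ^ k * (2 * C)"
      by (rule sum_wlen_le) (use sec_bound[OF LC] C0 in auto)
    also have "\<dots> \<le> real N * (2 * C)"
    proof (rule mult_right_mono)
      have "real N ^ k \<le> real N ^ 1" using N_pos k1 by (intro power_increasing) auto
      then show "real N ^ k \<le> real N" by simp
    qed (use C0 in simp)
    also have "\<dots> \<le> C1" using C0 by (simp add: C1_def)
    finally show ?thesis .
  qed
  have Bb: "(\<Sum>u\<in>wlen k. cmod (sec (L (ind w)) u)) \<le> real N ^ k * (C * K0 * gw r D0 k)"
    if k: "k \<ge> length w" "k \<ge> 2" for k w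
  proof (rule sum_wlen_le)
    fix u assume u: "u \<in> wlen k"
    have "cmod (sec (L (ind w)) u) \<le> real N * exp F * (var N A f k * 1 + 0)"
      by (rule sec_Lop_bound[OF F(2) ind1 _ u k(2)]) (use ind_agree k(1) in auto)
    also have "\<dots> \<le> C * K0 * gw r D0 k"
      using f_var[of k] C0 unfolding C_def by (simp add: mult_left_mono mult.assoc)
    finally show "cmod (sec (L (ind w)) u) \<le> C * K0 * gw r D0 k" .
  qed (use C0 K0 D0k[of k] in auto)
  obtain K' where K': "K' \<ge> 0" "\<And>m. (\<Sum>k<m. gw r D m / gw r D k) \<le> K' * r ^ (2 * m)"
    "\<And>m. gw r D m \<le> K' * r ^ (2 * m)"
    using gw_ratio_sum_bounded[OF r D_pos] by blast
  \<comment> \<open>Collects the lengths \<open>0\<close> and \<open>1\<close> and the geometric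
    series, whose sum is \<open>2\<close>.\<close>
  define E where "E = C1 * (1 + 1 / gw r D 1) + 2 * (C * K0)"
  have E0: "0 \<le> E" using C1 C0 K0 D0k[of 1] by (simp add: E_def)
  define K where "K = C1 * K' + K' * E"
  have main: "(\<lambda>i. Bm i j) \<in> l1 \<and> n1 (\<lambda>i. Bm i j) \<le> K * r ^ (2 * length (W j))" for j
  proof -
    define w where "w = W j"
    define m where "m = length w"
    define h where "h u = gw r D m * (cmod (sec (L (ind w)) u) / \<rho> u)" for u
    define c where "c k = (if k \<in> {..<m} \<union> {..1} then C1 / gw r D k else 0)" for k
    define b where "b k = gw r D m * (c k + C * K0 * (1 / 2) ^ k)" for k
    have eB: "cmod (Bm i j) = h (W i)" for i
      using \<rho>_pos[of "W i"] D0k[of m]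
      by (simp add: Bm_def coef_def basis_fun_def Lop_lin sec_lin norm_mult norm_divide h_def w_def[symmetric] \<rho>_def[of w] m_def)
    have c_sums: "c sums (\<Sum>k\<in>{..<m} \<union> {..1}. C1 / gw r D k)"
      unfolding c_def by (rule sums_If_finite_set) simp
    have b_sums: "b sums (gw r D m * ((\<Sum>k\<in>{..<m} \<union> {..1}. C1 / gw r D k) + C * K0 * 2))"
    proof -
      have "(\<lambda>k. (1 / 2 :: real) ^ k) sums (1 / (1 - 1 / 2))" by (rule geometric_sums) simp
      then have "(\<lambda>k. (1 / 2 :: real) ^ k) sums 2" by simp
      then show ?thesis unfolding b_def by (intro sums_mult sums_add c_sums)
    qed
    have h0: "0 \<le> h u" for u using \<rho>_pos[of u] D0k[of m] by (simp add: h_def)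
    have c0: "0 \<le> c k" for k using C1 D0k[of k] by (simp add: c_def)
    have hb: "(\<Sum>u\<in>wlen k. h u) \<le> b k" for k
    proof -
      have "(\<Sum>u\<in>wlen k. cmod (sec (L (ind w)) u) / gw r D k) \<le> c k + C * K0 * (1 / 2) ^ k"
      proof (cases "k < length w \<or> k \<le> 1")
        case True
        have "(\<Sum>u\<in>wlen k. cmod (sec (L (ind w)) u) / gw r D k) \<le> C1 / gw r D k"
          unfolding sum_divide_distrib[symmetric] using A[OF True] D0k[of k] by (intro divide_right_mono) auto
        also have "\<dots> = c k" using True by (auto simp: c_def m_def)
        finally show ?thesis using C0 K0 by (simp add: add_increasing2)
      next
        case False
        have "(\<Sum>u\<in>wlen k. cmod (sec (L (ind w)) u) / gw r D k) \<le> real N ^ k * (C * K0 * gw r D0 k) / gw r D k"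
          unfolding sum_divide_distrib[symmetric] using Bb[of w k] False D0k[of k] by (intro divide_right_mono) auto
        also have "\<dots> = C * K0 * (1 / 2) ^ k" unfolding ratio_geometric[of k, symmetric] by simp
        finally show ?thesis using c0[of k] by simp
      qed
      moreover have "(\<Sum>u\<in>wlen k. h u) = gw r D m * (\<Sum>u\<in>wlen k. cmod (sec (L (ind w)) u) / gw r D k)"
        unfolding sum_distrib_left by (rule sum.cong[OF refl]) (auto simp: h_def \<rho>_def wlen_def)
      ultimately show ?thesis unfolding b_def using D0k[of m] by (simp add: mult_left_mono)
    qed
    note ws = words_summable[OF h0 hb sums_summable[OF b_sums]]
    have "n1 (\<lambda>i. Bm i j) \<le> suminf b" unfolding n1_def eB using ws(2) .
    also have "\<dots> = gw r D m * ((\<Sum>k\<in>{..<m} \<union> {..1}. C1 / gw r D k) + C * K0 * 2)"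
      using b_sums by (simp add: sums_iff)
    also have "\<dots> \<le> gw r D m * (((\<Sum>k<m. C1 / gw r D k) + (\<Sum>k\<le>1. C1 / gw r D k)) + C * K0 * 2)"
    proof -
      have nn: "0 \<le> C1 / gw r D k" for k using C1 D0k[of k] by simp
      have "(\<Sum>k\<in>{..<m} \<union> {..1}. C1 / gw r D k) \<le> (\<Sum>k<m. C1 / gw r D k) + (\<Sum>k\<le>1. C1 / gw r D k)"
        using sum.union_inter[of "{..<m}" "{..1}" "\<lambda>k. C1 / gw r D k"] sum_nonneg[of "{..<m} \<inter> {..1}" "\<lambda>k. C1 / gw r D k"] nn
        by simp
      then show ?thesis using D0k[of m] by (intro mult_left_mono add_right_mono) auto
    qed
    also have "\<dots> = C1 * (\<Sum>k<m. gw r D m / gw r D k) + gw r D m * E"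
      by (simp add: E_def sum_distrib_left algebra_simps)
    also have "\<dots> \<le> C1 * (K' * r ^ (2 * m)) + K' * r ^ (2 * m) * E"
      using C1 E0 K' by (intro add_mono mult_left_mono mult_right_mono) auto
    also have "\<dots> = K * r ^ (2 * m)" by (simp add: K_def algebra_simps)
    finally have "n1 (\<lambda>i. Bm i j) \<le> K * r ^ (2 * length (W j))" by (simp add: m_def w_def)
    moreover have "(\<lambda>i. Bm i j) \<in> l1" using ws(1) by (simp add: l1_def eB)
    ultimately show ?thesis by blast
  qed
  have "0 \<le> K" using C1 K'(1) E0 by (simp add: K_def)
  then show ?thesis using main by blast
qed

lemma Bm_pmat:
  assumes p: "p > 0" and s: "summable (\<lambda>k. real (card (wlen k)) * (r ^ (2 * k)) powr p)"
  shows "pmat p Bm"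
proof -
  obtain K where K: "K \<ge> 0" "\<And>j. (\<lambda>i. Bm i j) \<in> l1" "\<And>j. n1 (\<lambda>i. Bm i j) \<le> K * r ^ (2 * length (W j))"
    using Bm_columns by blast
  define h where "h w = (K * r ^ (2 * length w)) powr p" for w :: "nat list"
  have "summable (\<lambda>j. h (W j))"
  proof (rule words_summable(1))
    show "summable (\<lambda>k. K powr p * (real (card (wlen k)) * (r ^ (2 * k)) powr p))" by (rule summable_mult[OF s])
    fix k
    have "(\<Sum>w\<in>wlen k. h w) = (\<Sum>w\<in>wlen k. (K * r ^ (2 * k)) powr p)"
      by (rule sum.cong) (auto simp: h_def wlen_def)
    also have "\<dots> = K powr p * (real (card (wlen k)) * (r ^ (2 * k)) powr p)"
      using K(1) r by (simp add: powr_mult)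
    finally show "(\<Sum>w\<in>wlen k. h w) \<le> K powr p * (real (card (wlen k)) * (r ^ (2 * k)) powr p)" by simp
  qed (simp add: h_def)
  moreover have "n1 (\<lambda>i. Bm i j) powr p \<le> h (W j)" for j
    unfolding h_def using K p by (intro powr_mono2 n1_nonneg) auto
  ultimately have "summable (\<lambda>j. n1 (\<lambda>i. Bm i j) powr p)"
    by (intro summable_comparison_test'[where N=0 and g="\<lambda>j. h (W j)" and f="\<lambda>j. n1 (\<lambda>i. Bm i j) powr p"]) auto
  then show ?thesis using K(2) by (simp add: pmat_def)
qed

section \<open>Generalised eigenfunctions and equality of multiplicities\<close>

lemma Bm_l1_matrix: obtains M where "l1_matrix Bm M"
proof -
  obtain K where K: "K \<ge> 0" "\<And>j. (\<lambda>i. Bm i j) \<in> l1" "\<And>j. n1 (\<lambda>i. Bm i j) \<le> K * r ^ (2 * length (W j))"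
    using Bm_columns by blast
  have "n1 (\<lambda>i. Bm i j) \<le> K" for j
  proof -
    have "K * r ^ (2 * length (W j)) \<le> K * 1" using K(1) r by (intro mult_left_mono power_le_one) auto
    then show ?thesis using K(3)[of j] by simp
  qed
  then have "l1_matrix Bm K" using K(2) by unfold_locales
  then show ?thesis by (rule that)
qed

text \<open>Induction on the order of nilpotency. With \<open>h = L g - \<mu> g\<close> already of
  Gaussian decay, \<open>\<mu> g = L g - h\<close>, and since \<open>L\<close> gains one letter, the
  variation of \<open>g\<close> at level \<open>k\<close> is bounded by that at level
  \<open>k + 1\<close> plus a Gaussian term. \<open>superexp_bootstrap\<close> then applies.\<close>

lemma gen_eigenfunction_decay:
  assumes \<mu>: "\<mu> \<noteq> 0" and g: "g \<in> gen_ker L (Vsp N A) \<mu>"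
  shows "\<exists>Q\<ge>0. \<forall>k\<ge>1. var N A g k \<le> Q * gw r D0 k"
proof -
  obtain n where "g \<in> Vsp N A" "(eig_shift L \<mu> ^^ n) g = (\<lambda>_. 0)" using g by (auto simp: gen_ker_def)
  then show ?thesis
  proof (induction n arbitrary: g)
    case 0
    have "var N A g k = 0" for k
    proof -
      obtain x where "agree k x x" using nonempty by (auto simp: agree_def)
      then have "{cmod (g x - g y) | x y. agree k x y} = {0}" using 0 by auto
      then show ?thesis by (simp add: var_eq)
    qed
    then show ?case by (intro exI[of _ 0]) auto
  next
    case (Suc n)
    let ?h = "eig_shift L \<mu> g"
    have gV: "g \<in> Vsp N A" by fact
    have hV: "?h \<in> Vsp N A"
      using eig_shift_lin(2)[OF Vsp_lin_on[OF fV], of \<mu>] Lop_Vsp[OF fV] gV by blast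
    have "(eig_shift L \<mu> ^^ n) ?h = (\<lambda>_. 0)" using Suc.prems(2) by (simp add: funpow_swap1)
    then obtain Q where Q: "Q \<ge> 0" "\<And>k. k \<ge> 1 \<Longrightarrow> var N A ?h k \<le> Q * gw r D0 k"
      using Suc.IH[OF hV] by blast
    obtain F where F: "F \<ge> 0" "\<And>x. x \<in> S \<Longrightarrow> cmod (f x) \<le> F" using f_bounded by blast
    obtain G where G: "G \<ge> 0" "\<And>x. x \<in> S \<Longrightarrow> cmod (g x) \<le> G"
      using modulus_bounded[OF Vsp_modulus(1)[OF gV]] by blast
    define C where "C = real N * exp F"
    have C0: "0 \<le> C" by (simp add: C_def)
    have D0k: "0 < gw r D0 k" for k using gw_pos[OF r(1) D0] .
    note mg = Vsp_modulus[OF gV] and mh = Vsp_modulus[OF hV]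
    have vg: "0 \<le> var N A g k" for k by (rule modulus_nonneg[OF mg(1)])
    define K where "K = (C * G * (K0 * D0) + Q) / cmod \<mu>"
    have K: "0 \<le> K" using C0 G Q K0 D0 by (simp add: K_def)
    have rec: "var N A g k \<le> C / cmod \<mu> * var N A g (Suc k) + K * gw r D0 k" if k: "k \<ge> 1" for k
      unfolding var_eq[of g k]
    proof (rule cSup_least)
      obtain x where "agree k x x" using nonempty by (auto simp: agree_def)
      then show "{cmod (g x - g y) | x y. agree k x y} \<noteq> {}" by blast
      fix z assume "z \<in> {cmod (g x - g y) | x y. agree k x y}"
      then obtain x y where xy: "z = cmod (g x - g y)" "agree k x y" by blast
      obtain k' where k': "k = Suc k'" using k by (cases k) auto
      have "cmod (L g x - L g y) \<le> C * (var N A f (Suc k) * G + var N A g (Suc k))"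
        unfolding C_def
        by (rule Lop_diff_bound[OF F(2) G(2) xy(2)[unfolded k'] G(1) var_f_nonneg vg])
           (use Vsp_modulus(1)[OF fV] mg(1) k' in \<open>auto simp: modulus_def\<close>)
      moreover have "cmod (?h x - ?h y) \<le> Q * gw r D0 k"
        using mh(1) xy(2) Q(2)[OF k] unfolding modulus_def by (meson order_trans)
      moreover have "cmod \<mu> * z = cmod ((L g x - L g y) - (?h x - ?h y))"
        unfolding xy(1) norm_mult[symmetric] by (rule arg_cong[of _ _ cmod]) (simp add: eig_shift_apply[of _ _ g] algebra_simps)
      ultimately have "cmod \<mu> * z \<le> C * (var N A f (Suc k) * G + var N A g (Suc k)) + Q * gw r D0 k"
        using norm_triangle_ineq4[of "L g x - L g y" "?h x - ?h y"] by linarith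
      moreover have "var N A f (Suc k) \<le> K0 * D0 * gw r D0 k"
      proof -
        have "gw r D0 (Suc k) \<le> D0 * gw r D0 k"
        proof -
          have "D0 * r ^ (2 * k + 1) * gw r D0 k \<le> D0 * 1 * gw r D0 k"
            using r D0 D0k[of k] by (intro mult_right_mono mult_left_mono power_le_one) auto
          then show ?thesis by (simp add: gw_Suc)
        qed
        then have "K0 * gw r D0 (Suc k) \<le> K0 * (D0 * gw r D0 k)" using K0 by (rule mult_left_mono)
        then show ?thesis using f_var[of "Suc k"] by simp
      qed
      then have "C * (var N A f (Suc k) * G) \<le> C * (K0 * D0 * gw r D0 k * G)"
        using C0 G by (intro mult_left_mono mult_right_mono) auto
      ultimately have "cmod \<mu> * z \<le> C * var N A g (Suc k) + (C * G * (K0 * D0) + Q) * gw r D0 k"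
        by (simp add: algebra_simps)
      then have "z \<le> (C * var N A g (Suc k) + (C * G * (K0 * D0) + Q) * gw r D0 k) / cmod \<mu>"
        using \<mu> by (simp add: field_simps)
      moreover have "(a * b + c * d) / m = a / m * b + c / m * d" for a b c d m :: real
        by (simp add: add_divide_distrib)
      ultimately show "z \<le> C / cmod \<mu> * var N A g (Suc k) + K * gw r D0 k"
        unfolding K_def by (simp only:)
    qed
    show ?case
      by (rule superexp_bootstrap[OF mg(2) vg r D0 _ K rec]) (use C0 in auto)
  qed
qed

text \<open>The direct bound on \<open>sec g\<close> at length \<open>k\<close> is a variation at
  level \<open>k - 1\<close>, too large by a factor of order \<open>r^(-2 k)\<close>. Applying
  \<open>L\<close> first recovers the missing letter, which is why \<open>alg_mult_eq\<close> uses
  \<open>coef\<close> after \<open>L\<close> and not \<open>coef\<close> alone.\<close>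

lemma coef_Lop_l1:
  assumes \<mu>: "\<mu> \<noteq> 0" and g: "g \<in> gen_ker L (Vsp N A) \<mu>"
  shows "coef (L g) \<in> l1"
proof -
  have gV: "g \<in> Vsp N A" using g by (simp add: gen_ker_def)
  obtain F where F: "F \<ge> 0" "\<And>x. x \<in> S \<Longrightarrow> cmod (f x) \<le> F" using f_bounded by blast
  obtain G where G: "G \<ge> 0" "\<And>x. x \<in> S \<Longrightarrow> cmod (g x) \<le> G"
    using modulus_bounded[OF Vsp_modulus(1)[OF gV]] by blast
  obtain Q where Q: "Q \<ge> 0" "\<And>k. k \<ge> 1 \<Longrightarrow> var N A g k \<le> Q * gw r D0 k"
    using gen_eigenfunction_decay[OF \<mu> g] by blast
  show ?thesis
  proof (rule coef_l1[where Q="real N * exp F * (K0 * G + Q)"])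
    show "cmod (L g x) \<le> real N * exp F * G" for x by (rule Lop_bound[OF F(2) G(2) G(1)])
    show "0 \<le> real N * exp F * (K0 * G + Q)" using K0 G Q by simp
    fix k u assume k: "(2::nat) \<le> k" and u: "u \<in> wlen k"
    have "cmod (sec (L g) u) \<le> real N * exp F * (var N A f k * G + var N A g k)"
      by (rule sec_Lop_bound[OF F(2) G(2) G(1) u k modulus_nonneg[OF Vsp_modulus(1)[OF gV]]])
         (use Vsp_modulus(1)[OF gV] in \<open>auto simp: modulus_def\<close>)
    also have "\<dots> \<le> real N * exp F * (K0 * gw r D0 k * G + Q * gw r D0 k)"
      using f_var[of k] Q(2)[of k] k G by (intro mult_left_mono add_mono mult_right_mono) auto
    finally show "cmod (sec (L g) u) \<le> real N * exp F * (K0 * G + Q) * gw r D0 k" by (simp add: algebra_simps)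
  qed
qed

lemma synth_lin_on: "lin_on l1 synth"
  unfolding lin_on_def
proof (intro conjI ballI allI)
  fix a b :: "nat \<Rightarrow> complex" and c assume a: "a \<in> l1"
  show "(\<lambda>i. c * a i) \<in> l1" by (rule l1_scale[OF a])
  have "(\<lambda>i. c * a i * basis_fun i x) sums (c * synth a x)" for x
    using sums_mult[OF synth_sums[OF a], of c] by (simp add: mult.assoc)
  then show "synth (\<lambda>i. c * a i) = (\<lambda>x. c * synth a x)"
    unfolding synth_def by (auto simp: sums_iff fun_eq_iff)
  assume b: "b \<in> l1"
  show "(\<lambda>i. a i + b i) \<in> l1" by (rule l1_add(1)[OF a b])
  have "(\<lambda>i. (a i + b i) * basis_fun i x) sums (synth a x + synth b x)" for x
    using sums_add[OF synth_sums[OF a] synth_sums[OF b], of x x] by (simp add: distrib_right)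
  then show "synth (\<lambda>i. a i + b i) = (\<lambda>x. synth a x + synth b x)"
    unfolding synth_def by (auto simp: sums_iff fun_eq_iff)
qed (rule l1_zero)

text \<open>\<open>synth\<close> maps the generalised eigenspace of the matrix to that of the
  operator, and \<open>U\<close>, which is \<open>coef\<close> after \<open>L\<close>, maps back.
  Both are injective by \<open>gen_ker_null\<close>: a vector killed by \<open>synth\<close> is
  killed by \<open>app Bm\<close>, and one killed by \<open>U\<close> is killed by
  \<open>L\<close>.\<close>

lemma alg_mult_eq:
  assumes \<mu>: "\<mu> \<noteq> 0" and basis: "has_basis (gen_ker (app Bm) l1 \<mu>) c"
  shows "alg_mult N A f \<mu> = enat c"
proof -
  obtain M where "l1_matrix Bm M" using Bm_l1_matrix .
  then interpret B: l1_matrix Bm M .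
  let ?E = "gen_ker (app Bm) l1 \<mu>" and ?V = "gen_ker L (Vsp N A) \<mu>"
  note VL = Vsp_lin_on[OF fV]
  have LV: "L ` Vsp N A \<subseteq> Vsp N A" using Lop_Vsp[OF fV] by blast
  have VV: "g \<in> Vsp N A" if "g \<in> ?V" for g using that by (simp add: gen_ker_def)
  have comm: "L (synth a) = synth (app Bm a)" if a: "a \<in> l1" for a
    using synth_coef[OF Lop_Vsp[OF fV synth_Vsp[OF a]]] B.app_l1[OF a] by (simp add: app_Bm[OF a])
  have T: "synth a \<in> ?V" if a: "a \<in> ?E" for a
    by (rule gen_ker_intertwine[OF synth_Vsp B.app_l1 synth_lin_on B.app_lin(1) comm a])
  have T0: "a = (\<lambda>_. 0)" if a: "a \<in> ?E" "synth a = (\<lambda>_. 0)" for a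
  proof -
    have al: "a \<in> l1" using a(1) by (simp add: gen_ker_def)
    have "app Bm a = (\<lambda>_. 0)" unfolding app_Bm[OF al] a(2) by (simp add: Lop_lin coef_lin)
    then show ?thesis
      by (rule gen_ker_null[OF a(1) _ _ \<mu> B.app_scale[OF al]]) (simp add: lin_onD(2)[OF B.app_lin(1)])
  qed
  have Lg: "L g \<in> ?V" if g: "g \<in> ?V" for g
    by (rule gen_ker_intertwine[OF Lop_Vsp[OF fV] Lop_Vsp[OF fV] VL VL refl g])
  define U where "U g = coef (L g)" for g
  have Ul1: "U g \<in> l1" if "g \<in> ?V" for g unfolding U_def by (rule coef_Lop_l1[OF \<mu> that])
  have sU: "synth (U g) = L g" if g: "g \<in> ?V" for g
    unfolding U_def by (rule synth_coef[OF Lop_Vsp[OF fV VV[OF g]] coef_Lop_l1[OF \<mu> g]])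
  have Ulin: "lin_on (Vsp N A) U"
    using VL unfolding lin_on_def U_def by (simp add: coef_lin)
  have UV: "lin_on ?V U" by (rule gen_ker_lin[OF VL LV Ulin])
  have UT: "U g \<in> ?E" if g: "g \<in> ?V" for g
  proof (rule gen_ker_intertwine[where E="?V" and T=L and U=U and T'="app Bm" and F=l1])
    show "U x \<in> l1" if "x \<in> ?V" for x by (rule Ul1[OF that])
    show "L x \<in> ?V" if "x \<in> ?V" for x by (rule Lg[OF that])
    show "lin_on ?V U" by (rule UV)
    show "lin_on ?V L" by (rule gen_ker_lin[OF VL LV VL])
    show "app Bm (U x) = U (L x)" if "x \<in> ?V" for x
      unfolding app_Bm[OF Ul1[OF that]] sU[OF that] by (simp add: U_def)
    show "g \<in> gen_ker L ?V \<mu>" using g by (auto simp: gen_ker_def)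
  qed
  have U0: "g = (\<lambda>_. 0)" if g: "g \<in> ?V" "U g = (\<lambda>_. 0)" for g
  proof -
    have "L g = (\<lambda>_. 0)" unfolding sU[OF g(1), symmetric] g(2) by (rule lin_onD(2)[OF synth_lin_on])
    then show ?thesis by (rule gen_ker_null[OF g(1) _ Lop_lin(3) \<mu> Lop_lin(2)])
  qed
  have "(SUP S\<in>{S. S \<subseteq> ?V \<and> lindep S}. enat (card S)) = enat c"
  proof (rule has_basis_transfer[OF basis])
    show "lin_on ?E synth" by (rule gen_ker_lin[OF B.app_lin synth_lin_on])
    show "synth ` ?E \<subseteq> ?V" using T by blast
    show "lin_on ?V U" by (rule UV)
    show "U ` ?V \<subseteq> ?E" using UT by blast
  qed (fact T0 U0)+
  moreover have "?V = gen_eigenspace N A f \<mu>"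
    by (simp add: gen_ker_def gen_eigenspace_def eig_shift_def)
  moreover have "lindep = lin_indep_fun" by (simp add: fun_eq_iff lindep_def lin_indep_fun_def)
  ultimately show ?thesis unfolding alg_mult_def by simp
qed

end

section \<open>Traces and periodic points\<close>

context sft
begin

lemma sum_ind_children:
  assumes y: "y \<in> S" and u: "u \<in> wlen m"
  shows "(\<Sum>w\<in>{w \<in> wlen (Suc m). butlast w = u}. ind w y) = ind u y"
proof -
  have fin: "finite {w \<in> wlen (Suc m). butlast w = u}" using finite_wlen by simp
  have "(\<Sum>w\<in>{w \<in> wlen (Suc m). butlast w = u}. ind w y)
      = (\<Sum>w\<in>{w \<in> wlen (Suc m). butlast w = u}. if w = pref (Suc m) y then 1 else 0)"
    by (rule sum.cong[OF refl]) (auto simp: ind_wlen[OF y])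
  also have "\<dots> = (if pref (Suc m) y \<in> {w \<in> wlen (Suc m). butlast w = u} then 1 else 0)"
    using fin by (simp only: sum.delta)
  also have "\<dots> = (if u = pref m y then 1 else 0)"
    using pref_wlen[OF y] by (auto simp: butlast_pref)
  also have "\<dots> = ind u y" by (simp add: ind_wlen[OF y u])
  finally show ?thesis .
qed

text \<open>The trace of the compression of the \<open>q\<close>-th iterate to functions constant on
  cylinders of length \<open>m\<close>, with values sampled at the representatives.\<close>

definition Ttr :: "((nat \<Rightarrow> nat) \<Rightarrow> complex) \<Rightarrow> nat \<Rightarrow> nat \<Rightarrow> complex" where
  "Ttr f q m = (\<Sum>w\<in>wlen m. (Lop N A f ^^ q) (ind w) (rep w))"

text \<open>The terms subtracted at level \<open>Suc m\<close> are grouped by the parent word. The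
  indicators of the extensions add up to that of the parent, so each group is the parent's term at
  level \<open>m\<close> and the sum telescopes.\<close>

lemma sum_sec_trace:
  "(\<Sum>k\<le>m. \<Sum>w\<in>wlen k. sec ((Lop N A f ^^ q) (ind w)) w) = Ttr f q m"
proof (induction m)
  case 0
  have "(\<Sum>w\<in>wlen 0. sec ((Lop N A f ^^ q) (ind w)) w) = Ttr f q 0"
    unfolding Ttr_def by (rule sum.cong[OF refl]) (auto simp: sec_def wlen_def)
  then show ?case by simp
next
  case (Suc m)
  let ?g = "\<lambda>w. (Lop N A f ^^ q) (ind w)"
  have "(\<Sum>w\<in>wlen (Suc m). ?g w (rep (butlast w)))
      = (\<Sum>u\<in>wlen m. \<Sum>w\<in>{w \<in> wlen (Suc m). butlast w = u}. ?g w (rep (butlast w)))"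
    by (rule sum.group[symmetric]) (use finite_wlen butlast_wlen in auto)
  also have "\<dots> = (\<Sum>u\<in>wlen m. ?g u (rep u))"
  proof (rule sum.cong[OF refl])
    fix u assume u: "u \<in> wlen m"
    then have ru: "rep u \<in> S" using rep_S by (simp add: wlen_def)
    let ?C = "{w \<in> wlen (Suc m). butlast w = u}" and ?Q = "{y \<in> S. (shift ^^ q) y = rep u}"
    have "(\<Sum>w\<in>?C. ?g w (rep (butlast w))) = (\<Sum>w\<in>?C. \<Sum>y\<in>?Q. exp (birk f q y) * ind w y)"
      by (rule sum.cong[OF refl]) (auto simp: Lop_pow[OF ru])
    also have "\<dots> = (\<Sum>y\<in>?Q. \<Sum>w\<in>?C. exp (birk f q y) * ind w y)" by (rule sum.swap)
    also have "\<dots> = (\<Sum>y\<in>?Q. exp (birk f q y) * ind u y)"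
      unfolding sum_distrib_left[symmetric] by (rule sum.cong[OF refl]) (use sum_ind_children u in auto)
    also have "\<dots> = ?g u (rep u)" by (rule Lop_pow[OF ru, symmetric])
    finally show "(\<Sum>w\<in>?C. ?g w (rep (butlast w))) = ?g u (rep u)" .
  qed
  finally have e: "(\<Sum>w\<in>wlen (Suc m). ?g w (rep (butlast w))) = Ttr f q m" by (simp add: Ttr_def)
  have "(\<Sum>w\<in>wlen (Suc m). sec (?g w) w) = (\<Sum>w\<in>wlen (Suc m). ?g w (rep w) - ?g w (rep (butlast w)))"
    by (rule sum.cong[OF refl]) (auto simp: sec_def wlen_def)
  also have "\<dots> = Ttr f q (Suc m) - Ttr f q m" by (simp add: sum_subtractf e Ttr_def)
  finally show ?case using Suc by simp
qed

lemma Ttr_eq: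
  "Ttr f q m = (\<Sum>y\<in>{y \<in> S. (shift ^^ q) y = rep (pref m y)}. exp (birk f q y))"
proof -
  let ?Q = "\<lambda>w. {y \<in> S. (shift ^^ q) y = rep w \<and> pref m y = w}"
  have "(Lop N A f ^^ q) (ind w) (rep w) = (\<Sum>y\<in>?Q w. exp (birk f q y))" if w: "w \<in> wlen m" for w
  proof -
    have rw: "rep w \<in> S" and l: "length w = m" using w rep_S by (auto simp: wlen_def)
    have "(\<Sum>y\<in>{y \<in> S. (shift ^^ q) y = rep w}. exp (birk f q y) * ind w y)
        = (\<Sum>y\<in>?Q w. exp (birk f q y) * ind w y)"
      by (rule sum.mono_neutral_right[OF finite_preimage_pow[OF rw]]) (auto simp: ind_def cyl_def l)
    also have "\<dots> = (\<Sum>y\<in>?Q w. exp (birk f q y))"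
      by (rule sum.cong[OF refl]) (auto simp: ind_def cyl_def l)
    finally show ?thesis by (simp add: Lop_pow[OF rw])
  qed
  then have "Ttr f q m = (\<Sum>w\<in>wlen m. \<Sum>y\<in>?Q w. exp (birk f q y))" by (simp add: Ttr_def)
  also have "\<dots> = (\<Sum>y\<in>(\<Union>w\<in>wlen m. ?Q w). exp (birk f q y))"
  proof (rule sum.UNION_disjoint[symmetric])
    show "finite (wlen m)" by (rule finite_wlen)
    show "\<forall>w\<in>wlen m. finite (?Q w)"
    proof
      fix w assume "w \<in> wlen m"
      then have "finite {y \<in> S. (shift ^^ q) y = rep w}" using finite_preimage_pow rep_S by (simp add: wlen_def)
      then show "finite (?Q w)" by (rule rev_finite_subset) auto
    qed
  qed auto
  also have "(\<Union>w\<in>wlen m. ?Q w) = {y \<in> S. (shift ^^ q) y = rep (pref m y)}"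
    using pref_wlen by auto
  finally show ?thesis .
qed

section \<open>Periodic points and their shadows\<close>

lemma PerD: assumes "x \<in> Per N A q" shows "x \<in> S" "x (k + q) = x k"
  using assms shift_pow_apply[of q x k] by (auto simp: Per_def)

lemma Per_mod: assumes "x \<in> Per N A q" "q > 0" shows "x k = x (k mod q)"
proof (induction k rule: less_induct)
  case (less k)
  show ?case
  proof (cases "k < q")
    case False
    then have "x k = x (k - q)" using PerD(2)[OF assms(1), of "k - q"] by simp
    also have "\<dots> = x ((k - q) mod q)" using less[of "k - q"] False assms(2) by simp
    finally show ?thesis using False by (simp add: le_mod_geq)
  qed simp
qed

text \<open>For periodic \<open>x\<close>, the unique point close to \<open>x\<close> that \<open>shift ^^ q\<close> sends to the representative of its own
  \<open>m\<close>-cylinder.\<close>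

definition shadow :: "nat \<Rightarrow> nat \<Rightarrow> (nat \<Rightarrow> nat) \<Rightarrow> nat \<Rightarrow> nat" where
  "shadow q m x k = (if k < q then x k else rep (pref m x) (k - q))"

lemma shadow_agree:
  assumes x: "x \<in> Per N A q" and k: "k < m + q" shows "shadow q m x k = x k"
proof (cases "k < q")
  case False
  then have "rep (pref m x) (k - q) = x (k - q)" using k by (intro rep_pref_agree PerD[OF x]) simp
  also have "\<dots> = x k" using PerD(2)[OF x, of "k - q"] False by simp
  finally show ?thesis using False by (simp add: shadow_def)
qed (simp add: shadow_def)

lemma shadow_S:
  assumes x: "x \<in> Per N A q" and m: "m > 0" shows "shadow q m x \<in> S"
proof -
  have xS: "x \<in> S" by (rule PerD(1)[OF x])
  have rS: "rep (pref m x) \<in> S" by (rule rep_S[OF pref_words[OF xS]])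
  have "A (shadow q m x k) (shadow q m x (Suc k)) = 1" for k
  proof (cases "Suc k < q + m")
    case True
    then show ?thesis using shadow_agree[OF x] S_trans[OF xS] by simp
  next
    case False
    then have "\<not> k < q" "\<not> Suc k < q" "Suc k - q = Suc (k - q)" using m by auto
    then show ?thesis using S_trans[OF rS, of "k - q"] by (simp add: shadow_def)
  qed
  moreover have "shadow q m x k \<in> {1..N}" for k
    using S_letter[OF xS] S_letter[OF rS] by (simp add: shadow_def)
  ultimately show ?thesis by (simp add: Sigma_A_def)
qed

text \<open>The inverse repeats the first \<open>q\<close> letters of \<open>y\<close> periodically.
  The equation for \<open>y\<close> yields \<open>y (k + q) = y k\<close> for \<open>k < m\<close>,
  so this periodic point has the same first \<open>m\<close> letters as \<open>y\<close>.\<close>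

lemma shadow_bij:
  assumes q: "q > 0" and m: "m > 0"
  shows "bij_betw (shadow q m) (Per N A q) {y \<in> S. (shift ^^ q) y = rep (pref m y)}"
  unfolding bij_betw_def
proof
  show "inj_on (shadow q m) (Per N A q)"
  proof (rule inj_onI)
    fix x y assume xy: "x \<in> Per N A q" "y \<in> Per N A q" "shadow q m x = shadow q m y"
    have "x k = y k" for k
    proof -
      have "x (k mod q) = y (k mod q)" using fun_cong[OF xy(3), of "k mod q"] q by (simp add: shadow_def)
      then show ?thesis using Per_mod[OF xy(1) q, of k] Per_mod[OF xy(2) q, of k] by simp
    qed
    then show "x = y" by (rule ext)
  qed
  have pr: "pref m (shadow q m x) = pref m x" if "x \<in> Per N A q" for x
    using shadow_agree[OF that] by (simp add: pref_eq_iff)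
  show "shadow q m ` Per N A q = {y \<in> S. (shift ^^ q) y = rep (pref m y)}"
  proof (intro equalityI subsetI)
    fix y assume "y \<in> shadow q m ` Per N A q"
    then obtain x where x: "x \<in> Per N A q" "y = shadow q m x" by blast
    have "(shift ^^ q) y = rep (pref m y)"
      unfolding x(2) pr[OF x(1)] by (rule ext) (simp add: shift_pow_apply shadow_def)
    then show "y \<in> {y \<in> S. (shift ^^ q) y = rep (pref m y)}" using shadow_S[OF x(1) m] x(2) by simp
  next
    fix y assume "y \<in> {y \<in> S. (shift ^^ q) y = rep (pref m y)}"
    then have y: "y \<in> S" "(shift ^^ q) y = rep (pref m y)" by auto
    have yq: "y (k + q) = rep (pref m y) k" for k using fun_cong[OF y(2), of k] by (simp add: shift_pow_apply)
    have yper: "y (k + q) = y k" if "k < m" for k using yq[of k] rep_pref_agree[OF y(1) that] by simp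
    define x where "x k = y (k mod q)" for k
    have "A (x k) (x (Suc k)) = 1" for k
    proof (cases "Suc (k mod q) = q")
      case True
      \<comment> \<open>At the end of a period the next letter is \<open>y 0\<close>, which equals
        \<open>y q\<close> because \<open>m > 0\<close>.\<close>
      then have "x (Suc k) = y (Suc (k mod q))" using yper[of 0] m by (simp add: x_def mod_Suc)
      then show ?thesis using S_trans[OF y(1), of "k mod q"] by (simp add: x_def)
    next
      case False
      then show ?thesis using S_trans[OF y(1), of "k mod q"] by (simp add: x_def mod_Suc)
    qed
    then have xS: "x \<in> S" using S_letter[OF y(1)] by (simp add: Sigma_A_def x_def)
    have "(shift ^^ q) x = x" by (rule ext) (simp add: shift_pow_apply x_def)
    then have xP: "x \<in> Per N A q" using xS by (simp add: Per_def)
    have xy: "y k = x k" if "k < m" for k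
      using that
    proof (induction k rule: less_induct)
      case (less k)
      show ?case
      proof (cases "k < q")
        case False
        have "y k = y (k - q)" using yper[of "k - q"] False less.prems by simp
        also have "\<dots> = x (k - q)" using less.IH[of "k - q"] False less.prems q by simp
        also have "\<dots> = x k" using False by (simp add: x_def le_mod_geq)
        finally show ?thesis .
      qed (simp add: x_def)
    qed
    then have "pref m x = pref m y" by (simp add: pref_eq_iff)
    then have "shadow q m x k = y k" for k
      using yq[of "k - q"] by (cases "k < q") (simp_all add: shadow_def x_def)
    then have "y = shadow q m x" by (simp add: fun_eq_iff)
    then show "y \<in> shadow q m ` Per N A q" using xP by blast
  qed
qed

text \<open>Reindexing by \<open>shadow\<close> makes the index set independent of \<open>m\<close>,
  and the limit is taken term by term. The index \<open>Suc m\<close> meets the condition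
  \<open>m > 0\<close> of \<open>shadow_bij\<close>.\<close>

lemma Ttr_tendsto:
  assumes f: "f \<in> Vsp N A" and q: "q > 0"
  shows "Ttr f q \<longlonglongrightarrow> Zper N A f q"
proof -
  have T: "Ttr f q (Suc m) = (\<Sum>x\<in>Per N A q. exp (birk f q (shadow q (Suc m) x)))" for m
    unfolding Ttr_eq by (rule sum.reindex_bij_betw[OF shadow_bij[OF q], symmetric]) simp
  have lim: "(\<lambda>m. birk f q (shadow q (Suc m) x)) \<longlonglongrightarrow> birk f q x" if x: "x \<in> Per N A q" for x
    unfolding birk_def
  proof (rule tendsto_sum)
    fix k assume "k \<in> {..<q}"
    then have k: "k < q" by simp
    show "(\<lambda>m. f ((shift ^^ k) (shadow q (Suc m) x))) \<longlonglongrightarrow> f ((shift ^^ k) x)"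
    proof (rule rep_tendsto[OF f])
      show "(shift ^^ k) x \<in> S" by (rule shift_pow_S[OF PerD(1)[OF x]])
      show "agree m ((shift ^^ k) (shadow q (Suc m) x)) ((shift ^^ k) x)" for m
        unfolding agree_def using k PerD(1)[OF x] shadow_S[OF x] shadow_agree[OF x]
        by (auto intro!: shift_pow_S simp: shift_pow_apply)
    qed
  qed
  have "(\<lambda>m. Ttr f q (Suc m)) \<longlonglongrightarrow> Zper N A f q"
    unfolding T Zper_def by (intro tendsto_sum tendsto_exp lim)
  then show ?thesis by (rule LIMSEQ_imp_Suc)
qed

end

context gauss_sft
begin

lemma synth_unitv: "synth (unitv j) = basis_fun j"
proof (rule ext)
  fix x
  have "(\<lambda>i. unitv j i * basis_fun i x) = (\<lambda>i. if i = j then basis_fun i x else 0)" by (auto simp: unitv_def)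
  then show "synth (unitv j) x = basis_fun j x"
    unfolding synth_def using sums_single[of j "\<lambda>i. basis_fun i x"] by (simp add: sums_iff)
qed

text \<open>On the diagonal the weight in \<open>basis_fun\<close> cancels the one in
  \<open>coef\<close>, leaving \<open>sec\<close> of the \<open>q\<close>-th iterate of
  \<open>ind w\<close> at \<open>w\<close> itself. Absolute convergence allows summation by word
  length, so the trace is the limit of \<open>Ttr\<close>.\<close>

lemma Bm_trace:
  assumes p: "p > 0" and P: "pmat p Bm" and q: "real q > p"
  shows "trp Bm q = Zper N A f q"
proof -
  obtain M where "l1_matrix Bm M" using Bm_l1_matrix .
  then interpret B: l1_matrix Bm M .
  obtain k where k: "q = Suc k" using p q by (cases q) auto
  have LV: "(L ^^ n) g \<in> Vsp N A" if "g \<in> Vsp N A" for n g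
    using that by (induction n) (auto intro: Lop_Vsp[OF fV])
  have bV: "basis_fun j \<in> Vsp N A" for j using synth_Vsp[OF unitv_l1(1)[of j]] by (simp add: synth_unitv)
  have pw: "(app Bm ^^ Suc n) (unitv j) = coef ((L ^^ Suc n) (basis_fun j))" for n j
  proof (induction n)
    case 0
    show ?case by (simp add: app_Bm[OF unitv_l1(1)] synth_unitv)
  next
    case (Suc n)
    let ?g = "(L ^^ Suc n) (basis_fun j)"
    have l: "coef ?g \<in> l1" using B.pow_l1[OF unitv_l1(1), of "Suc n" j] Suc by simp
    have "(app Bm ^^ Suc (Suc n)) (unitv j) = app Bm (coef ?g)" using Suc by simp
    also have "\<dots> = coef (L ?g)" unfolding app_Bm[OF l] synth_coef[OF LV[OF bV] l] ..
    finally show ?case by simp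
  qed
  define h where "h w = sec ((L ^^ q) (ind w)) w" for w
  have e: "(app Bm ^^ q) (unitv i) i = h (W i)" for i
  proof -
    have "(app Bm ^^ q) (unitv i) i = coef ((L ^^ q) (basis_fun i)) i" unfolding k pw ..
    also have "\<dots> = h (W i)"
      using \<rho>_pos[of "W i"] by (simp add: coef_def basis_fun_def Lop_pow_scale sec_lin h_def)
    finally show ?thesis .
  qed
  have "summable (\<lambda>i. cmod (h (W i)))" using trace_tendsto(1)[OF P p q] by (simp add: e)
  from words_sum_limit[OF this] have "Ttr f q \<longlonglongrightarrow> trp Bm q"
    by (simp add: h_def sum_sec_trace trp_def e)
  then show ?thesis using Ttr_tendsto[OF fV, of q] k LIMSEQ_unique by blast
qed

theorem spectrum:
  assumes p: "p > 0" and s: "summable (\<lambda>k. real (card (wlen k)) * (r ^ (2 * k)) powr p)"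
  shows "\<exists>a K. K \<ge> 0 \<and> (\<forall>n. cmod (a (Suc n)) \<le> cmod (a n)) \<and>
    (\<forall>n. cmod (a n) \<le> (K / real (Suc n)) powr (1 / p)) \<and>
    (\<forall>q. real q > p \<longrightarrow> (\<lambda>n. a n ^ q) sums Zper N A f q) \<and>
    (\<forall>\<mu>. \<mu> \<noteq> 0 \<longrightarrow> finite {n. a n = \<mu>} \<and> alg_mult N A f \<mu> = enat (card {n. a n = \<mu>}))"
proof -
  note P = Bm_pmat[OF p s]
  define K where "K = (\<Sum>j. n1 (\<lambda>i. Bm i j) powr p)"
  have K0: "K \<ge> 0" unfolding K_def using P by (intro suminf_nonneg) (auto simp: pmat_def)
  show ?thesis
  proof (rule spectral_sequence[OF P p, folded K_def])
    fix a :: "nat \<Rightarrow> complex"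
    assume a: "\<And>n. cmod (a (Suc n)) \<le> cmod (a n)" "\<And>n. cmod (a n) \<le> (K / real (Suc n)) powr (1 / p)"
      "\<And>q. real q > p \<Longrightarrow> (\<lambda>n. a n ^ q) sums trp Bm q"
    obtain q0 where q0: "real q0 > p" using reals_Archimedean2 by blast
    have sm: "summable (\<lambda>n. cmod (a n) ^ q0)"
      by (rule summable_spectral_sequence[OF P p q0]) (use a(2) in \<open>simp add: K_def\<close>)
    have aq: "(\<lambda>n. a n ^ q) sums trp Bm q" if "q \<ge> q0" for q using that q0 by (intro a(3)) simp
    have "finite {n. a n = \<mu>} \<and> alg_mult N A f \<mu> = enat (card {n. a n = \<mu>})" if "\<mu> \<noteq> 0" for \<mu>
      using finite_fiber(2)[OF sm that] alg_mult_eq[OF that multiplicity_eq_count[OF P p q0 that sm aq]] by blast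
    moreover have "(\<lambda>n. a n ^ q) sums Zper N A f q" if "real q > p" for q
      using a(3)[OF that] Bm_trace[OF p P that] by simp
    ultimately show ?thesis using K0 a(1,2) by (intro exI[of _ a] exI[of _ K]) blast
  qed
qed

end

section \<open>Entropy and the number of words\<close>

context sft
begin

lemma dshift_le:
  assumes "\<And>k. k < s \<Longrightarrow> x k = y k" shows "dshift x y \<le> (1 / 2) ^ s"
proof (cases "x = y")
  case False
  then obtain m where "x m \<noteq> y m" by (auto simp: fun_eq_iff)
  then have "x (LEAST m. x m \<noteq> y m) \<noteq> y (LEAST m. x m \<noteq> y m)" by (rule LeastI)
  then have "s \<le> (LEAST m. x m \<noteq> y m)" using assms by (meson not_le)
  then show ?thesis using False by (simp add: dshift_def power_decreasing)
qed (simp add: dshift_def)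

text \<open>A distance above \<open>(1 / 2)^s\<close> at some time \<open>k < n\<close> requires a
  difference among the first \<open>n + s\<close> letters.\<close>

lemma separated_card:
  assumes E: "finite E" "separated N A n \<epsilon> E" and s: "(1 / 2) ^ s \<le> \<epsilon>"
  shows "card E \<le> N ^ (n + s)"
proof -
  have ES: "E \<subseteq> S" using E by (simp add: separated_def)
  have "inj_on (pref (n + s)) E"
  proof (rule inj_onI, rule ccontr)
    fix x y assume xy: "x \<in> E" "y \<in> E" "pref (n + s) x = pref (n + s) y" "x \<noteq> y"
    then obtain k where k: "k < n" "dshift ((shift ^^ k) x) ((shift ^^ k) y) > \<epsilon>"
      using E(2) unfolding separated_def by blast
    have "dshift ((shift ^^ k) x) ((shift ^^ k) y) \<le> (1 / 2) ^ s"
      by (rule dshift_le) (use xy(3) k(1) in \<open>simp add: shift_pow_apply pref_eq_iff\<close>)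
    then show False using k(2) s by simp
  qed
  then have "card E \<le> card (wlen (n + s))"
    by (rule card_inj_on_le) (use ES pref_wlen finite_wlen in auto)
  then show ?thesis using card_wlen[of "n + s"] by simp
qed

lemma half_power_le: assumes "\<epsilon> > 0" obtains s where "(1 / 2 :: real) ^ s \<le> \<epsilon>"
  using real_arch_pow_inv[OF assms, of "1/2"] by (auto intro: less_imp_le)

lemma sepnum_le:
  assumes s: "(1 / 2) ^ s \<le> \<epsilon>" shows "sepnum N A n \<epsilon> \<le> N ^ (n + s)"
  unfolding sepnum_def
proof (rule cSup_least)
  have "separated N A n \<epsilon> {}" by (simp add: separated_def)
  then show "{card E |E. finite E \<and> separated N A n \<epsilon> E} \<noteq> {}" by blast
qed (use separated_card[OF _ _ s] in auto)

text \<open>Representatives of distinct words of length \<open>n\<close> differ at some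
  \<open>k < n\<close>, and after \<open>k\<close> shifts their distance is
  \<open>1\<close>.\<close>

lemma card_wlen_le_sepnum: "card (wlen n) \<le> sepnum N A n (1 / 2)"
proof -
  let ?E = "rep ` wlen n"
  have pr: "pref n (rep w) = w" "rep w \<in> S" if "w \<in> wlen n" for w
    using that pref_rep[of w] rep_S[of w] by (auto simp: wlen_def)
  have inj: "inj_on rep (wlen n)" by (rule inj_on_inverseI[where g="pref n"]) (rule pr(1))
  have "separated N A n (1 / 2) ?E"
    unfolding separated_def
  proof (intro conjI ballI impI)
    show "?E \<subseteq> S" using pr(2) by blast
    fix x y assume xy: "x \<in> ?E" "y \<in> ?E" "x \<noteq> y"
    then have "pref n x \<noteq> pref n y" using pr(1) by auto
    then obtain k where k: "k < n" "x k \<noteq> y k" by (auto simp: pref_eq_iff)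
    let ?x = "(shift ^^ k) x" and ?y = "(shift ^^ k) y"
    have d: "?x 0 \<noteq> ?y 0" using k(2) by (simp add: shift_pow_apply)
    then have "(LEAST m. ?x m \<noteq> ?y m) = 0" by (intro Least_equality) auto
    moreover have "?x \<noteq> ?y" using d by auto
    ultimately have "dshift ?x ?y = 1" by (simp add: dshift_def)
    then show "\<exists>k<n. dshift ((shift ^^ k) x) ((shift ^^ k) y) > 1 / 2" using k(1) by (intro exI[of _ k]) simp
  qed
  then have mem: "card ?E \<in> {card E |E. finite E \<and> separated N A n (1 / 2) E}" using finite_wlen by blast
  have "bdd_above {card E |E. finite E \<and> separated N A n (1 / 2) E}"
    unfolding bdd_above_def using separated_card[of _ n "1 / 2" 1] by auto
  from cSup_upper[OF mem this] show ?thesis by (simp add: sepnum_def card_image[OF inj])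
qed

text \<open>\<open>real_of_ereal\<close> is faithful only on finite values, so the entropy is first
  shown to lie between \<open>0\<close> and a finite bound; the growth rate then follows from the
  scale \<open>1 / 2\<close> alone.\<close>

lemma card_wlen_growth:
  assumes h: "real_of_ereal (htop N A) < h"
  shows "\<forall>\<^sub>F n in sequentially. real (card (wlen n)) \<le> exp (h * real n)"
proof -
  have N1: "1 \<le> N"
  proof -
    obtain x where "x \<in> S" using nonempty by blast
    then show ?thesis using S_letter[of x 0] by linarith
  qed
  let ?c = "\<lambda>\<epsilon>. limsup (\<lambda>n. ereal (ln (real (sepnum N A n \<epsilon>)) / real n))"
  \<comment> \<open>The factor \<open>2\<close> absorbs the scale: \<open>n + s \<le> 2 n\<close>
    for \<open>n \<ge> s\<close>.\<close>
  have "htop N A \<le> ereal (2 * ln (real N))"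
    unfolding htop_def
  proof (rule SUP_least)
    fix \<epsilon> :: real assume "\<epsilon> \<in> {0<..}"
    then obtain s where s: "(1 / 2) ^ s \<le> \<epsilon>" using half_power_le[of \<epsilon>] by auto
    show "?c \<epsilon> \<le> ereal (2 * ln (real N))"
    proof (rule Limsup_bounded)
      show "\<forall>\<^sub>F n in sequentially. ereal (ln (real (sepnum N A n \<epsilon>)) / real n) \<le> ereal (2 * ln (real N))"
        using eventually_ge_at_top[of "max 1 s"]
      proof eventually_elim
        case (elim n)
        have "ln (real (sepnum N A n \<epsilon>)) \<le> real (n + s) * ln (real N)"
        proof (cases "sepnum N A n \<epsilon> = 0")
          case False
          have "real (sepnum N A n \<epsilon>) \<le> real (N ^ (n + s))" using sepnum_le[OF s, of n] by (simp only: of_nat_le_iff)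
          then have "ln (real (sepnum N A n \<epsilon>)) \<le> ln (real N ^ (n + s))" using False N1 by simp
          then show ?thesis using N1 by (simp add: ln_realpow)
        qed (use N1 in simp)
        also have "\<dots> \<le> real (2 * n) * ln (real N)" using elim N1 by (intro mult_right_mono) auto
        finally show ?case using elim by (simp add: field_simps)
      qed
    qed
  qed
  then have fin: "htop N A < \<infinity>" by auto
  have half: "?c (1 / 2) \<le> htop N A" unfolding htop_def by (rule SUP_upper) simp
  have seppos: "0 < sepnum N A n (1 / 2)" for n
  proof -
    have "0 < card (wlen n)" using wlen_nonempty finite_wlen by (simp add: card_gt_0_iff)
    then show ?thesis using card_wlen_le_sepnum[of n] by linarith
  qed
  have "0 \<le> ?c (1 / 2)"
  proof -
    have "0 \<le> ereal (ln (real (sepnum N A n (1 / 2))) / real n)" for n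
    proof -
      have "1 \<le> sepnum N A n (1 / 2)" using seppos[of n] by linarith
      then have "0 \<le> ln (real (sepnum N A n (1 / 2)))" by (intro ln_ge_zero) simp
      then show ?thesis by simp
    qed
    then have "limsup (\<lambda>n. 0 :: ereal) \<le> ?c (1 / 2)"
      by (intro Limsup_mono always_eventually allI)
    then show ?thesis by (simp add: Limsup_const)
  qed
  then have "0 \<le> htop N A" using half by (rule order_trans)
  then have "htop N A = ereal (real_of_ereal (htop N A))" using fin by (simp add: ereal_real)
  then have "?c (1 / 2) < ereal h" using half h by (metis ereal_less_eq(3) less_ereal.simps(1) order_le_less_trans)
  then have "\<forall>\<^sub>F n in sequentially. ereal (ln (real (sepnum N A n (1 / 2))) / real n) < ereal h"
    by (rule Limsup_lessD)
  then show ?thesis using eventually_gt_at_top[of 0]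
  proof eventually_elim
    case (elim n)
    have "ln (real (sepnum N A n (1 / 2))) < h * real n" using elim by (simp add: field_simps)
    then have "real (sepnum N A n (1 / 2)) < exp (h * real n)" using seppos by (metis exp_less_mono exp_ln of_nat_0_less_iff)
    then show ?case using card_wlen_le_sepnum[of n] by linarith
  qed
qed

lemma wlen_weight_summable:
  assumes r: "0 < r" "r < 1" and p: "0 < p" and lt: "r powr (2 * p) * exp (real_of_ereal (htop N A)) < 1"
  obtains p' where "0 < p'" "p' < p" "summable (\<lambda>k. real (card (wlen k)) * (r ^ (2 * k)) powr p')"
proof -
  define h where "h = real_of_ereal (htop N A)"
  define c where "c = - 2 * ln r"
  have c: "0 < c" using r by (simp add: c_def)
  have rp: "(r ^ (2 * k)) powr x = exp (- c * x * real k)" for x k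
  proof -
    have "(r ^ (2 * k)) powr x = (r powr real (2 * k)) powr x" using r by (simp only: powr_realpow)
    also have "\<dots> = r powr (real (2 * k) * x)" by (simp add: powr_powr)
    also have "\<dots> = exp (- c * x * real k)" using r by (simp add: powr_def c_def)
    finally show ?thesis .
  qed
  have "exp (h - c * p) < 1"
  proof -
    have "r powr (2 * p) = exp (- c * p)" using r by (simp add: powr_def c_def)
    then have "exp (- c * p) * exp h < 1" using lt by (simp only: h_def)
    moreover have "exp (- c * p) * exp h = exp (h - c * p)" by (simp add: exp_add[symmetric])
    ultimately show ?thesis by (simp only:)
  qed
  then have gap: "0 < c * p - h" by simp
  \<comment> \<open>\<open>d\<close> is spent twice, on the entropy and on the exponent: the ratio
    \<open>exp (h + d - c (p - d))\<close> is below \<open>1\<close> exactly if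
    \<open>d (c + 1) < c p - h\<close>.\<close>
  define d where "d = min (p / 2) ((c * p - h) / (2 * (c + 1)))"
  have d: "0 < d" "d < p" using p gap c by (auto simp: d_def)
  have dc: "d * (c + 1) < c * p - h"
  proof -
    have "d * (c + 1) \<le> (c * p - h) / (2 * (c + 1)) * (c + 1)" using c by (intro mult_right_mono) (auto simp: d_def)
    also have "\<dots> = (c * p - h) / 2" using c by (simp add: field_simps)
    also have "\<dots> < c * p - h" using gap by simp
    finally show ?thesis .
  qed
  define x where "x = exp (h + d - c * (p - d))"
  have x: "0 < x" "x < 1" using dc by (auto simp: x_def algebra_simps)
  have "summable (\<lambda>k. real (card (wlen k)) * (r ^ (2 * k)) powr (p - d))"
  proof (rule summable_comparison_test_ev)
    show "summable (\<lambda>k. x ^ k)" using x by (intro summable_geometric) simp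
    have "real_of_ereal (htop N A) < h + d" using d by (simp add: h_def)
    from card_wlen_growth[OF this]
    show "\<forall>\<^sub>F k in sequentially. norm (real (card (wlen k)) * (r ^ (2 * k)) powr (p - d)) \<le> x ^ k"
    proof eventually_elim
      case (elim k)
      have "real (card (wlen k)) * (r ^ (2 * k)) powr (p - d) \<le> exp ((h + d) * real k) * exp (- c * (p - d) * real k)"
        unfolding rp using elim by (intro mult_right_mono) auto
      also have "\<dots> = x ^ k"
        unfolding x_def exp_of_nat_mult[symmetric] exp_add[symmetric] by (rule arg_cong[of _ _ exp]) (simp add: algebra_simps)
      finally show ?case by simp
    qed
  qed
  then show ?thesis using d by (intro that[of "p - d"]) auto
qed

lemma gauss_var_bound:
  assumes f: "f \<in> Vsp N A" and r: "0 < r" "r < 1"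
    and ls: "limsup (\<lambda>m. ereal (var N A f m powr (1 / real m) / r ^ m)) < \<infinity>"
  obtains D0 K0 where "0 < D0" "0 \<le> K0" "\<And>k. var N A f k \<le> K0 * gw r D0 k"
proof -
  obtain C :: nat where "limsup (\<lambda>m. ereal (var N A f m powr (1 / real m) / r ^ m)) < ereal (real C)"
    using less_PInf_Ex_of_nat ls by auto
  from Limsup_lessD[OF this] obtain m0
    where m0: "\<And>m. m \<ge> m0 \<Longrightarrow> var N A f m powr (1 / real m) / r ^ m < real C"
    unfolding eventually_sequentially by auto
  \<comment> \<open>The \<open>1\<close> keeps \<open>D0\<close> positive when
    \<open>C = 0\<close>.\<close>
  define D0 where "D0 = real C + 1"
  have D0: "0 < D0" by (simp add: D0_def)
  have v0: "0 \<le> var N A f m" for m by (rule modulus_nonneg[OF Vsp_modulus(1)[OF f]])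
  have g: "0 < gw r D0 m" for m by (rule gw_pos[OF r(1) D0])
  \<comment> \<open>\<open>m = 0\<close> is excluded because there the exponent
    \<open>1 / real m\<close> is \<open>0\<close>; the finitely many remaining indices go into
    \<open>K0\<close>.\<close>
  have big: "var N A f m \<le> gw r D0 m" if m: "m \<ge> max 1 m0" for m
  proof -
    have "var N A f m powr (1 / real m) \<le> D0 * r ^ m"
    proof -
      have "var N A f m powr (1 / real m) < real C * r ^ m" using m0[of m] m r by (simp add: divide_less_eq)
      also have "\<dots> \<le> D0 * r ^ m" using r by (intro mult_right_mono) (auto simp: D0_def)
      finally show ?thesis by simp
    qed
    then have "(var N A f m powr (1 / real m)) ^ m \<le> (D0 * r ^ m) ^ m" by (intro power_mono) auto
    moreover have "(var N A f m powr (1 / real m)) ^ m = var N A f m"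
      using m v0[of m] by (cases "var N A f m = 0") (auto simp: powr_realpow[symmetric] powr_powr)
    moreover have "(D0 * r ^ m) ^ m = gw r D0 m" by (simp add: gw_def power_mult_distrib power_mult)
    ultimately show ?thesis by simp
  qed
  define K0 where "K0 = 1 + (\<Sum>m<max 1 m0. var N A f m / gw r D0 m)"
  have q0: "0 \<le> var N A f m / gw r D0 m" for m using v0 g by (simp add: less_imp_le)
  have K1: "1 \<le> K0" unfolding K0_def using q0 by (simp add: sum_nonneg)
  have "var N A f m \<le> K0 * gw r D0 m" for m
  proof (cases "m < max 1 m0")
    case True
    then have "var N A f m / gw r D0 m \<le> (\<Sum>m<max 1 m0. var N A f m / gw r D0 m)"
      using q0 by (intro member_le_sum) auto
    then have "var N A f m / gw r D0 m \<le> K0" by (simp add: K0_def)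
    then show ?thesis using g[of m] by (simp add: divide_le_eq)
  next
    case False
    then have "var N A f m \<le> 1 * gw r D0 m" using big[of m] False by (simp only: not_less mult_1)
    also have "\<dots> \<le> K0 * gw r D0 m" using K1 g[of m] by (intro mult_right_mono) auto
    finally show ?thesis .
  qed
  then show ?thesis using D0 K1 by (intro that[of D0 K0]) auto
qed

end

section \<open>Canonical products and the zeta function\<close>

text \<open>Equal finite multiplicities give a bijection between the supports of \<open>b\<close>
  and \<open>a\<close>, fibre by fibre. Zero entries, which may differ in number, contribute nothing
  because \<open>h 0 = 0\<close>.\<close>

lemma has_sum_rearrange:
  fixes a b :: "nat \<Rightarrow> complex" and h :: "complex \<Rightarrow> 'b::real_normed_vector"
  assumes fin: "\<And>\<mu>. \<mu> \<noteq> 0 \<Longrightarrow> finite {n. a n = \<mu>}" "\<And>\<mu>. \<mu> \<noteq> 0 \<Longrightarrow> finite {n. b n = \<mu>}"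
    and card: "\<And>\<mu>. \<mu> \<noteq> 0 \<Longrightarrow> card {n. a n = \<mu>} = card {n. b n = \<mu>}"
    and h0: "h 0 = 0" and s: "((\<lambda>n. h (a n)) has_sum s) UNIV"
  shows "((\<lambda>n. h (b n)) has_sum s) UNIV"
proof -
  have "\<exists>g. bij_betw g {n. b n = \<mu>} {n. a n = \<mu>}" if "\<mu> \<noteq> 0" for \<mu>
    using finite_same_card_bij[OF fin(2)[OF that] fin(1)[OF that]] card[OF that] by simp
  then obtain g where g: "\<And>\<mu>. \<mu> \<noteq> 0 \<Longrightarrow> bij_betw (g \<mu>) {n. b n = \<mu>} {n. a n = \<mu>}" by metis
  define t where "t n = g (b n) n" for n
  have at: "a (t n) = b n" if "b n \<noteq> 0" for n
    using bij_betwE[OF g[OF that]] by (auto simp: t_def)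
  have "bij_betw t {n. b n \<noteq> 0} {n. a n \<noteq> 0}"
    unfolding bij_betw_def
  proof
    show "inj_on t {n. b n \<noteq> 0}"
    proof (rule inj_onI)
      fix m n assume mn: "m \<in> {n. b n \<noteq> 0}" "n \<in> {n. b n \<noteq> 0}" "t m = t n"
      then have e: "b m = b n" using at[of m] at[of n] by simp
      have "inj_on (g (b n)) {k. b k = b n}" using g[of "b n"] mn by (simp add: bij_betw_def)
      then show "m = n" using mn(3) e by (auto simp: t_def inj_on_def)
    qed
    show "t ` {n. b n \<noteq> 0} = {n. a n \<noteq> 0}"
    proof (intro equalityI subsetI)
      fix k assume "k \<in> {n. a n \<noteq> 0}"
      then have k: "a k \<noteq> 0" by simp
      have "k \<in> g (a k) ` {n. b n = a k}" using bij_betw_imp_surj_on[OF g[OF k]] by simp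
      then obtain n where "b n = a k" "k = g (a k) n" by blast
      then show "k \<in> t ` {n. b n \<noteq> 0}" using k by (intro image_eqI[of _ _ n]) (auto simp: t_def)
    qed (use at in auto)
  qed
  from has_sum_reindex_bij_betw[OF this, of "\<lambda>n. h (a n)" s]
  have "((\<lambda>n. h (a (t n))) has_sum s) {n. b n \<noteq> 0} \<longleftrightarrow> ((\<lambda>n. h (a n)) has_sum s) {n. a n \<noteq> 0}" .
  moreover have "((\<lambda>n. h (a n)) has_sum s) {n. a n \<noteq> 0} \<longleftrightarrow> ((\<lambda>n. h (a n)) has_sum s) UNIV"
    by (rule has_sum_cong_neutral) (auto simp: h0)
  moreover have "((\<lambda>n. h (a (t n))) has_sum s) {n. b n \<noteq> 0} \<longleftrightarrow> ((\<lambda>n. h (b n)) has_sum s) UNIV"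
    by (rule has_sum_cong_neutral) (auto simp: h0 at)
  ultimately show ?thesis using s by blast
qed

lemma Efac_eq: "Efac k = weierstrass_factor k"
  by (auto simp: Efac_def weierstrass_factor_def)

text \<open>\<open>E(w, k) - 1\<close> is bounded by \<open>3 |w|^(k + 1)\<close> for
  \<open>|w| \<le> 1 / 2\<close>, so the factors satisfy the Weierstrass test on discs. On a given
  disc the bound holds from some index on, whence the eventual forms of the tests.\<close>

lemma canonical_product:
  fixes lam :: "nat \<Rightarrow> complex"
  assumes sm: "summable (\<lambda>n. cmod (lam n) ^ Suc k)"
  defines "P \<equiv> \<lambda>z. \<Prod>n. Efac k (z * lam n)"
  shows "compact K \<Longrightarrow> uniform_limit K (\<lambda>M z. \<Prod>n<M. Efac k (z * lam n)) P sequentially"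
    "P holomorphic_on UNIV"
proof -
  have small: "\<forall>\<^sub>F n in sequentially. R * cmod (lam n) \<le> 1 / 2" if R: "R \<ge> 0" for R
  proof -
    have lim: "(\<lambda>n. R ^ Suc k * cmod (lam n) ^ Suc k) \<longlonglongrightarrow> R ^ Suc k * 0"
      by (intro tendsto_mult tendsto_const summable_LIMSEQ_zero sm)
    have "\<forall>\<^sub>F n in sequentially. R ^ Suc k * cmod (lam n) ^ Suc k < (1 / 2) ^ Suc k"
      by (rule order_tendstoD(2)[OF lim]) simp
    then show ?thesis
    proof eventually_elim
      case (elim n)
      then have "(R * cmod (lam n)) ^ Suc k \<le> (1 / 2) ^ Suc k" by (simp only: power_mult_distrib less_imp_le)
      then show ?case by (rule power_le_imp_le_base) simp
    qed
  qed
  have bound: "\<forall>\<^sub>F n in sequentially. \<forall>z\<in>cball 0 R. norm (norm (Efac k (z * lam n) - 1)) \<le> 3 * (R * cmod (lam n)) ^ Suc k"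
    if R: "R \<ge> 0" for R
    using small[OF R]
  proof eventually_elim
    case (elim n)
    show ?case
    proof
      fix z :: complex assume "z \<in> cball 0 R"
      then have z: "cmod (z * lam n) \<le> R * cmod (lam n)" unfolding norm_mult by (intro mult_right_mono) auto
      then have "norm (Efac k (z * lam n) - 1) \<le> 3 * cmod (z * lam n) ^ Suc k"
        unfolding Efac_eq using elim by (intro weierstrass_factor_bound) simp
      also have "\<dots> \<le> 3 * (R * cmod (lam n)) ^ Suc k"
        using z by (intro mult_left_mono power_mono) auto
      finally show "norm (norm (Efac k (z * lam n) - 1)) \<le> 3 * (R * cmod (lam n)) ^ Suc k" by simp
    qed
  qed
  have sR: "summable (\<lambda>n. 3 * (R * cmod (lam n)) ^ Suc k)" for R
    unfolding power_mult_distrib by (intro summable_mult sm)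
  have conv: "convergent_prod (\<lambda>n. Efac k (z * lam n))" for z
  proof -
    have "summable (\<lambda>n. norm (Efac k (z * lam n) - 1))"
    proof (rule summable_comparison_test_ev[OF _ sR])
      show "\<forall>\<^sub>F n in sequentially. norm (norm (Efac k (z * lam n) - 1)) \<le> 3 * (cmod z * cmod (lam n)) ^ Suc k"
        using bound[of "cmod z"] by (auto elim: eventually_mono)
    qed
    then show ?thesis
      using abs_convergent_prod_imp_convergent_prod abs_convergent_prod_conv_summable by blast
  qed
  have cont: "continuous_on X (\<lambda>z. Efac k (z * lam n))" for X n
    unfolding Efac_eq weierstrass_factor_def by (intro continuous_intros) auto
  show ul: "uniform_limit K (\<lambda>M z. \<Prod>n<M. Efac k (z * lam n)) P sequentially" if K: "compact K" for K
  proof -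
    obtain R where R: "R > 0" "K \<subseteq> cball 0 R"
      using compact_imp_bounded[OF K] unfolding bounded_pos by (auto simp: subset_iff)
    have "uniformly_convergent_on K (\<lambda>M z. \<Prod>n<M. Efac k (z * lam n))"
    proof (rule uniformly_convergent_on_prod'[OF cont K])
      show "uniformly_convergent_on K (\<lambda>M z. \<Sum>n<M. norm (Efac k (z * lam n) - 1))"
      proof (rule Weierstrass_m_test'_ev[OF _ sR])
        show "\<forall>\<^sub>F n in sequentially. \<forall>z\<in>K. norm (norm (Efac k (z * lam n) - 1)) \<le> 3 * (R * cmod (lam n)) ^ Suc k"
          using bound[of R] R by (auto elim!: eventually_mono)
      qed
    qed
    then obtain g where g: "uniform_limit K (\<lambda>M z. \<Prod>n<M. Efac k (z * lam n)) g sequentially"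
      by (auto simp: uniformly_convergent_on_def)
    have "g z = P z" if "z \<in> K" for z
    proof -
      have "(\<lambda>M. \<Prod>n<M. Efac k (z * lam n)) \<longlonglongrightarrow> g z" using tendsto_uniform_limitI[OF g that] .
      moreover have "(\<lambda>M. \<Prod>n\<le>M. Efac k (z * lam n)) \<longlonglongrightarrow> P z"
        unfolding P_def by (rule convergent_prod_LIMSEQ[OF conv])
      then have "(\<lambda>M. \<Prod>n<M. Efac k (z * lam n)) \<longlonglongrightarrow> P z"
        by (subst (asm) lessThan_Suc_atMost[symmetric]) (rule LIMSEQ_imp_Suc)
      ultimately show ?thesis by (rule LIMSEQ_unique)
    qed
    then show ?thesis using g by (auto simp: uniform_limit_iff)
  qed
  show "P holomorphic_on UNIV"
  proof (rule holomorphic_uniform_sequence[of UNIV "\<lambda>M z. \<Prod>n<M. Efac k (z * lam n)"])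
    show "(\<lambda>z. \<Prod>n<M. Efac k (z * lam n)) holomorphic_on UNIV" for M
      unfolding Efac_eq weierstrass_factor_def by (intro holomorphic_intros) auto
    show "\<exists>d>0. cball x d \<subseteq> UNIV \<and> uniform_limit (cball x d) (\<lambda>M z. \<Prod>n<M. Efac k (z * lam n)) P sequentially" for x
      using ul[OF compact_cball, of x 1] by (intro exI[of _ 1]) auto
  qed auto
qed

lemma Efac_exp_tail:
  assumes w: "cmod w < 1"
  shows "Efac k w = exp (- (\<Sum>j. w ^ (j + Suc k) / of_nat (j + Suc k)))"
    "summable (\<lambda>j. w ^ (j + Suc k) / of_nat (j + Suc k))"
proof -
  have "(\<lambda>n. - (w ^ n / of_nat n)) sums ln (1 - w)"
    using Ln_series'[of "- w"] w by simp
  then have s: "(\<lambda>n. w ^ n / of_nat n) sums (- ln (1 - w))" using sums_minus by fastforce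
  have tail: "(\<lambda>j. w ^ (j + Suc k) / of_nat (j + Suc k)) sums (- ln (1 - w) - (\<Sum>i<Suc k. w ^ i / of_nat i))"
    by (rule sums_split_initial_segment[OF s])
  then show "summable (\<lambda>j. w ^ (j + Suc k) / of_nat (j + Suc k))" by (rule sums_summable)
  have "(\<Sum>i<Suc k. w ^ i / of_nat i) = (\<Sum>i=1..k. w ^ i / of_nat i)"
  proof -
    \<comment> \<open>The term at \<open>0\<close> is a division by zero and has the value
      \<open>0\<close>.\<close>
    have "(\<Sum>i<Suc k. w ^ i / of_nat i) = w ^ 0 / of_nat 0 + (\<Sum>i=1..k. w ^ i / of_nat i)"
      unfolding lessThan_Suc_atMost atMost_atLeast0 by (subst sum.atLeast_Suc_atMost) auto
    then show ?thesis by simp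
  qed
  then have "(\<Sum>j. w ^ (j + Suc k) / of_nat (j + Suc k)) = - ln (1 - w) - (\<Sum>i=1..k. w ^ i / of_nat i)"
    using tail by (simp add: sums_iff)
  moreover have "1 - w \<noteq> 0" using w by auto
  ultimately show "Efac k w = exp (- (\<Sum>j. w ^ (j + Suc k) / of_nat (j + Suc k)))"
    by (simp add: Efac_def exp_add)
qed

text \<open>Each factor is the exponential of minus the logarithmic series without its first
  \<open>k\<close> terms. Interchanging the sums over \<open>n\<close> and \<open>q\<close> produces
  the trace identities for \<open>q > k\<close> only; the terms with \<open>q \<le> k\<close> form
  the polynomial in the prefactor.\<close>

lemma zeta_inverse_eq_product:
  fixes lam :: "nat \<Rightarrow> complex" and Z :: "nat \<Rightarrow> complex"
  assumes sm: "summable (\<lambda>n. cmod (lam n) ^ Suc k)"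
    and Z: "\<And>q. q > k \<Longrightarrow> (\<lambda>n. lam n ^ q) sums Z q"
  shows "\<exists>\<rho>>0. \<forall>z. cmod z < \<rho> \<longrightarrow>
     summable (\<lambda>q. z ^ Suc q / of_nat (Suc q) * Z (Suc q)) \<and>
     inverse (exp (\<Sum>q. z ^ Suc q / of_nat (Suc q) * Z (Suc q)))
       = exp (- (\<Sum>q=1..k. z ^ q / of_nat q * Z q)) * (\<Prod>n. Efac k (z * lam n))"
proof -
  have "Bseq (\<lambda>n. cmod (lam n) ^ Suc k)"
    by (rule convergent_imp_Bseq[OF convergentI[OF summable_LIMSEQ_zero[OF sm]]])
  then obtain B where B: "B > 0" "\<And>n. cmod (lam n) ^ Suc k \<le> B" unfolding Bseq_def by (auto simp: norm_power norm_mult)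
  define C where "C = max 1 B"
  have C: "cmod (lam n) \<le> C" for n
  proof (cases "cmod (lam n) \<le> 1")
    case False
    then have "cmod (lam n) ^ 1 \<le> cmod (lam n) ^ Suc k" by (intro power_increasing) auto
    then show ?thesis using B(2)[of n] by (simp add: C_def)
  qed (simp add: C_def)
  have C1: "1 \<le> C" by (simp add: C_def)
  \<comment> \<open>Keeps all \<open>|z * lam n|\<close> below \<open>1 / 2\<close>, which gives
    geometric domination uniformly in \<open>n\<close>.\<close>
  define \<rho> where "\<rho> = 1 / (2 * C)"
  have \<rho>: "\<rho> > 0" using C1 by (simp add: \<rho>_def)
  show ?thesis
  proof (intro exI[of _ \<rho>] conjI \<rho> allI impI)
    fix z :: complex assume z: "cmod z < \<rho>"
    define w where "w n = z * lam n" for n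
    have w: "cmod (w n) \<le> 1 / 2" for n
    proof -
      have "cmod (w n) \<le> \<rho> * C" unfolding w_def norm_mult using z C \<rho> by (intro mult_mono) auto
      then show ?thesis using C1 by (simp add: \<rho>_def)
    qed
    define T where "T j = z ^ (j + Suc k) / of_nat (j + Suc k) * Z (j + Suc k)" for j
    define a where "a M j = (\<Sum>n<M. w n ^ (j + Suc k) / of_nat (j + Suc k))" for M j
    define Sw where "Sw = (\<Sum>n. cmod (w n) ^ Suc k)"
    have sw: "summable (\<lambda>n. cmod (w n) ^ Suc k)"
      unfolding w_def norm_mult power_mult_distrib by (rule summable_mult[OF sm])
    have alim: "(\<lambda>M. a M j) \<longlonglongrightarrow> T j" for j
    proof -
      have "(\<lambda>n. z ^ (j + Suc k) / of_nat (j + Suc k) * lam n ^ (j + Suc k)) sums T j"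
        unfolding T_def by (intro sums_mult Z) simp
      then show ?thesis unfolding sums_def a_def w_def power_mult_distrib by (simp only: times_divide_eq_left)
    qed
    have adom: "norm (a M j) \<le> Sw * (1 / 2) ^ j" for M j
    proof -
      have "norm (a M j) \<le> (\<Sum>n<M. cmod (w n) ^ Suc k * (1 / 2) ^ j)"
        unfolding a_def
      proof (rule sum_norm_le)
        fix n
        have "norm (w n ^ (j + Suc k) / of_nat (j + Suc k)) \<le> cmod (w n) ^ (j + Suc k) / 1"
          unfolding norm_divide norm_power norm_of_nat by (intro divide_left_mono) auto
        also have "\<dots> = cmod (w n) ^ Suc k * cmod (w n) ^ j" by (simp only: power_add mult.commute div_by_1)
        also have "\<dots> \<le> cmod (w n) ^ Suc k * (1 / 2) ^ j" using w[of n] by (intro mult_left_mono power_mono) auto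
        finally show "norm (w n ^ (j + Suc k) / of_nat (j + Suc k)) \<le> cmod (w n) ^ Suc k * (1 / 2) ^ j" .
      qed
      also have "\<dots> = (\<Sum>n<M. cmod (w n) ^ Suc k) * (1 / 2) ^ j" by (rule sum_distrib_right[symmetric])
      also have "\<dots> \<le> Sw * (1 / 2) ^ j"
        unfolding Sw_def by (intro mult_right_mono sum_le_suminf sw) auto
      finally show ?thesis .
    qed
    have geo: "summable (\<lambda>j. Sw * (1 / 2) ^ j)" by (intro summable_mult summable_geometric) simp
    have sT: "summable T" by (rule summable_norm_cancel[OF suminf_dominated_convergence(1)[OF alim adom geo]])
    have "(\<lambda>M. \<Sum>j. a M j) \<longlonglongrightarrow> suminf T" by (rule suminf_dominated_convergence(2)[OF alim adom geo])
    then have e1: "(\<lambda>M. exp (- (\<Sum>j. a M j))) \<longlonglongrightarrow> exp (- suminf T)" by (intro tendsto_exp tendsto_minus)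
    have w1: "cmod (w n) < 1" for n using w[of n] by linarith
    have "exp (- (\<Sum>j. a M j)) = (\<Prod>n<M. Efac k (w n))" for M
    proof -
      have "(\<Sum>j. a M j) = (\<Sum>n<M. \<Sum>j. w n ^ (j + Suc k) / of_nat (j + Suc k))"
        unfolding a_def by (rule suminf_sum) (rule Efac_exp_tail(2)[OF w1])
      then show ?thesis by (simp add: Efac_exp_tail(1)[OF w1] exp_sum[symmetric] sum_negf)
    qed
    then have "(\<lambda>M. \<Prod>n<M. Efac k (z * lam n)) \<longlonglongrightarrow> exp (- suminf T)" using e1 by (simp add: w_def)
    moreover have "(\<lambda>M. \<Prod>n<M. Efac k (z * lam n)) \<longlonglongrightarrow> (\<Prod>n. Efac k (z * lam n))"
      using tendsto_uniform_limitI[OF canonical_product(1)[OF sm, of "{z}"], of z] by simp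
    ultimately have prod: "(\<Prod>n. Efac k (z * lam n)) = exp (- suminf T)" by (rule LIMSEQ_unique[symmetric])
    define g where "g q = z ^ Suc q / of_nat (Suc q) * Z (Suc q)" for q
    have gT: "(\<lambda>j. g (j + k)) = T" by (simp add: g_def T_def fun_eq_iff)
    have sg: "summable g" using sT summable_iff_shift[of g k] unfolding gT by blast
    then show "summable (\<lambda>q. z ^ Suc q / of_nat (Suc q) * Z (Suc q))" unfolding g_def .
    have "suminf g = (\<Sum>q<k. g q) + suminf T"
      using suminf_split_initial_segment[OF sg, of k] gT by (simp add: add.commute)
    moreover have "(\<Sum>q<k. g q) = (\<Sum>q=1..k. z ^ q / of_nat q * Z q)"
    proof -
      have "(\<Sum>q=1..k. z ^ q / of_nat q * Z q) = (\<Sum>q\<in>Suc ` {..<k}. z ^ q / of_nat q * Z q)"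
        by (rule sum.cong) (auto simp: image_Suc_lessThan)
      also have "\<dots> = (\<Sum>q<k. g q)" by (simp add: sum.reindex g_def del: power_Suc of_nat_Suc)
      finally show ?thesis by simp
    qed
    ultimately have "inverse (exp (suminf g)) = exp (- (\<Sum>q=1..k. z ^ q / of_nat q * Z q)) * exp (- suminf T)"
      by (simp add: exp_minus[symmetric] exp_add[symmetric])
    then show "inverse (exp (\<Sum>q. z ^ Suc q / of_nat (Suc q) * Z (Suc q)))
       = exp (- (\<Sum>q=1..k. z ^ q / of_nat q * Z q)) * (\<Prod>n. Efac k (z * lam n))"
      unfolding prod g_def .
  qed
qed

lemma mpow_row_nonzero: "0 < mpow N A k i j \<Longrightarrow> 0 < k \<Longrightarrow> j \<in> {1..N} \<Longrightarrow> \<exists>l\<in>{1..N}. A i l \<noteq> 0"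
proof (induction k arbitrary: j)
  case (Suc k)
  from Suc.prems(1) have "(\<Sum>l\<in>{1..N}. mpow N A k i l * A l j) \<noteq> 0" by (simp only: mpow.simps)
  then obtain l where l: "l \<in> {1..N}" "mpow N A k i l * A l j \<noteq> 0" by (rule sum.not_neutral_contains_not_neutral)
  show ?case
  proof (cases "k = 0")
    case True
    then have "i = l" "A l j \<noteq> 0" using l by (auto split: if_splits)
    then show ?thesis using Suc.prems(3) by blast
  next
    case False
    then show ?thesis using Suc.IH[of l] l by auto
  qed
qed simp

text \<open>A positive power of \<open>A\<close> leaves no zero row, so every letter has a successor
  and an infinite path can be chosen letter by letter.\<close>

lemma Sigma_A_nonempty:
  assumes N: "N \<ge> 1" and A: "zero_one_matrix N A" "aperiodic N A"
  shows "Sigma_A N A \<noteq> {}"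
proof -
  obtain k where k: "k > 0" "\<And>i j. i \<in> {1..N} \<Longrightarrow> j \<in> {1..N} \<Longrightarrow> mpow N A k i j > 0"
    using A(2) unfolding aperiodic_def by blast
  have succ: "\<exists>l\<in>{1..N}. A i l = 1" if i: "i \<in> {1..N}" for i
  proof -
    obtain l where "l \<in> {1..N}" "A i l \<noteq> 0" using mpow_row_nonzero[OF k(2)[OF i i] k(1) i] by blast
    moreover from this have "A i l = 1" using A(1) i unfolding zero_one_matrix_def by (metis atLeastAtMost_iff)
    ultimately show ?thesis by blast
  qed
  obtain \<omega> where "\<And>n. \<omega> n \<in> {1..N}" "\<And>n. A (\<omega> n) (\<omega> (Suc n)) = 1"
    using dependent_nat_choice[of "\<lambda>_ i. i \<in> {1..N}" "\<lambda>_ i j. A i j = 1"] succ N by (metis atLeastAtMost_iff order_refl)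
  then have "\<omega> \<in> Sigma_A N A" by (simp add: Sigma_A_def)
  then show ?thesis by blast
qed

text \<open>Any two enumerations of the spectrum share all nonzero multiplicities. What is proved
  for the constructed sequence thus passes to every \<open>lam\<close> in the theorem.\<close>

lemma eig_seq_same_sums:
  fixes h :: "complex \<Rightarrow> 'b::banach"
  assumes a: "eig_seq N A f a" and b: "eig_seq N A f b" and h0: "h 0 = 0"
    and sm: "summable (\<lambda>n. norm (h (a n)))"
  shows "(\<lambda>n. h (b n)) sums (\<Sum>n. h (a n))"
proof -
  have "((\<lambda>n. h (a n)) has_sum (\<Sum>n. h (a n))) UNIV"
    by (rule norm_summable_imp_has_sum[OF sm summable_sums[OF summable_norm_cancel[OF sm]]])
  then have "((\<lambda>n. h (b n)) has_sum (\<Sum>n. h (a n))) UNIV"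
  proof (rule has_sum_rearrange[rotated -1])
    show "card {n. a n = \<mu>} = card {n. b n = \<mu>}" if "\<mu> \<noteq> 0" for \<mu>
    proof -
      have "enat (card {n. a n = \<mu>}) = enat (card {n. b n = \<mu>})"
        using a b that unfolding eig_seq_def by metis
      then show ?thesis by simp
    qed
  qed (use a b h0 in \<open>auto simp: eig_seq_def\<close>)
  then show ?thesis by (rule has_sum_imp_sums)
qed

theorem theorem1p2:
  fixes N :: nat and A :: "nat \<Rightarrow> nat \<Rightarrow> nat" and f :: "(nat \<Rightarrow> nat) \<Rightarrow> complex"
    and r p :: real
  assumes "N \<ge> 2" and "zero_one_matrix N A" and "aperiodic N A"
    and "f \<in> Vsp N A"
    and "0 < r" and "r < 1"
    and "limsup (\<lambda>m. ereal (var N A f m powr (1 / real m) / r ^ m)) < \<infinity>"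
    and "p > 0"
    and "r powr (2 * p) * exp (real_of_ereal (htop N A)) < 1"
  shows "(\<exists>lam. eig_seq N A f lam) \<and>
    (\<forall>lam. eig_seq N A f lam \<longrightarrow>
      summable (\<lambda>n. cmod (lam n) powr p) \<and>
      (\<forall>q::nat. q \<ge> 1 \<and> real q \<ge> p \<longrightarrow> (\<lambda>n. lam n ^ q) sums Zper N A f q) \<and>
      (let k0 = (LEAST k::nat. summable (\<lambda>n. cmod (lam n) ^ (k + 1)) \<and>
                    (\<forall>q::nat. q > k \<longrightarrow> (\<lambda>n. lam n ^ q) sums Zper N A f q));
           F = (\<lambda>z. exp (- (\<Sum>q=1..k0. z ^ q / of_nat q * Zper N A f q))
                     * (\<Prod>n. Efac k0 (z * lam n)))
       in (\<forall>K. compact K \<longrightarrow>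
             uniform_limit K (\<lambda>M z. \<Prod>n<M. Efac k0 (z * lam n))
                             (\<lambda>z. \<Prod>n. Efac k0 (z * lam n)) sequentially) \<and>
          F holomorphic_on UNIV \<and>
          (\<exists>\<rho>>0. \<forall>z. cmod z < \<rho> \<longrightarrow>
             summable (\<lambda>q. z ^ Suc q / of_nat (Suc q) * Zper N A f (Suc q)) \<and>
             inverse (exp (\<Sum>q. z ^ Suc q / of_nat (Suc q) * Zper N A f (Suc q))) = F z)))"
proof -
  have ne: "Sigma_A N A \<noteq> {}" using assms(1-3) by (intro Sigma_A_nonempty) auto
  interpret sft N A by unfold_locales (rule ne)
  obtain D0 K0 where DK: "0 < D0" "0 \<le> K0" "\<And>k. var N A f k \<le> K0 * gw r D0 k"
    using gauss_var_bound[OF assms(4-7)] by metis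
  interpret gauss_sft N A f r D0 K0 by unfold_locales (use assms(4-6) DK in auto)
  obtain p' where p': "0 < p'" "p' < p" "summable (\<lambda>k. real (card (wlen k)) * (r ^ (2 * k)) powr p')"
    using wlen_weight_summable[OF assms(5,6,8,9)] by metis
  obtain a K where K: "K \<ge> 0" and mono: "\<And>n. cmod (a (Suc n)) \<le> cmod (a n)"
    and decay: "\<And>n. cmod (a n) \<le> (K / real (Suc n)) powr (1 / p')"
    and trace: "\<And>q. real q > p' \<Longrightarrow> (\<lambda>n. a n ^ q) sums Zper N A f q"
    and mult: "\<And>\<mu>. \<mu> \<noteq> 0 \<Longrightarrow> finite {n. a n = \<mu>} \<and> alg_mult N A f \<mu> = enat (card {n. a n = \<mu>})"
    using spectrum[OF p'(1,3)] by blast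
  have a: "eig_seq N A f a" using mono mult by (simp add: eig_seq_def)
  have powr_sm: "summable (\<lambda>n. cmod (a n) powr x)" if "x > p'" for x
    by (rule summable_power_of_decay[OF decay K p'(1) that])
  have lam_trace: "summable (\<lambda>n. cmod (lam n) ^ q) \<and> (\<lambda>n. lam n ^ q) sums Zper N A f q"
    if lam: "eig_seq N A f lam" and q: "q \<ge> 1" "real q > p'" for lam q
  proof
    have sm: "summable (\<lambda>n. cmod (a n) ^ q)" using powr_sm[OF q(2)] q(1) by (simp add: cmod_powr_nat)
    show "summable (\<lambda>n. cmod (lam n) ^ q)"
      by (rule sums_summable[OF eig_seq_same_sums[OF a lam, of "\<lambda>x. cmod x ^ q"]]) (use sm q in auto)
    have "(\<lambda>n. lam n ^ q) sums (\<Sum>n. a n ^ q)"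
      by (rule eig_seq_same_sums[OF a lam]) (use sm q in \<open>auto simp: norm_power\<close>)
    then show "(\<lambda>n. lam n ^ q) sums Zper N A f q" using trace[OF q(2)] by (simp add: sums_iff)
  qed
  show ?thesis
    unfolding Let_def
  proof (intro conjI allI impI)
    show "\<exists>lam. eig_seq N A f lam" using a by blast
    fix lam assume lam: "eig_seq N A f lam"
    show "summable (\<lambda>n. cmod (lam n) powr p)"
      by (rule sums_summable[OF eig_seq_same_sums[OF a lam, of "\<lambda>x. cmod x powr p"]])
        (use powr_sm[OF p'(2)] in auto)
    show "(\<lambda>n. lam n ^ q) sums Zper N A f q" if "q \<ge> 1 \<and> real q \<ge> p" for q
      using lam_trace[OF lam, of q] p'(2) that by simp
    let ?Q = "\<lambda>k. summable (\<lambda>n. cmod (lam n) ^ (k + 1)) \<and>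
      (\<forall>q::nat. q > k \<longrightarrow> (\<lambda>n. lam n ^ q) sums Zper N A f q)"
    let ?k0 = "LEAST k. ?Q k"
    \<comment> \<open>The minimum defining \<open>k0\<close> needs a witness: every exponent above
      the rounded \<open>p\<close> exceeds \<open>p'\<close>.\<close>
    have "?Q (nat \<lceil>p\<rceil>)"
    proof (intro conjI allI impI)
      have c: "p' < real (nat \<lceil>p\<rceil>)" using p' by linarith
      show "summable (\<lambda>n. cmod (lam n) ^ (nat \<lceil>p\<rceil> + 1))" using lam_trace[OF lam, of "nat \<lceil>p\<rceil> + 1"] c by simp
      show "(\<lambda>n. lam n ^ q) sums Zper N A f q" if "q > nat \<lceil>p\<rceil>" for q
        using lam_trace[OF lam, of q] c that by simp
    qed
    then have k0: "?Q ?k0" by (rule LeastI[of ?Q])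
    have sm: "summable (\<lambda>n. cmod (lam n) ^ Suc ?k0)" unfolding Suc_eq_plus1 by (rule conjunct1[OF k0])
    note Z = conjunct2[OF k0, rule_format]
    show "uniform_limit K (\<lambda>M z. \<Prod>n<M. Efac ?k0 (z * lam n)) (\<lambda>z. \<Prod>n. Efac ?k0 (z * lam n)) sequentially"
      if "compact K" for K
      by (rule canonical_product(1)[OF sm that])
    have "(\<lambda>z. exp (- (\<Sum>q=1..k. z ^ q / of_nat q * Zper N A f q))) holomorphic_on UNIV" for k
      by (intro holomorphic_intros) auto
    then show "(\<lambda>z. exp (- (\<Sum>q=1..?k0. z ^ q / of_nat q * Zper N A f q)) * (\<Prod>n. Efac ?k0 (z * lam n))) holomorphic_on UNIV"
      by (rule holomorphic_on_mult[OF _ canonical_product(2)[OF sm]])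
    show "\<exists>\<rho>>0. \<forall>z. cmod z < \<rho> \<longrightarrow>
       summable (\<lambda>q. z ^ Suc q / of_nat (Suc q) * Zper N A f (Suc q)) \<and>
       inverse (exp (\<Sum>q. z ^ Suc q / of_nat (Suc q) * Zper N A f (Suc q)))
         = exp (- (\<Sum>q=1..?k0. z ^ q / of_nat q * Zper N A f q)) * (\<Prod>n. Efac ?k0 (z * lam n))"
      by (rule zeta_inverse_eq_product[OF sm Z])
  qed
qed

end
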